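(* Let $L>0$, let $P\in H^2(0,L)$ be real-valued with $P(x)\ge P^0>0$ on $[0,L]$ for some constant $P^0$, and let $\theta_1,\theta_2,\theta_3,\theta_4\in\mathbb R$. Let $\mathcal H=\{(w,v,\xi,\psi): w\in H^2(0,L),\ v\in H^1(0,L),\ \xi=v(L),\ \psi=v(0)\}$ with the natural inner product $\langle z_1,z_2\rangle=\langle w_1,w_2\rangle_{H^2}+\langle v_1,v_2\rangle_{H^1}+\xi_1\bar\xi_2+\psi_1\bar\psi_2$. Define $F[w,v]=\theta_1v(0)+\theta_2v'(0)+\theta_3w(0)+\theta_4w'(0)$ and the operator $A$ by $A(w,v,\xi,\psi)=(v,(Pw')',-w'(L),F[w,v])$ on the domain $$D(A)=\{(w,v,\xi,\psi): w\in H^3(0,L),\ v\in H^2(0,L),\ \xi=v(L),\ \psi=v(0),\ (Pw')'(L)=-w'(L),\ (Pw')'(0)=F[w,v]\}.$$ Suppose there are constants $a,b>0$ with $(a+b-1)^2<4ab$ such that $\theta_1=\theta_3/b-a$ and $\theta_2=\theta_4/b$, and suppose $\theta_1,\theta_3<0$ and $\theta_2,\theta_4>0$. Then $A$ is the infinitesimal generator of a $C_0$-semigroup of uniformly bounded operators $\{T(t)\}_{t\ge0}$ on $\mathcal H$.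
   Context: $\mathcal H$ is a complex Hilbert space, a closed subspace of $H^2(0,L)\times H^1(0,L)\times\mathbb C\times\mathbb C$. Prime denotes $d/dx$. This operator encodes the rescaled closed-loop gantry crane system $\partial_t^2 w=\partial_x(P\partial_x w)$, $\partial_t^2w(t,L)=-\partial_xw(t,L)$, $\partial_t^2w(t,0)=\theta_1 v(t,0)+\theta_2\partial_xv(t,0)+\theta_3w(t,0)+\theta_4\partial_xw(t,0)$ with $v=\partial_tw$. *)

theory Defs
  imports "HOL-Analysis.Analysis"
begin

definition L2 :: "real \<Rightarrow> (real \<Rightarrow> 'a::{banach,second_countable_topology}) \<Rightarrow> bool" where
  "L2 L f \<longleftrightarrow> set_borel_measurable lborel {0..L} f \<and>
               set_integrable lborel {0..L} (\<lambda>x. (norm (f x))\<^sup>2)"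

text \<open>H^0 = L^2; H^(k+1) = functions that on [0,L] are the primitive of an H^k function
  (i.e. absolutely continuous with weak derivative in H^k); the pointwise values are those
  of the continuous representative.\<close>
fun sob :: "nat \<Rightarrow> real \<Rightarrow> (real \<Rightarrow> 'a::{banach,second_countable_topology}) \<Rightarrow> bool" where
  "sob 0 L f = L2 L f"
| "sob (Suc k) L f = (\<exists>g. sob k L g \<and> (\<forall>x\<in>{0..L}. f x = f 0 + (LINT t:{0..x}|lborel. g t)))"

text \<open>A weak derivative (L^2 witness) of an H^1 function (unique a.e.).\<close>
definition wd :: "real \<Rightarrow> (real \<Rightarrow> 'a::{banach,second_countable_topology}) \<Rightarrow> real \<Rightarrow> 'a" where
  "wd L f = (SOME g. L2 L g \<and> (\<forall>x\<in>{0..L}. f x = f 0 + (LINT t:{0..x}|lborel. g t)))"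

text \<open>Classical (one-sided at the end points) derivative on [0,L]; used for H^2 functions,
  which are C^1 on [0,L].\<close>
definition dd :: "real \<Rightarrow> (real \<Rightarrow> 'a::real_normed_vector) \<Rightarrow> real \<Rightarrow> 'a" where
  "dd L f x = vector_derivative f (at x within {0..L})"

definition l2sq :: "real \<Rightarrow> (real \<Rightarrow> complex) \<Rightarrow> real" where
  "l2sq L f = (LINT x:{0..L}|lborel. (cmod (f x))\<^sup>2)"

definition h1sq :: "real \<Rightarrow> (real \<Rightarrow> complex) \<Rightarrow> real" where
  "h1sq L f = l2sq L f + l2sq L (wd L f)"

definition h2sq :: "real \<Rightarrow> (real \<Rightarrow> complex) \<Rightarrow> real" where
  "h2sq L f = l2sq L f + h1sq L (dd L f)"

record st =
  sw :: "real \<Rightarrow> complex"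
  sv :: "real \<Rightarrow> complex"
  sxi :: complex
  spsi :: complex

definition st_add :: "st \<Rightarrow> st \<Rightarrow> st" where
  "st_add z1 z2 = \<lparr>sw = (\<lambda>x. sw z1 x + sw z2 x), sv = (\<lambda>x. sv z1 x + sv z2 x),
                   sxi = sxi z1 + sxi z2, spsi = spsi z1 + spsi z2\<rparr>"

definition st_scale :: "complex \<Rightarrow> st \<Rightarrow> st" where
  "st_scale c z = \<lparr>sw = (\<lambda>x. c * sw z x), sv = (\<lambda>x. c * sv z x),
                   sxi = c * sxi z, spsi = c * spsi z\<rparr>"

definition st_diff :: "st \<Rightarrow> st \<Rightarrow> st" where
  "st_diff z1 z2 = st_add z1 (st_scale (-1) z2)"

text \<open>The space \<H> (elements are identified when they agree on [0,L], i.e. when the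
  H-norm of their difference vanishes).\<close>
definition Hsp :: "real \<Rightarrow> st set" where
  "Hsp L = {z. sob 2 L (sw z) \<and> sob 1 L (sv z) \<and> sxi z = sv z L \<and> spsi z = sv z 0}"

definition Hnorm :: "real \<Rightarrow> st \<Rightarrow> real" where
  "Hnorm L z = sqrt (h2sq L (sw z) + h1sq L (sv z) + (cmod (sxi z))\<^sup>2 + (cmod (spsi z))\<^sup>2)"

definition Heq :: "real \<Rightarrow> st \<Rightarrow> st \<Rightarrow> bool" where
  "Heq L z1 z2 \<longleftrightarrow> Hnorm L (st_diff z1 z2) = 0"

definition Fb :: "real \<Rightarrow> real \<Rightarrow> real \<Rightarrow> real \<Rightarrow> real \<Rightarrow> st \<Rightarrow> complex" where
  "Fb L th1 th2 th3 th4 z =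
     of_real th1 * sv z 0 + of_real th2 * dd L (sv z) 0 + of_real th3 * sw z 0 + of_real th4 * dd L (sw z) 0"

definition flux_d :: "real \<Rightarrow> (real \<Rightarrow> real) \<Rightarrow> (real \<Rightarrow> complex) \<Rightarrow> real \<Rightarrow> complex" where
  "flux_d L P w = dd L (\<lambda>x. of_real (P x) * dd L w x)"

definition DA :: "real \<Rightarrow> (real \<Rightarrow> real) \<Rightarrow> real \<Rightarrow> real \<Rightarrow> real \<Rightarrow> real \<Rightarrow> st set" where
  "DA L P th1 th2 th3 th4 = {z. sob 3 L (sw z) \<and> sob 2 L (sv z) \<and> sxi z = sv z L \<and> spsi z = sv z 0
       \<and> flux_d L P (sw z) L = - dd L (sw z) L
       \<and> flux_d L P (sw z) 0 = Fb L th1 th2 th3 th4 z}"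

definition Aop :: "real \<Rightarrow> (real \<Rightarrow> real) \<Rightarrow> real \<Rightarrow> real \<Rightarrow> real \<Rightarrow> real \<Rightarrow> st \<Rightarrow> st" where
  "Aop L P th1 th2 th3 th4 z =
     \<lparr>sw = sv z, sv = flux_d L P (sw z), sxi = - dd L (sw z) L, spsi = Fb L th1 th2 th3 th4 z\<rparr>"

definition c0_semigroup :: "real \<Rightarrow> (real \<Rightarrow> st \<Rightarrow> st) \<Rightarrow> bool" where
  "c0_semigroup L T \<longleftrightarrow>
     (\<forall>t\<ge>0. \<forall>z\<in>Hsp L. T t z \<in> Hsp L)
   \<and> (\<forall>t\<ge>0. \<forall>z1\<in>Hsp L. \<forall>z2\<in>Hsp L. \<forall>c::complex.
        Heq L (T t (st_add z1 (st_scale c z2))) (st_add (T t z1) (st_scale c (T t z2))))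
   \<and> (\<forall>t\<ge>0. \<exists>M. \<forall>z\<in>Hsp L. Hnorm L (T t z) \<le> M * Hnorm L z)
   \<and> (\<forall>z\<in>Hsp L. Heq L (T 0 z) z)
   \<and> (\<forall>t\<ge>0. \<forall>s\<ge>0. \<forall>z\<in>Hsp L. Heq L (T (t + s) z) (T t (T s z)))
   \<and> (\<forall>z\<in>Hsp L. ((\<lambda>t. Hnorm L (st_diff (T t z) z)) \<longlongrightarrow> 0) (at_right 0))"

definition uniformly_bounded :: "real \<Rightarrow> (real \<Rightarrow> st \<Rightarrow> st) \<Rightarrow> bool" where
  "uniformly_bounded L T \<longleftrightarrow> (\<exists>M. \<forall>t\<ge>0. \<forall>z\<in>Hsp L. Hnorm L (T t z) \<le> M * Hnorm L z)"

definition is_generator :: "real \<Rightarrow> st set \<Rightarrow> (st \<Rightarrow> st) \<Rightarrow> (real \<Rightarrow> st \<Rightarrow> st) \<Rightarrow> bool" where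
  "is_generator L D A T \<longleftrightarrow>
     D \<subseteq> Hsp L
   \<and> (\<forall>z\<in>Hsp L. z \<in> D \<longleftrightarrow>
        (\<exists>y\<in>Hsp L. ((\<lambda>h. Hnorm L (st_diff (st_scale (of_real (1/h)) (st_diff (T h z) z)) y))
                       \<longlongrightarrow> 0) (at_right 0)))
   \<and> (\<forall>z\<in>D. A z \<in> Hsp L \<and>
        ((\<lambda>h. Hnorm L (st_diff (st_scale (of_real (1/h)) (st_diff (T h z) z)) (A z)))
           \<longlongrightarrow> 0) (at_right 0))"

end

theory Submission
  imports Defs
begin

text \<open>
  With \<open>v = w\<^sub>t\<close>, the function \<open>u = v + b w\<close> solves the same wave equation as \<open>w\<close>, and the relations
  between the parameters turn the boundary condition at \<open>0\<close> into
  \<open>v\<^sub>t(0) + a v(0) = (\<theta>\<^sub>3 u(0) + \<theta>\<^sub>4 u'(0)) / b\<close>. Hence the energy of \<open>u\<close>,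
  \<open>\<integral> P |u'|\<^sup>2 + |u\<^sub>t|\<^sup>2 + P(L) |w'(L) - b v(L)|\<^sup>2 + c\<^sub>1 |v(0)|\<^sup>2 + c\<^sub>2 |u(0)|\<^sup>2\<close>
  with \<open>c\<^sub>1 = P(0) b (a + b) / \<theta>\<^sub>4\<close> and \<open>c\<^sub>2 = - P(0) \<theta>\<^sub>3 / \<theta>\<^sub>4\<close>, decreases at the rate
  \<open>2 P(0) b / \<theta>\<^sub>4 (|v\<^sub>t(0)|\<^sup>2 + a b |v(0)|\<^sup>2)\<close>. Expanding the squares shows that it is equivalent to the
  square of the norm of the state space. The generator has an explicit bounded inverse, obtained by integrating
  twice, so dissipativity and the projection theorem give the resolvents and the density of the domain, and the
  Yosida approximations converge to the semigroup.
\<close>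

section \<open>Bounded operators\<close>

text \<open>The state space lies one derivative above the usual energy space of the wave equation,
  because the feedback contains \<open>v'(0)\<close>, which has no meaning there. The energy of
  \<open>v + b w\<close> makes up for this: \<open>v\<close> already is a time derivative, so that
  energy sees \<open>v'\<close> and \<open>(P w')'\<close>. Its term at \<open>L\<close> is
  \<open>P(L) |u_t(L)|^2\<close>, as \<open>u_t(L) = b v(L) - w'(L)\<close>, and it absorbs the flux
  through that end. The constants \<open>c1\<close> and \<open>c2\<close> are those for which the
  cross terms at \<open>0\<close>, of \<open>v_t(0)\<close> with \<open>v(0)\<close> and of
  \<open>u_t(0)\<close> with \<open>u(0)\<close>, cancel and only squares remain. States are stored
  through square integrable derivatives and a few end point values, from which the functions are
  rebuilt by integration. Thus \<open>L^2\<close> is the only function space to be constructed, and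
  completeness of the state space comes from a product. All spaces are treated as real; complex
  linearity is recovered from the fact that multiplication by a complex number commutes with the
  inverse of the generator.\<close>

instance prod :: (topological_space, perfect_space) perfect_space
proof
  fix x :: "'a \<times> 'b"
  show "\<not> open {x}"
  proof
    assume "open {x}"
    then have "open (snd ` {x})" by (rule open_image_snd)
    then show False by (simp add: not_open_singleton)
  qed
qed

text \<open>The algebra structure makes \<^const>\<open>exp\<close> available.\<close>

typedef (overloaded) 'a blinop = "UNIV :: ('a::real_normed_vector \<Rightarrow>\<^sub>L 'a) set" by simp

setup_lifting type_definition_blinop

lift_definition oapp :: "'a::real_normed_vector blinop \<Rightarrow> 'a \<Rightarrow> 'a" is blinfun_apply .

instantiation blinop :: (real_normed_vector) real_normed_vector
begin
lift_definition zero_blinop :: "'a blinop" is 0 .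
lift_definition plus_blinop :: "'a blinop \<Rightarrow> 'a blinop \<Rightarrow> 'a blinop" is "(+)" .
lift_definition minus_blinop :: "'a blinop \<Rightarrow> 'a blinop \<Rightarrow> 'a blinop" is "(-)" .
lift_definition uminus_blinop :: "'a blinop \<Rightarrow> 'a blinop" is uminus .
lift_definition scaleR_blinop :: "real \<Rightarrow> 'a blinop \<Rightarrow> 'a blinop" is "(*\<^sub>R)" .
lift_definition norm_blinop :: "'a blinop \<Rightarrow> real" is norm .
lift_definition dist_blinop :: "'a blinop \<Rightarrow> 'a blinop \<Rightarrow> real" is dist .
lift_definition sgn_blinop :: "'a blinop \<Rightarrow> 'a blinop" is sgn .
definition uniformity_blinop :: "('a blinop \<times> 'a blinop) filter"
  where "uniformity_blinop = (INF e\<in>{0<..}. principal {(x, y). dist x y < e})"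
definition open_blinop :: "'a blinop set \<Rightarrow> bool"
  where "open_blinop S = (\<forall>x\<in>S. \<forall>\<^sub>F (x', y) in uniformity. x' = x \<longrightarrow> y \<in> S)"
instance
  apply standard
  unfolding uniformity_blinop_def open_blinop_def
  by (transfer, simp add: algebra_simps norm_triangle_ineq dist_norm sgn_div_norm; fail | rule refl)+
end

instance blinop :: (banach) banach
proof
  fix X :: "nat \<Rightarrow> 'a blinop"
  assume "Cauchy X"
  then have "Cauchy (\<lambda>n. Rep_blinop (X n))"
    unfolding Cauchy_def dist_norm by (simp add: norm_blinop.rep_eq minus_blinop.rep_eq)
  then obtain l where "(\<lambda>n. Rep_blinop (X n)) \<longlonglongrightarrow> l"
    using Cauchy_convergent_iff convergent_def by blast
  then have "X \<longlonglongrightarrow> Abs_blinop l"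
    unfolding LIMSEQ_def dist_norm by (simp add: norm_blinop.rep_eq minus_blinop.rep_eq Abs_blinop_inverse)
  then show "convergent X" by (auto simp: convergent_def)
qed

text \<open>In a \<open>perfect_space\<close> some vector has norm 1, so the identity has norm 1 and
  differs from 0. The product instance above carries this over to the coordinate space, whose last
  factor is the complex plane.\<close>

instantiation blinop :: ("{real_normed_vector,perfect_space}") real_normed_algebra_1
begin
lift_definition one_blinop :: "'a blinop" is id_blinfun .
lift_definition times_blinop :: "'a blinop \<Rightarrow> 'a blinop \<Rightarrow> 'a blinop" is blinfun_compose .
instance
proof
  fix A B D :: "'a blinop" and r :: real
  show "A * B * D = A * (B * D)" by transfer (auto intro: blinfun_eqI)
  show "(A + B) * D = A * D + B * D" by transfer (auto intro: blinfun_eqI simp: blinfun.bilinear_simps)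
  show "A * (B + D) = A * B + A * D" by transfer (auto intro: blinfun_eqI simp: blinfun.bilinear_simps)
  show "r *\<^sub>R A * B = r *\<^sub>R (A * B)" by transfer (auto intro: blinfun_eqI simp: blinfun.bilinear_simps)
  show "A * r *\<^sub>R B = r *\<^sub>R (A * B)" by transfer (auto intro: blinfun_eqI simp: blinfun.bilinear_simps)
  show "1 * A = A" by transfer (auto intro: blinfun_eqI)
  show "A * 1 = A" by transfer (auto intro: blinfun_eqI)
  show "norm (1 :: 'a blinop) = 1" by transfer simp
  then show "(0 :: 'a blinop) \<noteq> 1" by (metis norm_zero zero_neq_one)
  show "norm (A * B) \<le> norm A * norm B" by transfer (rule norm_blinfun_compose)
qed
end

lemma oapp_simps [simp]:
  "oapp (A * B) x = oapp A (oapp B x)"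
  "oapp 1 x = x"
  "oapp (r *\<^sub>R A') z = r *\<^sub>R oapp A' z"
  "oapp (A' + B') z = oapp A' z + oapp B' z"
  "oapp (A' - B') z = oapp A' z - oapp B' z"
  "oapp (- A') z = - oapp A' z"
  "oapp 0 z = 0"
  by (transfer; simp add: blinfun.bilinear_simps)+

lemma bounded_bilinear_oapp: "bounded_bilinear oapp"
proof
  show "\<exists>K. \<forall>A x. norm (oapp A x) \<le> norm A * norm x * K"
    by (rule exI[of _ 1], transfer) (simp add: norm_blinfun)
qed (transfer; simp add: blinfun.bilinear_simps)+

lemmas bounded_linear_oapp_left = bounded_bilinear.bounded_linear_left[OF bounded_bilinear_oapp]
  and bounded_linear_oapp_right = bounded_bilinear.bounded_linear_right[OF bounded_bilinear_oapp]

lemma exp_commuting: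
  fixes A B :: "'a::{real_normed_algebra_1,banach}"
  assumes "A * B = B * A"
  shows "exp A * B = B * exp A"
proof -
  have p: "A ^ n * B = B * A ^ n" for n
    by (induction n) (simp_all add: assms mult.assoc, metis assms mult.assoc)
  have "(\<lambda>n. (A ^ n /\<^sub>R fact n) * B) sums (exp A * B)"
    by (intro sums_mult2 exp_converges)
  moreover have "(\<lambda>n. B * (A ^ n /\<^sub>R fact n)) sums (B * exp A)"
    by (intro sums_mult exp_converges)
  ultimately show ?thesis
    using p by (simp add: sums_unique2)
qed

text \<open>The mean value inequality through which differences of approximating semigroups,
  increments of orbits and their first order expansion are estimated.\<close>

lemma vector_derivative_bound:
  fixes f :: "real \<Rightarrow> 'b::real_normed_vector"
  assumes "t \<ge> 0"
    and "\<And>s. 0 \<le> s \<Longrightarrow> s \<le> t \<Longrightarrow> (f has_vector_derivative f' s) (at s within {0..t})"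
    and "\<And>s. 0 \<le> s \<Longrightarrow> s \<le> t \<Longrightarrow> norm (f' s) \<le> K"
  shows "norm (f t - f 0) \<le> K * t"
proof -
  have "norm (f t - f 0) \<le> K * norm (t - 0)"
  proof (rule differentiable_bound[where S = "{0..t}" and f' = "\<lambda>s h. h *\<^sub>R f' s"])
    show "\<And>s. s \<in> {0..t} \<Longrightarrow> onorm (\<lambda>h. h *\<^sub>R f' s) \<le> K"
      by (rule onorm_le) (use assms(3) in \<open>simp add: mult.commute[of K] mult_left_mono\<close>)
  qed (use assms in \<open>auto simp: has_vector_derivative_def\<close>)
  then show ?thesis using assms(1) by simp
qed

lemma norm_diff_add_le: "norm (a - b + c) \<le> norm a + norm b + norm c" for a :: "'a::real_normed_vector"
  by (rule order_trans[OF norm_triangle_ineq]) (intro add_right_mono norm_triangle_ineq4)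

section \<open>Generation of contraction semigroups\<close>

text \<open>\<open>G\<close> is the inverse of the generator; the semigroup contracts the norm \<open>x \<mapsto> \<parallel>\<Phi> x\<parallel>\<close>. Stating
  dissipativity through the bounded operator \<open>G\<close> avoids unbounded operators and their domains.\<close>

locale dissipative_inverse =
  fixes G :: "'a::{real_inner,banach,perfect_space} \<Rightarrow>\<^sub>L 'a"
    and \<Phi> :: "'a \<Rightarrow>\<^sub>L 'b::real_inner" and C :: real
  assumes G_inj: "\<And>x. G x = 0 \<Longrightarrow> x = 0"
    and \<Phi>_lower: "\<And>x. norm x \<le> C * norm (\<Phi> x)"
    and diss: "\<And>x. inner (\<Phi> x) (\<Phi> (G x)) \<le> 0"
begin

section \<open>The energy norm and the projection theorem\<close>

lemma C_nonneg: "C \<ge> 0"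
proof -
  obtain x :: 'a where "norm x = 1" by (rule vector_choose_size[of 1]) auto
  with \<Phi>_lower[of x] have "0 < C * norm (\<Phi> x)" by simp
  then show ?thesis by (simp add: zero_less_mult_iff)
qed

lemma \<Phi>_inj: "\<Phi> x = 0 \<Longrightarrow> x = 0"
  using \<Phi>_lower[of x] by simp

text \<open>Only \<open>'a\<close> is assumed complete. The lower bound brings Cauchy sequences of
  the energy norm back to \<open>'a\<close>, where limits exist.\<close>

lemma Cauchy_\<Phi>:
  fixes X :: "nat \<Rightarrow> 'a"
  assumes "Cauchy (\<lambda>n. \<Phi> (X n))" shows "Cauchy X"
proof (rule metric_CauchyI)
  fix e :: real assume e: "e > 0"
  then have "e / (C + 1) > 0" using C_nonneg by simp
  then obtain M where M: "\<And>m n. m \<ge> M \<Longrightarrow> n \<ge> M \<Longrightarrow> dist (\<Phi> (X m)) (\<Phi> (X n)) < e / (C + 1)"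
    using metric_CauchyD[OF assms] by blast
  show "\<exists>M. \<forall>m\<ge>M. \<forall>n\<ge>M. dist (X m) (X n) < e"
  proof (intro exI allI impI)
    fix m n assume mn: "m \<ge> M" "n \<ge> M"
    have "dist (X m) (X n) \<le> C * dist (\<Phi> (X m)) (\<Phi> (X n))"
      using \<Phi>_lower[of "X m - X n"] by (simp add: dist_norm blinfun.bilinear_simps)
    also have "\<dots> \<le> (C + 1) * dist (\<Phi> (X m)) (\<Phi> (X n))"
      by (simp add: mult_right_mono)
    also have "\<dots> < e"
      using M[OF mn] C_nonneg by (simp add: field_simps)
    finally show "dist (X m) (X n) < e" .
  qed
qed

text \<open>The projection theorem for the inner product pulled back along \<open>\<Phi>\<close>: a
  minimising sequence in \<open>V\<close> is Cauchy, and its limit \<open>p\<close> leaves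
  \<open>x - p\<close> orthogonal to \<open>V\<close>, hence \<open>x = p\<close>.\<close>

lemma dense_if_orthogonal_trivial:
  assumes V: "subspace V" and orth: "\<And>y. (\<And>v. v \<in> V \<Longrightarrow> inner (\<Phi> y) (\<Phi> v) = 0) \<Longrightarrow> y = 0"
  shows "closure V = UNIV"
proof (rule UNIV_eq_I[symmetric])
  fix x :: 'a
  define d where "d = Inf ((\<lambda>v. norm (\<Phi> (x - v))) ` V)"
  have V0: "0 \<in> V" using V by (rule subspace_0)
  have bdd: "bdd_below ((\<lambda>v. norm (\<Phi> (x - v))) ` V)"
    by (rule bdd_belowI[of _ 0]) auto
  have dle: "d \<le> norm (\<Phi> (x - v))" if "v \<in> V" for v
    unfolding d_def using bdd that by (intro cInf_lower) auto
  have d0: "d \<ge> 0" unfolding d_def using V0 by (intro cInf_greatest) auto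
  have "\<exists>v\<in>V. norm (\<Phi> (x - v)) < d + 1 / real (Suc n)" for n
  proof -
    have "\<exists>r\<in>(\<lambda>v. norm (\<Phi> (x - v))) ` V. r < d + 1 / real (Suc n)"
      unfolding d_def using V0 bdd by (subst cInf_less_iff[symmetric]) auto
    then show ?thesis by auto
  qed
  then obtain v where v: "\<And>n. v n \<in> V" "\<And>n. norm (\<Phi> (x - v n)) < d + 1 / real (Suc n)"
    by metis
  define r where "r n = norm (\<Phi> (x - v n))" for n
  have rlim: "r \<longlonglongrightarrow> d"
  proof (rule tendsto_sandwich[where f = "\<lambda>_. d" and h = "\<lambda>n. d + 1 / real (Suc n)"])
    show "(\<lambda>n. d + 1 / real (Suc n)) \<longlonglongrightarrow> d"
      using tendsto_add[OF tendsto_const[of d] LIMSEQ_inverse_real_of_nat] by (simp add: inverse_eq_divide)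
  qed (use dle v in \<open>auto simp: r_def less_imp_le\<close>)
  \<comment> \<open>Parallelogram law: the midpoint of \<open>v m\<close> and \<open>v n\<close>
    lies in \<open>V\<close> and so is at distance at least \<open>d\<close> from
    \<open>x\<close>.\<close>
  have est: "(norm (\<Phi> (v m) - \<Phi> (v n)))\<^sup>2 \<le> 2 * (r m)\<^sup>2 + 2 * (r n)\<^sup>2 - 4 * d\<^sup>2" for m n
  proof -
    let ?p = "\<Phi> (x - v m)" and ?q = "\<Phi> (x - v n)"
    have "(1/2) *\<^sub>R (v m + v n) \<in> V"
      using V v by (intro subspace_scale subspace_add)
    then have "d \<le> norm (\<Phi> (x - (1/2) *\<^sub>R (v m + v n)))" by (rule dle)
    moreover have "2 *\<^sub>R (x - (1/2) *\<^sub>R (v m + v n)) = (x - v m) + (x - v n)"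
      by (simp add: scaleR_right_diff_distrib scaleR_2)
    then have "2 *\<^sub>R \<Phi> (x - (1/2) *\<^sub>R (v m + v n)) = ?p + ?q"
      by (metis blinfun.add_right blinfun.scaleR_right)
    then have "2 * norm (\<Phi> (x - (1/2) *\<^sub>R (v m + v n))) = norm (?p + ?q)"
      by (metis abs_numeral norm_scaleR)
    ultimately have "2 * d \<le> norm (?p + ?q)" by linarith
    then have "(2 * d)\<^sup>2 \<le> (norm (?p + ?q))\<^sup>2" using d0 by (intro power_mono) auto
    moreover have "(norm (?p + ?q))\<^sup>2 + (norm (?p - ?q))\<^sup>2 = 2 * (norm ?p)\<^sup>2 + 2 * (norm ?q)\<^sup>2"
      by (simp add: power2_norm_eq_inner inner_diff inner_add algebra_simps)
    moreover have "norm (?p - ?q) = norm (\<Phi> (v m) - \<Phi> (v n))"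
      by (simp add: blinfun.bilinear_simps norm_minus_commute)
    ultimately show ?thesis by (simp add: r_def power_mult_distrib)
  qed
  have "Cauchy (\<lambda>n. \<Phi> (v n))"
  proof (rule metric_CauchyI)
    fix e :: real assume e: "e > 0"
    have "(\<lambda>n. (r n)\<^sup>2) \<longlonglongrightarrow> d\<^sup>2" by (intro tendsto_intros rlim)
    then have "\<forall>\<^sub>F n in sequentially. (r n)\<^sup>2 < d\<^sup>2 + e\<^sup>2 / 4"
      by (rule order_tendstoD) (use e in auto)
    then obtain M where M: "\<And>n. n \<ge> M \<Longrightarrow> (r n)\<^sup>2 < d\<^sup>2 + e\<^sup>2 / 4"
      by (auto simp: eventually_sequentially)
    show "\<exists>M. \<forall>m\<ge>M. \<forall>n\<ge>M. dist (\<Phi> (v m)) (\<Phi> (v n)) < e"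
    proof (intro exI allI impI)
      fix m n assume "m \<ge> M" "n \<ge> M"
      then have "(norm (\<Phi> (v m) - \<Phi> (v n)))\<^sup>2 < e\<^sup>2"
        using est[of m n] M[of m] M[of n] by linarith
      then show "dist (\<Phi> (v m)) (\<Phi> (v n)) < e"
        using e by (simp add: dist_norm power2_less_imp_less)
    qed
  qed
  then have "convergent v" using Cauchy_\<Phi> Cauchy_convergent_iff by blast
  then obtain p where p: "v \<longlonglongrightarrow> p" by (auto simp: convergent_def)
  have pV: "p \<in> closure V" using p v(1) closure_sequential by blast
  have "r \<longlonglongrightarrow> norm (\<Phi> (x - p))"
    unfolding r_def by (intro tendsto_intros p blinfun.tendsto)
  then have dp: "norm (\<Phi> (x - p)) = d" using rlim LIMSEQ_unique by blast
  have dle': "d \<le> norm (\<Phi> (x - (p + w)))" if w: "w \<in> V" for w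
  proof (rule LIMSEQ_le_const)
    show "(\<lambda>n. norm (\<Phi> (x - (v n + w)))) \<longlonglongrightarrow> norm (\<Phi> (x - (p + w)))"
      by (intro tendsto_intros p blinfun.tendsto)
    show "\<exists>n0. \<forall>n\<ge>n0. d \<le> norm (\<Phi> (x - (v n + w)))"
      using dle subspace_add[OF V v(1) w] by blast
  qed
  have "x - p = 0"
  proof (rule orth)
    fix w assume w: "w \<in> V"
    show "inner (\<Phi> (x - p)) (\<Phi> w) = 0"
    proof (rule ccontr)
      let ?i = "inner (\<Phi> (x - p)) (\<Phi> w)"
      assume i: "?i \<noteq> 0"
      then have pos: "(norm (\<Phi> w))\<^sup>2 > 0" by auto
      \<comment> \<open>The minimiser of the quadratic polynomial
        \<open>t \<mapsto> |\<Phi> (x - p) - t \<Phi> w|^2\<close>.\<close>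
      define t where "t = ?i / (norm (\<Phi> w))\<^sup>2"
      have "d\<^sup>2 \<le> (norm (\<Phi> (x - (p + t *\<^sub>R w))))\<^sup>2"
        using dle'[OF subspace_scale[OF V w]] d0 by (intro power_mono) auto
      also have "\<Phi> (x - (p + t *\<^sub>R w)) = \<Phi> (x - p) - t *\<^sub>R \<Phi> w"
        by (simp add: blinfun.bilinear_simps)
      also have "(norm \<dots>)\<^sup>2 = d\<^sup>2 - 2 * t * ?i + t\<^sup>2 * (norm (\<Phi> w))\<^sup>2"
        unfolding dp[symmetric]
        by (simp only: power2_norm_eq_inner) (simp add: inner_diff inner_commute algebra_simps power2_eq_square)
      also have "t\<^sup>2 * (norm (\<Phi> w))\<^sup>2 = t * ?i"
        using pos by (simp add: t_def power2_eq_square)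
      finally have "t * ?i \<le> 0" by simp
      moreover have "t * ?i = ?i\<^sup>2 / (norm (\<Phi> w))\<^sup>2" by (simp add: t_def power2_eq_square)
      moreover have "\<dots> > 0" using i pos by simp
      ultimately show False by simp
    qed
  qed
  then show "x \<in> closure V" using pV by simp
qed

section \<open>Resolvents and density of the domain\<close>

lemma norm_resolvent_eq:
  "(norm (\<Phi> (l *\<^sub>R G y - y)))\<^sup>2 = l\<^sup>2 * (norm (\<Phi> (G y)))\<^sup>2 + (norm (\<Phi> y))\<^sup>2 - 2 * l * inner (\<Phi> y) (\<Phi> (G y))"
  unfolding power2_norm_eq_inner
  by (simp add: blinfun.bilinear_simps inner_diff inner_commute algebra_simps power2_eq_square)

text \<open>With \<open>x = G y\<close>, the vector \<open>l *\<^sub>R G y - y\<close> is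
  \<open>l x\<close> minus the generator at \<open>x\<close>. Dissipativity makes the mixed term of
  its squared norm nonnegative, so each of the other two squares is a lower bound.\<close>

lemma resolvent_lower:
  assumes "l \<ge> 0"
  shows "norm (\<Phi> y) \<le> norm (\<Phi> (l *\<^sub>R G y - y))" "l * norm (\<Phi> (G y)) \<le> norm (\<Phi> (l *\<^sub>R G y - y))"
proof -
  have 0: "l * inner (\<Phi> y) (\<Phi> (G y)) \<le> 0" using diss assms by (simp add: mult_nonneg_nonpos)
  have 1: "0 \<le> l\<^sup>2 * (norm (\<Phi> (G y)))\<^sup>2" "0 \<le> (norm (\<Phi> y))\<^sup>2" by simp_all
  have "(norm (\<Phi> y))\<^sup>2 \<le> (norm (\<Phi> (l *\<^sub>R G y - y)))\<^sup>2"
    using 0 1 norm_resolvent_eq[of l y] by linarith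
  then show "norm (\<Phi> y) \<le> norm (\<Phi> (l *\<^sub>R G y - y))" by (rule power2_le_imp_le) simp
  have "(l * norm (\<Phi> (G y)))\<^sup>2 \<le> (norm (\<Phi> (l *\<^sub>R G y - y)))\<^sup>2"
    unfolding power_mult_distrib using 0 1 norm_resolvent_eq[of l y] by linarith
  then show "l * norm (\<Phi> (G y)) \<le> norm (\<Phi> (l *\<^sub>R G y - y))" by (rule power2_le_imp_le) simp
qed

text \<open>The lower bound makes the range closed. For \<open>y\<close> orthogonal to the range,
  the square of its energy norm equals \<open>l\<close> times the product bounded in
  \<open>diss\<close>, so \<open>y = 0\<close> and the range is dense.\<close>

lemma resolvent_surj:
  assumes "l \<ge> 0"
  shows "\<exists>y. l *\<^sub>R G y - y = f"
proof -
  define V where "V = range (\<lambda>y. l *\<^sub>R G y - y)"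
  have lin: "linear (\<lambda>y. l *\<^sub>R G y - y)"
    by (auto simp: linear_iff blinfun.bilinear_simps algebra_simps)
  have V: "subspace V" unfolding V_def using lin by (intro linear_subspace_image subspace_UNIV)
  have "closed V"
    unfolding closed_sequential_limits
  proof (intro allI impI)
    fix u q assume u: "(\<forall>n. u n \<in> V) \<and> u \<longlonglongrightarrow> q"
    then have "\<forall>n. \<exists>y. u n = l *\<^sub>R G y - y" unfolding V_def by blast
    then obtain y where y: "\<And>n. u n = l *\<^sub>R G (y n) - y n" by metis
    have "Cauchy (\<lambda>n. \<Phi> (u n))" using u by (intro LIMSEQ_imp_Cauchy[OF blinfun.tendsto]) auto
    moreover have "dist (\<Phi> (y m)) (\<Phi> (y n)) \<le> dist (\<Phi> (u m)) (\<Phi> (u n))" for m n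
      using resolvent_lower(1)[OF assms, of "y m - y n"]
      by (simp add: dist_norm y blinfun.bilinear_simps algebra_simps)
    ultimately have "Cauchy (\<lambda>n. \<Phi> (y n))" unfolding Cauchy_def by (meson le_less_trans)
    then obtain y' where "y \<longlonglongrightarrow> y'" using Cauchy_\<Phi> Cauchy_convergent_iff convergent_def by blast
    then have "u \<longlonglongrightarrow> l *\<^sub>R G y' - y'" unfolding y by (intro tendsto_intros blinfun.tendsto)
    then show "q \<in> V" using u LIMSEQ_unique unfolding V_def by blast
  qed
  moreover have "closure V = UNIV"
  proof (rule dense_if_orthogonal_trivial[OF V])
    fix y assume "\<And>v. v \<in> V \<Longrightarrow> inner (\<Phi> y) (\<Phi> v) = 0"
    then have "inner (\<Phi> y) (\<Phi> (l *\<^sub>R G y - y)) = 0" unfolding V_def by blast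
    then have "(norm (\<Phi> y))\<^sup>2 = l * inner (\<Phi> y) (\<Phi> (G y))"
      by (simp add: blinfun.bilinear_simps inner_diff power2_norm_eq_inner)
    also have "\<dots> \<le> 0" using diss assms by (simp add: mult_nonneg_nonpos)
    finally show "y = 0" using \<Phi>_inj by simp
  qed
  ultimately have "f \<in> V" by (simp add: closure_closed)
  then show ?thesis unfolding V_def by blast
qed

text \<open>Write a vector orthogonal to the range as \<open>G z - z\<close>. Orthogonality to
  \<open>G z\<close> and dissipativity force \<open>G z = 0\<close>, and injectivity of
  \<open>G\<close> gives \<open>z = 0\<close>.\<close>

lemma range_G_dense: "closure (range G) = UNIV"
proof (rule dense_if_orthogonal_trivial)
  show "subspace (range G)"
    by (intro linear_subspace_image subspace_UNIV) (simp add: blinfun.bounded_linear_right bounded_linear.linear)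
next
  fix y assume y: "\<And>v. v \<in> range G \<Longrightarrow> inner (\<Phi> y) (\<Phi> v) = 0"
  obtain z where z: "1 *\<^sub>R G z - z = y" using resolvent_surj[of 1 y] by auto
  have "inner (\<Phi> y) (\<Phi> (G z)) = 0" using y by blast
  then have "(norm (\<Phi> (G z)))\<^sup>2 = inner (\<Phi> z) (\<Phi> (G z))"
    unfolding z[symmetric] by (simp add: blinfun.bilinear_simps inner_diff power2_norm_eq_inner)
  also have "\<dots> \<le> 0" by (rule diss)
  finally have "G z = 0" using \<Phi>_inj by simp
  then show "y = 0" using G_inj z by auto
qed

section \<open>Yosida approximations and their exponentials\<close>

lemma ex_Yosida: "\<exists>M :: 'a blinop. \<forall>f. l *\<^sub>R G (oapp M f) - oapp M f = f" if l: "l \<ge> 0"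
proof -
  obtain M where M: "\<And>f. l *\<^sub>R G (M f) - M f = f" using resolvent_surj[OF l] by metis
  have inj: "y = z" if "l *\<^sub>R G y - y = l *\<^sub>R G z - z" for y z
  proof -
    have "l *\<^sub>R G (y - z) - (y - z) = 0" using that by (simp add: blinfun.bilinear_simps algebra_simps)
    then have "\<Phi> (y - z) = 0" using resolvent_lower(1)[OF l, of "y - z"] by (simp add: blinfun.bilinear_simps)
    then show ?thesis using \<Phi>_inj by fastforce
  qed
  have "bounded_linear M"
  proof (rule bounded_linear_intro)
    fix f g
    have "l *\<^sub>R G (M f + M g) - (M f + M g) = (l *\<^sub>R G (M f) - M f) + (l *\<^sub>R G (M g) - M g)"
      by (simp add: blinfun.bilinear_simps scaleR_add_right)
    then show "M (f + g) = M f + M g" by - (rule inj, simp only: M)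
  next
    fix r f
    have "l *\<^sub>R G (r *\<^sub>R M f) - r *\<^sub>R M f = r *\<^sub>R (l *\<^sub>R G (M f) - M f)"
      by (simp add: blinfun.bilinear_simps scaleR_diff_right)
    then show "M (r *\<^sub>R f) = r *\<^sub>R M f" by - (rule inj, simp only: M)
  next
    fix f
    have "norm (M f) \<le> C * norm (\<Phi> (M f))" by (rule \<Phi>_lower)
    also have "\<dots> \<le> C * norm (\<Phi> f)"
      using resolvent_lower(1)[OF l, of "M f"] C_nonneg by (intro mult_left_mono) (simp_all add: M)
    also have "\<dots> \<le> C * (norm \<Phi> * norm f)" using C_nonneg by (intro mult_left_mono norm_blinfun)
    finally show "norm (M f) \<le> norm f * (C * norm \<Phi>)" by (simp add: mult_ac)
  qed
  then have "oapp (Abs_blinop (Blinfun M)) = M"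
    by (simp add: oapp.rep_eq Abs_blinop_inverse bounded_linear_Blinfun_apply)
  then show ?thesis using M by metis
qed

text \<open>With \<open>B\<close> the inverse of \<open>G\<close> this is
  \<open>B (n - B)^-1\<close>, since \<open>n G - 1 = (n - B) G\<close>. The Yosida approximation
  proper is \<open>n\<close> times it, abbreviated \<open>A n\<close> below.\<close>

definition yosida :: "nat \<Rightarrow> 'a blinop" where
  "yosida n = (SOME M. \<forall>f. real n *\<^sub>R G (oapp M f) - oapp M f = f)"

lemma yosida: "real n *\<^sub>R G (oapp (yosida n) f) - oapp (yosida n) f = f"
  using someI_ex[OF ex_Yosida[of "real n"]] unfolding yosida_def by simp

abbreviation "Gop \<equiv> Abs_blinop G"

lemma Gop [simp]: "oapp Gop x = G x"
  by (simp add: oapp.rep_eq Abs_blinop_inverse)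

lemma blinop_eqI: "(\<And>x. oapp A x = oapp B x) \<Longrightarrow> A = B" for A B :: "'a blinop"
  by transfer (rule blinfun_eqI)

lemmas oapp_right = bounded_bilinear.scaleR_right[OF bounded_bilinear_oapp]
  bounded_bilinear.diff_right[OF bounded_bilinear_oapp]
  bounded_bilinear.add_right[OF bounded_bilinear_oapp]
  bounded_bilinear.zero_right[OF bounded_bilinear_oapp]

lemma resolvent_left: "(real n *\<^sub>R Gop - 1) * yosida n = 1"
  by (rule blinop_eqI) (simp add: yosida)

lemma resolvent_right: "yosida n * (real n *\<^sub>R Gop - 1) = 1"
proof (rule blinop_eqI)
  fix x
  let ?K = "real n *\<^sub>R Gop - 1" and ?y = "oapp (yosida n * (real n *\<^sub>R Gop - 1)) x"
  have "oapp ?K ?y = oapp ((?K * yosida n) * ?K) x" by (simp add: mult.assoc)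
  then have "oapp ?K (?y - x) = 0"
    by (simp only: resolvent_left) (simp add: blinfun.bilinear_simps algebra_simps)
  then have "real n *\<^sub>R G (?y - x) - (?y - x) = 0" by simp
  then have "\<Phi> (?y - x) = 0" using resolvent_lower(1)[of "real n" "?y - x"] by simp
  then show "?y = oapp 1 x" using \<Phi>_inj by fastforce
qed

lemma yosida_commute:
  assumes "Gop * J = J * Gop" shows "yosida n * J = J * yosida n"
proof -
  let ?K = "real n *\<^sub>R Gop - 1"
  have "?K * J = J * ?K" using assms by (simp add: algebra_simps)
  then have "yosida n * (?K * J) * yosida n = yosida n * (J * ?K) * yosida n" by simp
  then have "(yosida n * ?K) * J * yosida n = yosida n * J * (?K * yosida n)" by (simp only: mult.assoc)
  then show ?thesis by (simp only: resolvent_left resolvent_right mult_1_left mult_1_right)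
qed

definition E :: "nat \<Rightarrow> real \<Rightarrow> 'a blinop" where
  "E n t = exp (t *\<^sub>R real n *\<^sub>R yosida n)"

abbreviation "A n x \<equiv> real n *\<^sub>R oapp (yosida n) x"
abbreviation "U n t \<equiv> oapp (E n t)"

abbreviation N :: "'a \<Rightarrow> real" where "N x \<equiv> norm (\<Phi> x)"

lemma yosida_G: "yosida n * Gop = Gop * yosida n"
  by (rule yosida_commute) simp

lemma yosida_yosida: "yosida n * yosida m = yosida m * yosida n"
  by (rule yosida_commute) (simp add: yosida_G)

lemma E_commute:
  assumes "Gop * J = J * Gop" shows "E n t * J = J * E n t"
  unfolding E_def by (rule exp_commuting) (simp add: yosida_commute[OF assms])

lemma E_0 [simp]: "E n 0 = 1"
  by (simp add: E_def)

lemma E_add: "E n (s + t) = E n s * E n t"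
  unfolding E_def scaleR_add_left by (rule exp_add_commuting) simp

lemma E_deriv:
  "((\<lambda>t. U n t x) has_vector_derivative U n t (A n x)) (at t within T)"
  unfolding E_def
  using bounded_linear.has_vector_derivative[OF bounded_linear_oapp_left[of x]
      exp_scaleR_has_vector_derivative_right[of "real n *\<^sub>R yosida n" t T]]
  by (simp add: oapp_right)

text \<open>Dissipativity passes to the Yosida approximation: with \<open>y\<close> the value at
  \<open>f\<close> one has \<open>f = n G y - y\<close>, so the product is \<open>n\<close> times a
  nonpositive number minus a square.\<close>

lemma N_diss: "inner (\<Phi> (oapp (yosida n) f)) (\<Phi> f) \<le> 0"
proof -
  let ?y = "oapp (yosida n) f"
  have "\<Phi> f = real n *\<^sub>R \<Phi> (G ?y) - \<Phi> ?y"
    by (subst yosida[symmetric, of f n]) (simp add: blinfun.bilinear_simps)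
  then have "inner (\<Phi> ?y) (\<Phi> f) = real n * inner (\<Phi> ?y) (\<Phi> (G ?y)) - (norm (\<Phi> ?y))\<^sup>2"
    by (simp add: inner_diff power2_norm_eq_inner)
  moreover have "real n * inner (\<Phi> ?y) (\<Phi> (G ?y)) \<le> 0" using diss by (simp add: mult_nonneg_nonpos)
  moreover have "0 \<le> (norm (\<Phi> ?y))\<^sup>2" by simp
  ultimately show ?thesis by linarith
qed

lemma E_yosida_apply: "U n t (oapp (yosida n) x) = oapp (yosida n) (U n t x)"
  using E_commute[of "yosida n" n t] yosida_G by (metis oapp_simps(1))

text \<open>The derivative of the squared energy norm along an orbit is \<open>2 n\<close> times a
  product as in \<open>N_diss\<close>; the form fits because the exponential commutes with its
  exponent.\<close>

lemma N_E: assumes "t \<ge> 0" shows "N (U n t x) \<le> N x"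
proof -
  define f where "f s = \<Phi> (U n s x)" for s
  have d: "(f has_vector_derivative real n *\<^sub>R \<Phi> (oapp (yosida n) (U n s x))) (at s)" for s
    unfolding f_def
    using bounded_linear.has_vector_derivative[OF blinfun.bounded_linear_right[of \<Phi>] E_deriv[of n x s UNIV]]
    by (simp add: E_yosida_apply blinfun.bilinear_simps oapp_right)
  have "inner (f t) (f t) \<le> inner (f 0) (f 0)"
  proof (rule DERIV_nonpos_imp_nonincreasing[OF assms])
    fix s
    let ?d = "real n *\<^sub>R \<Phi> (oapp (yosida n) (U n s x))"
    have "((\<lambda>s. inner (f s) (f s)) has_vector_derivative (inner (f s) ?d + inner ?d (f s))) (at s)"
      by (rule bounded_bilinear.has_vector_derivative[OF bounded_bilinear_inner d d])
    then have "((\<lambda>s. inner (f s) (f s)) has_real_derivative (inner (f s) ?d + inner ?d (f s))) (at s)"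
      by (simp add: has_real_derivative_iff_has_vector_derivative)
    moreover have "inner ?d (f s) \<le> 0"
      using N_diss[of n "U n s x"] by (simp add: f_def mult_nonneg_nonpos)
    ultimately show "\<exists>y. ((\<lambda>s. inner (f s) (f s)) has_real_derivative y) (at s) \<and> y \<le> 0"
      by (auto simp: inner_commute intro!: exI)
  qed
  then show ?thesis by (simp add: f_def norm_eq_sqrt_inner)
qed

text \<open>\<open>G\<close> cancels the generator inside the Yosida approximation, so this is the
  resolvent bound \<open>|n R| \<le> 1\<close> in the energy norm.\<close>

lemma N_yosida_G: "N (A n (G x)) \<le> N x"
proof -
  have "oapp (yosida n) (G x) = G (oapp (yosida n) x)"
    using yosida_G[of n] by (metis oapp_simps(1) Gop)
  then show ?thesis
    using resolvent_lower(2)[of "real n" "oapp (yosida n) x"]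
    by (simp add: yosida blinfun.bilinear_simps)
qed

lemma range_G_approx:
  assumes e: "e > 0" obtains u where "N (G u - z) < e"
proof -
  define K where "K = norm \<Phi> + 1"
  have K: "K > 0" by (simp add: K_def add_nonneg_pos)
  have "z \<in> closure (range G)" by (simp add: range_G_dense)
  then obtain u where u: "dist (G u) z < e / K"
    using e K by (metis closure_approachable divide_pos_pos rangeE)
  have "N (G u - z) \<le> norm \<Phi> * norm (G u - z)" by (rule norm_blinfun)
  also have "\<dots> \<le> K * norm (G u - z)" by (simp add: K_def mult_right_mono)
  also have "\<dots> < e" using u K by (simp add: dist_norm field_simps)
  finally show thesis by (rule that)
qed

text \<open>The rate is \<open>1/n\<close> on the domain of the square of the generator; the rest is density.\<close>

lemma yosida_tendsto:
  "(\<lambda>n. \<Phi> (A n (G z))) \<longlonglongrightarrow> \<Phi> z"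
proof (rule LIMSEQ_I)
  fix e :: real assume e: "e > 0"
  let ?Q = "\<lambda>n z. A n (G z)"
  have lin: "?Q n (x - y) = ?Q n x - ?Q n y" for n x y
    by (simp add: blinfun.bilinear_simps oapp_right scaleR_diff_right)
  obtain u where a: "N (G u - z) < e / 3" using range_G_approx[of "e / 3"] e by auto
  obtain n0 :: nat where n0: "real n0 > 3 * N u / e" using reals_Archimedean2 by blast
  show "\<exists>n0. \<forall>n\<ge>n0. norm (\<Phi> (?Q n z) - \<Phi> z) < e"
  proof (intro exI allI impI)
    fix n assume n: "n \<ge> n0"
    have n1: "3 * N u / e < real n" using n n0 by linarith
    moreover have "0 \<le> 3 * N u / e" using e by simp
    ultimately have npos: "real n > 0" by linarith
    have "oapp (yosida n) (G (G u)) = G (oapp (yosida n) (G u))"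
      using yosida_G[of n] by (metis oapp_simps(1) Gop)
    then have "?Q n (G u) - G u = oapp (yosida n) (G u)"
      using yosida[of n "G u"] by (simp add: algebra_simps)
    then have "real n * N (?Q n (G u) - G u) \<le> N u"
      using N_yosida_G[of n u] by (simp add: blinfun.bilinear_simps)
    then have b: "N (?Q n (G u) - G u) \<le> N u / real n" using npos by (simp add: field_simps)
    also have "\<dots> < e / 3" using n1 npos e by (simp add: field_simps)
    finally have b: "N (?Q n (G u) - G u) < e / 3" .
    have c: "N (?Q n (z - G u)) < e / 3"
      using N_yosida_G[of n "z - G u"] a by (metis blinfun.diff_right norm_minus_commute order_le_less_trans)
    have eq: "\<Phi> (?Q n z) - \<Phi> z = \<Phi> (?Q n (z - G u)) + \<Phi> (?Q n (G u) - G u) + \<Phi> (G u - z)"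
      unfolding lin by (simp add: blinfun.bilinear_simps)
    have "norm (\<Phi> (?Q n z) - \<Phi> z) \<le> N (?Q n (z - G u)) + N (?Q n (G u) - G u) + N (G u - z)"
      unfolding eq by (rule order_trans[OF norm_triangle_ineq]) (intro add_right_mono norm_triangle_ineq)
    then show "norm (\<Phi> (?Q n z) - \<Phi> z) < e" using a b c by linarith
  qed
qed

text \<open>For fixed \<open>t\<close> this path joins \<open>E m t\<close> at \<open>s = 0\<close>
  to \<open>E n t\<close> at \<open>s = t\<close>, and for \<open>s\<close> in between it is a
  product of two contractions.\<close>

lemma exp_diff_E:
  "exp (s *\<^sub>R (real n *\<^sub>R yosida n - real m *\<^sub>R yosida m)) * E m t = E n s * E m (t - s)"
proof -
  let ?A = "\<lambda>n. real n *\<^sub>R yosida n"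
  have "exp (s *\<^sub>R (?A n - ?A m)) * exp (t *\<^sub>R ?A m) = exp (s *\<^sub>R (?A n - ?A m) + t *\<^sub>R ?A m)"
    by (rule exp_add_commuting[symmetric]) (simp add: algebra_simps yosida_yosida[of n m])
  also have "s *\<^sub>R (?A n - ?A m) + t *\<^sub>R ?A m = s *\<^sub>R ?A n + (t - s) *\<^sub>R ?A m"
    by (simp add: algebra_simps)
  also have "exp \<dots> = exp (s *\<^sub>R ?A n) * exp ((t - s) *\<^sub>R ?A m)"
    by (rule exp_add_commuting) (simp add: algebra_simps yosida_yosida[of n m])
  finally show ?thesis by (simp add: E_def)
qed

text \<open>Duhamel's formula as an estimate: the derivative of the path in
  \<open>exp_diff_E\<close> is a product of contractions applied to the difference of the two Yosida
  approximations at \<open>x\<close>.\<close>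

lemma E_diff:
  assumes t: "t \<ge> 0"
  shows "N (U n t x - U m t x)
    \<le> N (A n x - A m x) * t"
proof -
  define D where "D = real n *\<^sub>R yosida n - real m *\<^sub>R yosida m"
  define f where "f s = \<Phi> (oapp (exp (s *\<^sub>R D)) (U m t x))" for s
  have fE: "f s = \<Phi> (U n s (U m (t - s) x))" for s
    unfolding f_def D_def using exp_diff_E[of s n m t] by (metis oapp_simps(1))
  have ED: "E m t * D = D * E m t"
    using E_commute[of "yosida n" m t] E_commute[of "yosida m" m t] yosida_G
    by (simp add: D_def algebra_simps)
  have "norm (f t - f 0) \<le> N (oapp D x) * t"
  proof (rule vector_derivative_bound[OF t])
    fix s assume s: "0 \<le> s" "s \<le> t"
    show "(f has_vector_derivative \<Phi> (oapp (exp (s *\<^sub>R D) * D) (U m t x))) (at s within {0..t})"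
      unfolding f_def
      by (intro bounded_linear.has_vector_derivative[OF blinfun.bounded_linear_right]
          bounded_linear.has_vector_derivative[OF bounded_linear_oapp_left]
          exp_scaleR_has_vector_derivative_right)
    have "exp (s *\<^sub>R D) * D * E m t = exp (s *\<^sub>R D) * E m t * D"
      using ED by (simp add: mult.assoc)
    also have "\<dots> = E n s * E m (t - s) * D" using exp_diff_E by (simp add: D_def)
    finally have "oapp (exp (s *\<^sub>R D) * D) (U m t x)
        = U n s (U m (t - s) (oapp D x))"
      by (metis oapp_simps(1))
    then show "norm (\<Phi> (oapp (exp (s *\<^sub>R D) * D) (U m t x))) \<le> N (oapp D x)"
      using order_trans[OF N_E[of s n] N_E[of "t - s" m]] s by simp
  qed
  moreover have "f t - f 0 = \<Phi> (U n t x - U m t x)"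
    using fE[of t] fE[of 0] by (simp add: blinfun.bilinear_simps)
  ultimately show ?thesis by (simp add: D_def)
qed

section \<open>The limit semigroup and its generator\<close>

definition S :: "real \<Rightarrow> 'a \<Rightarrow> 'a" where
  "S t x = lim (\<lambda>n. U n t x)"

text \<open>On the range of \<open>G\<close> the Yosida approximations converge, hence by
  \<open>E_diff\<close> the exponentials do. Density of that range and contractivity extend this to
  every \<open>x\<close>.\<close>

lemma E_tendsto: assumes t: "t \<ge> 0" shows "(\<lambda>n. U n t x) \<longlonglongrightarrow> S t x"
proof -
  have "Cauchy (\<lambda>n. \<Phi> (U n t x))"
  proof (rule metric_CauchyI)
    fix e :: real assume e: "e > 0"
    obtain z where z: "N (G z - x) < e / 3" using range_G_approx[of "e / 3"] e by auto
    have ca: "Cauchy (\<lambda>n. \<Phi> (A n (G z)))"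
      by (rule LIMSEQ_imp_Cauchy[OF yosida_tendsto])
    \<comment> \<open>The divisor is \<open>t + 1\<close> because \<open>t\<close> may be 0.\<close>
    have "e / 3 / (t + 1) > 0" using e t by simp
    with metric_CauchyD[OF ca]
    obtain M where M: "\<And>m n. m \<ge> M \<Longrightarrow> n \<ge> M \<Longrightarrow>
        dist (\<Phi> (A m (G z))) (\<Phi> (A n (G z))) < e / 3 / (t + 1)"
      by blast
    show "\<exists>M. \<forall>m\<ge>M. \<forall>n\<ge>M. dist (\<Phi> (U m t x)) (\<Phi> (U n t x)) < e"
    proof (intro exI allI impI)
      fix m n assume mn: "m \<ge> M" "n \<ge> M"
      let ?d = "N (A m (G z) - A n (G z))"
      have d: "?d < e / 3 / (t + 1)" using M[OF mn] by (simp add: dist_norm blinfun.diff_right)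
      have "N (U m t (G z) - U n t (G z)) \<le> ?d * t" by (rule E_diff[OF t])
      also have "\<dots> \<le> ?d * (t + 1)" by (intro mult_left_mono) auto
      also have "\<dots> < e / 3" using d t by (simp add: field_simps)
      finally have 1: "N (U m t (G z) - U n t (G z)) < e / 3" .
      have 2: "N (U k t (G z - x)) < e / 3" for k
        using N_E[OF t, of k "G z - x"] z by linarith
      have eq: "U m t x - U n t x
          = (U m t (G z) - U n t (G z)) + U n t (G z - x) - U m t (G z - x)"
        by (simp add: oapp_right)
      have "N (U m t x - U n t x)
         \<le> N (U m t (G z) - U n t (G z)) + N (U n t (G z - x)) + N (U m t (G z - x))"
        unfolding eq blinfun.add_right blinfun.diff_right[of \<Phi> "_ + _"]
        by (rule order_trans[OF norm_triangle_ineq4]) (intro add_right_mono norm_triangle_ineq)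
      then show "dist (\<Phi> (U m t x)) (\<Phi> (U n t x)) < e"
        using 1 2[of m] 2[of n] by (simp add: dist_norm blinfun.diff_right)
    qed
  qed
  then have "convergent (\<lambda>n. U n t x)" by (rule Cauchy_convergent[OF Cauchy_\<Phi>])
  then show ?thesis unfolding S_def by (simp add: convergent_LIMSEQ_iff)
qed

lemma N_S_diff_le:
  assumes t: "t \<ge> 0" and le: "\<And>n. N (U n t x - y) \<le> c n" and c: "c \<longlonglongrightarrow> K"
  shows "N (S t x - y) \<le> K"
  by (rule LIMSEQ_le[OF _ c, of "\<lambda>n. N (U n t x - y)"])
     (intro tendsto_intros blinfun.tendsto E_tendsto t, use le in blast)

lemma N_S: "t \<ge> 0 \<Longrightarrow> N (S t x) \<le> N x"
  using N_S_diff_le[of t x 0 "\<lambda>_. N x" "N x"] N_E by simp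

lemma S_eqI:
  assumes "t \<ge> 0" "(\<lambda>n. U n t x) \<longlonglongrightarrow> y" shows "S t x = y"
  using LIMSEQ_unique[OF E_tendsto[OF assms(1)] assms(2)] .

lemma S_0 [simp]: "S 0 x = x"
  by (rule S_eqI) auto

lemma S_linear: assumes t: "t \<ge> 0" shows "linear (S t)"
proof (rule linearI)
  fix x y and r :: real
  show "S t (x + y) = S t x + S t y"
    by (rule S_eqI[OF t]) (simp add: oapp_right tendsto_add E_tendsto t)
  show "S t (r *\<^sub>R x) = r *\<^sub>R S t x"
    by (rule S_eqI[OF t]) (simp add: oapp_right tendsto_scaleR E_tendsto t)
qed

text \<open>Applied with \<open>J\<close> equal to \<open>G\<close>, and later to the projection on
  states and to multiplication by complex numbers.\<close>

lemma S_commute: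
  assumes "\<And>x. G (oapp J x) = oapp J (G x)" and t: "t \<ge> 0"
  shows "S t (oapp J x) = oapp J (S t x)"
proof (rule S_eqI[OF t])
  have "Gop * J = J * Gop" using assms by (intro blinop_eqI) simp
  then have "U n t (oapp J x) = oapp J (U n t x)" for n
    using E_commute by (metis oapp_simps(1))
  then show "(\<lambda>n. U n t (oapp J x)) \<longlonglongrightarrow> oapp J (S t x)"
    by (simp add: bounded_linear.tendsto[OF bounded_linear_oapp_right] E_tendsto t)
qed

lemma S_G: "t \<ge> 0 \<Longrightarrow> S t (G x) = G (S t x)"
  using S_commute[of Gop t x] by simp

text \<open>The law holds for each \<open>E n\<close>. Replacing \<open>U n t x\<close> by its limit
  inside the contraction \<open>U n s\<close> costs at most the distance between the two.\<close>

lemma S_add: assumes s: "s \<ge> 0" and t: "t \<ge> 0" shows "S (s + t) x = S s (S t x)"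
proof -
  have "(\<lambda>n. \<Phi> (U n (s + t) x - U n s (S t x))) \<longlonglongrightarrow> 0"
  proof (rule Lim_null_comparison)
    show "(\<lambda>n. N (U n t x - S t x)) \<longlonglongrightarrow> 0"
    proof -
      have "(\<lambda>n. N (U n t x - S t x)) \<longlonglongrightarrow> N (S t x - S t x)"
        by (intro tendsto_intros blinfun.tendsto E_tendsto t)
      then show ?thesis by simp
    qed
    show "\<forall>\<^sub>F n in sequentially. N (U n (s + t) x - U n s (S t x)) \<le> N (U n t x - S t x)"
      using N_E[OF s] by (simp add: E_add flip: oapp_right)
  qed
  moreover have "(\<lambda>n. \<Phi> (U n (s + t) x - U n s (S t x))) \<longlonglongrightarrow> \<Phi> (S (s + t) x - S s (S t x))"
    by (intro blinfun.tendsto tendsto_intros E_tendsto) (use s t in auto)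
  ultimately have "\<Phi> (S (s + t) x - S s (S t x)) = 0" using LIMSEQ_unique by blast
  then show ?thesis using \<Phi>_inj by fastforce
qed

lemma N_E_minus_id:
  assumes t: "t \<ge> 0" shows "N (U n t x - x) \<le> N (A n x) * t"
proof -
  have "norm (\<Phi> (U n t x) - \<Phi> (oapp (E n 0) x)) \<le> N (A n x) * t"
  proof (rule vector_derivative_bound[OF t])
    fix s assume s: "0 \<le> s" "s \<le> t"
    show "((\<lambda>s. \<Phi> (U n s x)) has_vector_derivative
        \<Phi> (U n s (A n x))) (at s within {0..t})"
      by (intro bounded_linear.has_vector_derivative[OF blinfun.bounded_linear_right] E_deriv)
  qed (rule N_E)
  then show ?thesis by (simp add: blinfun.diff_right)
qed

lemma N_S_minus_id: assumes t: "t \<ge> 0" shows "N (S t (G x) - G x) \<le> N x * t"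
proof (rule N_S_diff_le[OF t])
  show "N (U n t (G x) - G x) \<le> N x * t" for n
    using N_E_minus_id[OF t, of n "G x"] mult_right_mono[OF N_yosida_G t, of n x] by linarith
qed simp

text \<open>Apart from the vanishing error \<open>c n\<close>, the derivative of
  \<open>U n s x - s z\<close> is the increment \<open>U n s z - z\<close>, which is of order
  \<open>s\<close> because \<open>z\<close> lies in the range of \<open>G\<close> as well. This
  yields the derivative at 0 without integrating orbits.\<close>

lemma N_S_taylor: assumes t: "t \<ge> 0"
  shows "N (S t (G (G u)) - (G (G u) + t *\<^sub>R G u)) \<le> N u * t * t"
proof (rule N_S_diff_le[OF t])
  let ?x = "G (G u)" and ?z = "G u"
  define c where "c n = N (A n ?x - ?z)" for n
  have "(\<lambda>n. norm (\<Phi> (A n ?x) - \<Phi> ?z)) \<longlonglongrightarrow> norm (\<Phi> ?z - \<Phi> ?z)"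
    by (intro tendsto_intros yosida_tendsto)
  then have "c \<longlonglongrightarrow> 0" by (simp add: c_def[abs_def] blinfun.diff_right)
  then have "(\<lambda>n. (c n + N u * t) * t) \<longlonglongrightarrow> (0 + N u * t) * t" by (intro tendsto_intros)
  then show "(\<lambda>n. (c n + N u * t) * t) \<longlonglongrightarrow> N u * t * t" by simp
  fix n
  let ?f = "\<lambda>s. \<Phi> (U n s ?x - s *\<^sub>R ?z)"
  have "norm (?f t - ?f 0) \<le> (c n + N u * t) * t"
  proof (rule vector_derivative_bound[OF t])
    fix s assume s: "0 \<le> s" "s \<le> t"
    let ?d = "U n s (A n ?x)"
    show "(?f has_vector_derivative \<Phi> (?d - 1 *\<^sub>R ?z)) (at s within {0..t})"
      by (intro bounded_linear.has_vector_derivative[OF blinfun.bounded_linear_right] has_vector_derivative_diff E_deriv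
          bounded_linear.has_vector_derivative[OF bounded_linear_scaleR_left] has_vector_derivative_id)
    have eq: "\<Phi> (?d - 1 *\<^sub>R ?z) = \<Phi> (U n s (A n ?x - ?z)) + \<Phi> (U n s ?z - ?z)"
      by (simp add: oapp_right blinfun.bilinear_simps)
    have "N (U n s ?z - ?z) \<le> N (A n ?z) * s" by (rule N_E_minus_id[OF s(1)])
    also have "\<dots> \<le> N u * t" using s N_yosida_G by (intro mult_mono) auto
    finally show "norm (\<Phi> (?d - 1 *\<^sub>R ?z)) \<le> c n + N u * t"
      unfolding eq c_def using N_E[OF s(1)] by (intro norm_triangle_le add_mono)
  qed
  then show "N (U n t ?x - (?x + t *\<^sub>R ?z)) \<le> (c n + N u * t) * t"
    by (simp add: blinfun.diff_right blinfun.add_right algebra_simps)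
qed

lemma norm_le_N_tendsto:
  assumes "((\<lambda>h. N (f h)) \<longlongrightarrow> 0) F" shows "(f \<longlongrightarrow> 0) F"
proof (rule Lim_null_comparison)
  show "\<forall>\<^sub>F h in F. norm (f h) \<le> C * N (f h)" using \<Phi>_lower by simp
  show "((\<lambda>h. C * N (f h)) \<longlongrightarrow> 0) F" using tendsto_mult_left[OF assms, of C] by simp
qed

lemma S_continuous: "((\<lambda>t. S t x) \<longlongrightarrow> x) (at_right 0)"
proof -
  have "((\<lambda>t. N (S t x - x)) \<longlongrightarrow> 0) (at_right 0)"
  proof (rule tendstoI)
    fix e :: real assume e: "e > 0"
    obtain u where u: "N (G u - x) < e / 3" using range_G_approx[of "e / 3"] e by auto
    have "((\<lambda>t. N u * t) \<longlongrightarrow> N u * 0) (at_right 0)" by (intro tendsto_intros)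
    then have "\<forall>\<^sub>F t in at_right 0. N u * t < e / 3" using e by (intro order_tendstoD(2)) auto
    moreover have "\<forall>\<^sub>F t in at_right (0::real). t > 0" by (simp add: eventually_at_right_less)
    ultimately show "\<forall>\<^sub>F t in at_right 0. dist (N (S t x - x)) 0 < e"
    proof eventually_elim
      case (elim t)
      interpret l: linear "S t" using S_linear elim by simp
      have "\<Phi> (S t x - x) = \<Phi> (S t (G u) - G u) - \<Phi> (S t (G u - x)) + \<Phi> (G u - x)"
        by (simp add: blinfun.bilinear_simps l.diff)
      then have "N (S t x - x) \<le> N (S t (G u) - G u) + N (S t (G u - x)) + N (G u - x)"
        by (simp only: norm_diff_add_le)
      moreover have "N (S t (G u) - G u) < e / 3" using N_S_minus_id[of t u] elim by linarith
      moreover have "N (S t (G u - x)) < e / 3" using N_S[of t "G u - x"] elim u by linarith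
      ultimately show ?case using u by simp
    qed
  qed
  then have "((\<lambda>t. S t x - x) \<longlongrightarrow> 0) (at_right 0)" by (rule norm_le_N_tendsto)
  then show ?thesis by (simp add: LIM_zero_cancel)
qed

text \<open>Approximate \<open>z\<close> by \<open>G u\<close>. At \<open>G (G u)\<close> the first
  order expansion applies; the rest contributes a difference quotient at \<open>G (G u - z)\<close>,
  small uniformly in \<open>h\<close> by \<open>N_S_minus_id\<close>.\<close>

lemma S_generator: "((\<lambda>h. (1 / h) *\<^sub>R (S h (G z) - G z)) \<longlongrightarrow> z) (at_right 0)"
proof -
  have "((\<lambda>h. N ((1 / h) *\<^sub>R (S h (G z) - G z) - z)) \<longlongrightarrow> 0) (at_right 0)"
  proof (rule tendstoI)
    fix e :: real assume e: "e > 0"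
    obtain u where u: "N (G u - z) < e / 3" using range_G_approx[of "e / 3"] e by auto
    have "((\<lambda>t. N u * t) \<longlongrightarrow> N u * 0) (at_right 0)" by (intro tendsto_intros)
    then have "\<forall>\<^sub>F t in at_right 0. N u * t < e / 3" using e by (intro order_tendstoD(2)) auto
    moreover have "\<forall>\<^sub>F t in at_right (0::real). t > 0" by (simp add: eventually_at_right_less)
    ultimately show "\<forall>\<^sub>F h in at_right 0. dist (N ((1 / h) *\<^sub>R (S h (G z) - G z) - z)) 0 < e"
    proof eventually_elim
      case (elim h)
      interpret l: linear "S h" using S_linear elim by simp
      have "h *\<^sub>R \<Phi> ((1 / h) *\<^sub>R (S h (G z) - G z) - z)
          = \<Phi> (S h (G z) - G z - h *\<^sub>R z)"
        using elim by (simp add: blinfun.bilinear_simps scaleR_diff_right)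
      also have "\<dots> = \<Phi> (S h (G (G u)) - (G (G u) + h *\<^sub>R G u)) - \<Phi> (S h (G (G u - z)) - G (G u - z)) + h *\<^sub>R \<Phi> (G u - z)"
        by (simp add: blinfun.bilinear_simps l.diff scaleR_diff_right)
      finally have "norm (h *\<^sub>R \<Phi> ((1 / h) *\<^sub>R (S h (G z) - G z) - z)) \<le>
          N (S h (G (G u)) - (G (G u) + h *\<^sub>R G u)) + N (S h (G (G u - z)) - G (G u - z)) + norm (h *\<^sub>R \<Phi> (G u - z))"
        by (simp only: norm_diff_add_le)
      also have "\<dots> \<le> N u * h * h + N (G u - z) * h + h * N (G u - z)"
        using N_S_taylor[of h u] N_S_minus_id[of h "G u - z"] elim by (intro add_mono) auto
      finally have "h * N ((1 / h) *\<^sub>R (S h (G z) - G z) - z) \<le> h * (N u * h + 2 * N (G u - z))"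
        using elim by (simp add: algebra_simps)
      then have "N ((1 / h) *\<^sub>R (S h (G z) - G z) - z) \<le> N u * h + 2 * N (G u - z)"
        using elim by (simp only: mult_le_cancel_left_pos)
      then show ?case using u elim by simp
    qed
  qed
  then have "((\<lambda>h. (1 / h) *\<^sub>R (S h (G z) - G z) - z) \<longlongrightarrow> 0) (at_right 0)" by (rule norm_le_N_tendsto)
  then show ?thesis by (simp add: LIM_zero_cancel)
qed

text \<open>If the quotients at \<open>x\<close> tend to \<open>y\<close>, applying \<open>G\<close>
  shows that those at \<open>G x\<close> tend to \<open>G y\<close>. By \<open>S_generator\<close>
  they also tend to \<open>x\<close>, so the generator is no larger than the inverse of
  \<open>G\<close>.\<close>

lemma S_generator_iff:
  "((\<lambda>h. (1 / h) *\<^sub>R (S h x - x)) \<longlongrightarrow> y) (at_right 0) \<longleftrightarrow> x = G y"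
proof
  assume "((\<lambda>h. (1 / h) *\<^sub>R (S h x - x)) \<longlongrightarrow> y) (at_right 0)"
  then have "((\<lambda>h. G ((1 / h) *\<^sub>R (S h x - x))) \<longlongrightarrow> G y) (at_right 0)"
    by (intro blinfun.tendsto tendsto_intros)
  moreover have "\<forall>\<^sub>F h in at_right 0. G ((1 / h) *\<^sub>R (S h x - x)) = (1 / h) *\<^sub>R (S h (G x) - G x)"
    using eventually_at_right_less[of "0::real"]
    by eventually_elim (simp add: S_G blinfun.bilinear_simps)
  ultimately have "((\<lambda>h. (1 / h) *\<^sub>R (S h (G x) - G x)) \<longlongrightarrow> G y) (at_right 0)"
    by (rule Lim_transform_eventually)
  then show "x = G y" using S_generator tendsto_unique trivial_limit_at_right_real by blast
qed (use S_generator in blast)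

end

text \<open>On the complement of the range of \<open>Pr\<close> the generator is taken to be \<open>-1\<close>; this is needed because the
  functions of the \<open>L\<^sup>2\<close> type below live on the whole line, whereas the states live on \<open>[0,L]\<close>.\<close>

theorem semigroup_on_projection:
  fixes Pr G :: "'a::{real_inner,banach,perfect_space} \<Rightarrow> 'a" and \<Phi> :: "'a \<Rightarrow> 'b::real_inner"
  assumes Pr: "bounded_linear Pr" and G: "bounded_linear G" and \<Phi>: "bounded_linear \<Phi>"
    and Pr_Pr: "\<And>x. Pr (Pr x) = Pr x" and G_Pr: "\<And>x. G (Pr x) = G x" and Pr_G: "\<And>x. Pr (G x) = G x"
    and \<Phi>_Pr: "\<And>x. \<Phi> (Pr x) = \<Phi> x"
    and inj: "\<And>x. Pr x = x \<Longrightarrow> G x = 0 \<Longrightarrow> x = 0"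
    and lower: "\<And>x. Pr x = x \<Longrightarrow> norm x \<le> C * norm (\<Phi> x)"
    and diss: "\<And>x. inner (\<Phi> x) (\<Phi> (G x)) \<le> 0"
  obtains T :: "real \<Rightarrow> 'a \<Rightarrow> 'a" where
    "\<And>t x. t \<ge> 0 \<Longrightarrow> Pr x = x \<Longrightarrow> Pr (T t x) = T t x"
    "\<And>t. t \<ge> 0 \<Longrightarrow> linear (T t)"
    "\<And>t x. t \<ge> 0 \<Longrightarrow> Pr x = x \<Longrightarrow> norm (\<Phi> (T t x)) \<le> norm (\<Phi> x)"
    "\<And>x. T 0 x = x"
    "\<And>s t x. s \<ge> 0 \<Longrightarrow> t \<ge> 0 \<Longrightarrow> T (s + t) x = T s (T t x)"
    "\<And>x. ((\<lambda>t. T t x) \<longlongrightarrow> x) (at_right 0)"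
    "\<And>x y. Pr x = x \<Longrightarrow> Pr y = y \<Longrightarrow> ((\<lambda>h. (1 / h) *\<^sub>R (T h x - x)) \<longlongrightarrow> y) (at_right 0) \<longleftrightarrow> x = G y"
    "\<And>J t x. bounded_linear J \<Longrightarrow> (\<And>x. J (Pr x) = Pr (J x)) \<Longrightarrow> (\<And>x. J (G x) = G (J x)) \<Longrightarrow> t \<ge> 0 \<Longrightarrow>
        T t (J x) = J (T t x)"
proof -
  interpret Pr: bounded_linear Pr by fact
  interpret G: bounded_linear G by fact
  interpret \<Phi>: bounded_linear \<Phi> by fact
  define G' where "G' x = G x - (x - Pr x)" for x
  \<comment> \<open>The second component supplies the lower bound on the complement of the range of
    \<open>Pr\<close>, where \<open>\<Phi>\<close> vanishes, and \<open>G'\<close> is dissipative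
    there because it acts as \<open>-1\<close>.\<close>
  define \<Phi>' where "\<Phi>' x = (\<Phi> x, x - Pr x)" for x
  have G': "bounded_linear G'"
    unfolding G'_def by (intro bounded_linear_sub G bounded_linear_ident Pr)
  have \<Phi>': "bounded_linear \<Phi>'"
    unfolding \<Phi>'_def by (intro bounded_linear_Pair bounded_linear_sub \<Phi> bounded_linear_ident Pr)
  have PrG': "Pr (G' x) = G x" for x
    by (simp add: G'_def Pr.diff Pr_Pr Pr_G)
  have \<Phi>G': "\<Phi>' (G' x) = (\<Phi> (G x), - (x - Pr x))" for x
  proof -
    have "\<Phi> (G' x) = \<Phi> (G x)" using \<Phi>_Pr[of "G' x"] by (simp add: PrG')
    then show ?thesis by (simp add: \<Phi>'_def PrG') (simp add: G'_def)
  qed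
  interpret D: dissipative_inverse "Blinfun G'" "Blinfun \<Phi>'" "\<bar>C\<bar> + 1"
  proof (unfold_locales, unfold bounded_linear_Blinfun_apply[OF G'] bounded_linear_Blinfun_apply[OF \<Phi>'])
    fix x assume x: "G' x = 0"
    then have "G x = 0" using PrG'[of x] by (simp add: Pr.zero)
    then have "Pr x = x" using x by (simp add: G'_def)
    then show "x = 0" using \<open>G x = 0\<close> by (rule inj)
  next
    fix x
    have n: "norm (\<Phi> x) \<le> norm (\<Phi>' x)" "norm (x - Pr x) \<le> norm (\<Phi>' x)"
      unfolding \<Phi>'_def by (rule norm_fst_le norm_snd_le)+
    have "norm x \<le> norm (Pr x) + norm (x - Pr x)" using norm_triangle_ineq[of "Pr x" "x - Pr x"] by simp
    also have "norm (Pr x) \<le> C * norm (\<Phi> (Pr x))" by (rule lower) (rule Pr_Pr)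
    also have "\<dots> \<le> \<bar>C\<bar> * norm (\<Phi>' x)" unfolding \<Phi>_Pr using n(1) by (intro mult_mono) auto
    finally show "norm x \<le> (\<bar>C\<bar> + 1) * norm (\<Phi>' x)" using n(2) by (simp add: algebra_simps)
  next
    fix x
    show "inner (\<Phi>' x) (\<Phi>' (G' x)) \<le> 0"
      unfolding \<Phi>G' using diss[of x] inner_ge_zero[of "x - Pr x"]
      by (simp add: \<Phi>'_def inner_prod_def del: minus_diff_eq inner_ge_zero)
  qed
  have comm: "D.S t (J x) = J (D.S t x)"
    if J: "bounded_linear J" "\<And>x. J (Pr x) = Pr (J x)" "\<And>x. J (G x) = G (J x)" and t: "t \<ge> 0" for J t x
  proof -
    interpret J: bounded_linear J by (rule J)
    have Ja: "oapp (Abs_blinop (Blinfun J)) = J"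
      by (simp add: oapp.rep_eq Abs_blinop_inverse bounded_linear_Blinfun_apply[OF J(1)])
    have "Blinfun G' (J x) = J (Blinfun G' x)" for x
      by (simp add: bounded_linear_Blinfun_apply[OF G'] G'_def J.diff J(2,3))
    then show ?thesis using D.S_commute[of "Abs_blinop (Blinfun J)" t x] t unfolding Ja by blast
  qed
  \<comment> \<open>With \<open>J = Pr\<close> the commutation property keeps orbits of states
    inside the space of states.\<close>
  have PrS: "Pr (D.S t x) = D.S t (Pr x)" if "t \<ge> 0" for t x
    using comm[OF Pr _ _ that] G_Pr Pr_G by simp
  show thesis
  proof (rule that[of D.S], goal_cases)
    case (1 t x) then show ?case using PrS[of t x] by simp
  next
    case (3 t x) then show ?case using D.N_S[of t x] PrS[of t x]
      by (simp add: bounded_linear_Blinfun_apply[OF \<Phi>'] \<Phi>'_def norm_Pair)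
  next
    case (7 x y) then show ?case
      unfolding D.S_generator_iff by (simp add: bounded_linear_Blinfun_apply[OF G'] G'_def)
  next
    case (8 J t x) then show ?case using comm by blast
  qed (auto intro: D.S_linear D.S_add D.S_continuous)
qed

section \<open>The Hilbert space of square integrable functions\<close>

lemma borel_measurable_cnj [measurable]: "cnj \<in> borel_measurable borel"
  by (intro borel_measurable_continuous_onI continuous_intros)

lemma Re_mult_cnj_self: "Re (z * cnj z) = (cmod z)\<^sup>2"
  unfolding cmod_power2 by (simp add: power2_eq_square)

definition sqi :: "(real \<Rightarrow> complex) \<Rightarrow> bool" where
  "sqi f \<longleftrightarrow> f \<in> borel_measurable lborel \<and> integrable lborel (\<lambda>x. (cmod (f x))\<^sup>2)"

lemma sqi_measurable [measurable_dest]: "sqi f \<Longrightarrow> f \<in> borel_measurable lborel"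
  by (simp add: sqi_def)

lemma sqi_integrable: "sqi f \<Longrightarrow> integrable lborel (\<lambda>x. (cmod (f x))\<^sup>2)"
  by (simp add: sqi_def)

lemma sqi_bound:
  assumes "f \<in> borel_measurable lborel" "integrable lborel g" "\<And>x. (cmod (f x))\<^sup>2 \<le> g x"
  shows "sqi f"
  unfolding sqi_def
proof
  show "integrable lborel (\<lambda>x. (cmod (f x))\<^sup>2)"
    by (rule Bochner_Integration.integrable_bound[OF assms(2)])
       (use assms in \<open>auto intro: order_trans[OF _ abs_ge_self]\<close>)
qed fact

lemma norm_add_sq_le: "(norm (a + b))\<^sup>2 \<le> 2 * (norm a)\<^sup>2 + 2 * (norm b)\<^sup>2" for a b :: "'a::real_normed_vector"
proof -
  have "(norm (a + b))\<^sup>2 \<le> (norm a + norm b)\<^sup>2" by (intro power_mono norm_triangle_ineq) simp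
  also have "\<dots> \<le> 2 * (norm a)\<^sup>2 + 2 * (norm b)\<^sup>2"
    using zero_le_power2[of "norm a - norm b"] by (simp add: power2_eq_square algebra_simps)
  finally show ?thesis .
qed

lemma sqi_0 [simp]: "sqi (\<lambda>x. 0)"
  by (simp add: sqi_def)

lemma sqi_add [intro]: assumes "sqi f" "sqi g" shows "sqi (\<lambda>x. f x + g x)"
proof (rule sqi_bound)
  show "integrable lborel (\<lambda>x. 2 * (cmod (f x))\<^sup>2 + 2 * (cmod (g x))\<^sup>2)"
    by (intro Bochner_Integration.integrable_add integrable_mult_right sqi_integrable assms)
qed (use assms norm_add_sq_le in \<open>auto simp: sqi_def\<close>)

lemma sqi_mult_bounded:
  assumes "sqi f" "m \<in> borel_measurable lborel" "\<And>x. cmod (m x) \<le> K"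
  shows "sqi (\<lambda>x. m x * f x)"
proof (rule sqi_bound)
  show "integrable lborel (\<lambda>x. K\<^sup>2 * (cmod (f x))\<^sup>2)"
    by (intro integrable_mult_right sqi_integrable assms)
  show "(cmod (m x * f x))\<^sup>2 \<le> K\<^sup>2 * (cmod (f x))\<^sup>2" for x
    unfolding norm_mult power_mult_distrib using assms(3) by (intro mult_right_mono power_mono) auto
qed (use assms in \<open>auto simp: sqi_def\<close>)

lemma sqi_scale [intro]: "sqi f \<Longrightarrow> sqi (\<lambda>x. c * f x)"
  by (rule sqi_mult_bounded[of f "\<lambda>_. c" "cmod c"]) auto

lemma sqi_scaleR [intro]: "sqi f \<Longrightarrow> sqi (\<lambda>x. r *\<^sub>R f x)"
  unfolding scaleR_conv_of_real by (rule sqi_scale)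

lemma sqi_uminus [intro]: "sqi f \<Longrightarrow> sqi (\<lambda>x. - f x)"
  using sqi_scale[of f "-1"] by simp

lemma sqi_diff [intro]: "sqi f \<Longrightarrow> sqi g \<Longrightarrow> sqi (\<lambda>x. f x - g x)"
  using sqi_add[of f "\<lambda>x. - g x"] by (simp add: sqi_uminus)

lemma sqi_prod_integrable:
  assumes "sqi f" "sqi g" shows "integrable lborel (\<lambda>x. f x * cnj (g x))"
proof (rule Bochner_Integration.integrable_bound)
  show "integrable lborel (\<lambda>x. (cmod (f x))\<^sup>2 + (cmod (g x))\<^sup>2)"
    by (intro Bochner_Integration.integrable_add sqi_integrable assms)
  have "cmod (f x * cnj (g x)) \<le> (cmod (f x))\<^sup>2 + (cmod (g x))\<^sup>2" for x
  proof -
    have "0 \<le> cmod (f x) * cmod (g x)" by simp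
    moreover have "2 * (cmod (f x) * cmod (g x)) \<le> (cmod (f x))\<^sup>2 + (cmod (g x))\<^sup>2"
      using zero_le_power2[of "cmod (f x) - cmod (g x)"] by (simp add: power2_eq_square algebra_simps)
    ultimately show ?thesis unfolding norm_mult complex_mod_cnj by linarith
  qed
  then show "AE x in lborel. cmod (f x * cnj (g x)) \<le> norm ((cmod (f x))\<^sup>2 + (cmod (g x))\<^sup>2)"
    by (intro AE_I2) (metis abs_ge_self order_trans real_norm_def)
  show "(\<lambda>x. f x * cnj (g x)) \<in> borel_measurable lborel"
    using assms[THEN sqi_measurable] by measurable
qed

lemma sqi_Re_integrable:
  assumes "sqi f" "sqi g" shows "integrable lborel (\<lambda>x. Re (f x * cnj (g x)))"
  by (rule integrable_Re[OF sqi_prod_integrable[OF assms]])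

\<comment> \<open>One type serves every length \<open>L\<close>: classes are taken on the whole
  line, and functions on \<open>[0,L]\<close> enter extended by zero.\<close>
quotient_type l2 = "real \<Rightarrow> complex" / partial: "\<lambda>f g. sqi f \<and> sqi g \<and> (AE x in lborel. f x = g x)"
  by (rule part_equivpI) (auto simp: symp_def transp_def intro!: exI[of _ "\<lambda>x. 0"] elim: AE_mp)

text \<open>The inner product is the real part of the complex one, to match the real semigroup
  theory above. Complex scalars return later as the operators \<open>Jop c\<close>.\<close>

instantiation l2 :: real_inner
begin
lift_definition zero_l2 :: l2 is "\<lambda>x. 0" by simp
lift_definition plus_l2 :: "l2 \<Rightarrow> l2 \<Rightarrow> l2" is "\<lambda>f g x. f x + g x" by auto
lift_definition minus_l2 :: "l2 \<Rightarrow> l2 \<Rightarrow> l2" is "\<lambda>f g x. f x - g x" by auto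
lift_definition uminus_l2 :: "l2 \<Rightarrow> l2" is "\<lambda>f x. - f x" by auto
lift_definition scaleR_l2 :: "real \<Rightarrow> l2 \<Rightarrow> l2" is "\<lambda>r f x. r *\<^sub>R f x" by auto
lift_definition inner_l2 :: "l2 \<Rightarrow> l2 \<Rightarrow> real" is "\<lambda>f g. LINT x|lborel. Re (f x * cnj (g x))"
  by (intro integral_cong_AE) (auto simp: sqi_def)
definition norm_l2 :: "l2 \<Rightarrow> real" where "norm_l2 x = sqrt (inner x x)"
definition dist_l2 :: "l2 \<Rightarrow> l2 \<Rightarrow> real" where "dist_l2 x y = norm (x - y)"
definition sgn_l2 :: "l2 \<Rightarrow> l2" where "sgn_l2 x = (inverse (norm x)) *\<^sub>R x"
definition uniformity_l2 :: "(l2 \<times> l2) filter"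
  where "uniformity_l2 = (INF e\<in>{0<..}. principal {(x, y). dist x y < e})"
definition open_l2 :: "l2 set \<Rightarrow> bool"
  where "open_l2 S = (\<forall>x\<in>S. \<forall>\<^sub>F (x', y) in uniformity. x' = x \<longrightarrow> y \<in> S)"
instance
proof
  fix x y z :: l2 and r s :: real
  show "x + y + z = x + (y + z)" by transfer (auto simp: add.assoc)
  show "x + y = y + x" by transfer (auto simp: add.commute)
  show "0 + x = x" by transfer auto
  show "- x + x = 0" by transfer auto
  show "x - y = x + - y" by transfer auto
  show "r *\<^sub>R (x + y) = r *\<^sub>R x + r *\<^sub>R y" by transfer (auto simp: scaleR_add_right)
  show "(r + s) *\<^sub>R x = r *\<^sub>R x + s *\<^sub>R x" by transfer (auto simp: scaleR_add_left)
  show "r *\<^sub>R s *\<^sub>R x = (r * s) *\<^sub>R x" by transfer auto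
  show "1 *\<^sub>R x = x" by transfer auto
  show "dist x y = norm (x - y)" by (rule dist_l2_def)
  show "sgn x = inverse (norm x) *\<^sub>R x" by (rule sgn_l2_def)
  show "uniformity = (INF e\<in>{0<..}. principal {(x :: l2, y). dist x y < e})" by (rule uniformity_l2_def)
  show "open U = (\<forall>x\<in>U. \<forall>\<^sub>F (x', y) in uniformity. x' = x \<longrightarrow> y \<in> U)" for U :: "l2 set" by (rule open_l2_def)
  show "inner x y = inner y x" by transfer (simp add: mult.commute)
  show "inner (x + y) z = inner x z + inner y z"
  proof transfer
    fix f g h :: "real \<Rightarrow> complex"
    assume "sqi f \<and> sqi f \<and> (AE x in lborel. f x = f x)" "sqi g \<and> sqi g \<and> (AE x in lborel. g x = g x)"
      "sqi h \<and> sqi h \<and> (AE x in lborel. h x = h x)"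
    then have fh: "sqi f" "sqi h" and gh: "sqi g" "sqi h" by blast+
    show "(LINT x|lborel. Re ((f x + g x) * cnj (h x))) =
        (LINT x|lborel. Re (f x * cnj (h x))) + (LINT x|lborel. Re (g x * cnj (h x)))"
      unfolding distrib_right plus_complex.sel
      by (rule Bochner_Integration.integral_add[OF sqi_Re_integrable[OF fh] sqi_Re_integrable[OF gh]])
  qed
  show "inner (r *\<^sub>R x) y = r * inner x y"
  proof transfer
    fix r and f g :: "real \<Rightarrow> complex"
    show "(LINT x|lborel. Re (r *\<^sub>R f x * cnj (g x))) = r * (LINT x|lborel. Re (f x * cnj (g x)))"
      by (subst integral_mult_right_zero[symmetric]) (simp add: algebra_simps)
  qed
  show "0 \<le> inner x x" by transfer (simp add: complex_mult_cnj)
  show "inner x x = 0 \<longleftrightarrow> x = 0"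
  proof transfer
    fix f :: "real \<Rightarrow> complex" assume f: "sqi f \<and> sqi f \<and> (AE x in lborel. f x = f x)"
    show "(LINT x|lborel. Re (f x * cnj (f x))) = 0 \<longleftrightarrow> sqi f \<and> sqi (\<lambda>x. 0) \<and> (AE x in lborel. f x = 0)"
      unfolding Re_mult_cnj_self using f by (subst integral_nonneg_eq_0_iff_AE) (auto simp: sqi_def)
  qed
  show "norm x = sqrt (inner x x)" by (rule norm_l2_def)
qed
end

lemma sqi_rep [simp]: "sqi (rep_l2 x)"
  using Quotient3_rep_reflp[OF Quotient3_l2] by blast

lemma rep_abs_l2: "sqi f \<Longrightarrow> AE x in lborel. rep_l2 (abs_l2 f) x = f x"
  using Quotient3_rep_abs[OF Quotient3_l2, of f] by auto

lemma abs_rep_l2 [simp]: "abs_l2 (rep_l2 x) = x"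
  by (rule Quotient3_abs_rep[OF Quotient3_l2])

lemma abs_l2_eq_iff: "sqi f \<Longrightarrow> sqi g \<Longrightarrow> abs_l2 f = abs_l2 g \<longleftrightarrow> (AE x in lborel. f x = g x)"
  using Quotient3_rel[OF Quotient3_l2, of f g] by auto

lemma abs_l2_add: "sqi f \<Longrightarrow> sqi g \<Longrightarrow> abs_l2 (\<lambda>x. f x + g x) = abs_l2 f + abs_l2 g"
  by (simp add: plus_l2.abs_eq)

lemma abs_l2_diff: "sqi f \<Longrightarrow> sqi g \<Longrightarrow> abs_l2 (\<lambda>x. f x - g x) = abs_l2 f - abs_l2 g"
  by (simp add: minus_l2.abs_eq)

lemma abs_l2_scaleR: "sqi f \<Longrightarrow> abs_l2 (\<lambda>x. r *\<^sub>R f x) = r *\<^sub>R abs_l2 f"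
  by (simp add: scaleR_l2.abs_eq)

lemma inner_abs_l2: "sqi f \<Longrightarrow> sqi g \<Longrightarrow> inner (abs_l2 f) (abs_l2 g) = (LINT x|lborel. Re (f x * cnj (g x)))"
  by (simp add: inner_l2.abs_eq)

lemma norm_abs_l2_sq: "sqi f \<Longrightarrow> (norm (abs_l2 f))\<^sup>2 = (LINT x|lborel. (cmod (f x))\<^sup>2)"
  by (simp only: power2_norm_eq_inner inner_abs_l2 Re_mult_cnj_self)

lemma norm_diff_l2_sq: "(norm (x - y))\<^sup>2 = (LINT t|lborel. (cmod (rep_l2 x t - rep_l2 y t))\<^sup>2)"
  using norm_abs_l2_sq[of "\<lambda>t. rep_l2 x t - rep_l2 y t"] by (simp add: abs_l2_diff sqi_diff)

lemma nn_norm_diff_l2_sq: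
  "(\<integral>\<^sup>+t. ennreal ((cmod (rep_l2 x t - rep_l2 y t))\<^sup>2) \<partial>lborel) = ennreal ((norm (x - y))\<^sup>2)"
  unfolding norm_diff_l2_sq by (intro nn_integral_eq_integral sqi_integrable sqi_diff) auto

section \<open>Completeness of the space of square integrable functions\<close>

lemma Cauchy_fast_subseq:
  fixes X :: "nat \<Rightarrow> 'a::metric_space"
  assumes X: "Cauchy X" and e: "\<And>k. e k > (0::real)"
  obtains r where "strict_mono r" "\<And>k. dist (X (r (Suc k))) (X (r k)) < e k"
proof -
  have "\<exists>M. \<forall>m\<ge>M. \<forall>n\<ge>M. dist (X m) (X n) < e k" for k using metric_CauchyD[OF X e] by blast
  then obtain M where M: "\<And>k m n. m \<ge> M k \<Longrightarrow> n \<ge> M k \<Longrightarrow> dist (X m) (X n) < e k" by metis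
  define r where "r = rec_nat (M 0) (\<lambda>k rk. max (Suc rk) (M (Suc k)))"
  have rS: "r (Suc k) = max (Suc (r k)) (M (Suc k))" for k by (simp add: r_def)
  have rM: "r k \<ge> M k" for k by (cases k) (simp_all add: rS, simp add: r_def)
  have mono: "strict_mono r" unfolding strict_mono_Suc_iff rS by (auto simp: less_max_iff_disj)
  have "dist (X (r (Suc k))) (X (r k)) < e k" for k
    using M[of k "r (Suc k)" "r k"] rM[of k] strict_mono_leD[OF mono, of k "Suc k"] by simp
  with mono show thesis by (rule that)
qed

text \<open>Expanding \<open>2^k (2^-k - a)^2 \<ge> 0\<close> bounds \<open>a\<close> by a geometric
  term plus a weighted square. Thus pointwise convergence follows from integrals of squares alone,
  without the triangle inequality for infinite sums in \<open>L^2\<close>.\<close>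

lemma summable_of_weighted_squares:
  fixes a :: "nat \<Rightarrow> real"
  assumes "summable (\<lambda>k. 2 ^ k * (a k)\<^sup>2)" "\<And>k. a k \<ge> 0"
  shows "summable a"
proof (rule summable_comparison_test')
  show "summable (\<lambda>k. (1/2) ^ k + 2 ^ k * (a k)\<^sup>2)"
    by (intro summable_add assms(1) summable_geometric) simp
  fix k
  have "0 \<le> 2 ^ k * ((1/2) ^ k - a k)\<^sup>2" by simp
  also have "\<dots> = (2 ^ k * (1/2) ^ k) * (1/2) ^ k - 2 * (2 ^ k * (1/2) ^ k) * a k + 2 ^ k * (a k)\<^sup>2"
    by (simp only: power2_eq_square algebra_simps)
  also have "2 ^ k * (1/2) ^ k = (1::real)"
    by (simp flip: power_mult_distrib)
  finally show "norm (a k) \<le> (1/2) ^ k + 2 ^ k * (a k)\<^sup>2"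
    using assms(2)[of k] by simp
qed

text \<open>Riesz-Fischer: a rapidly converging subsequence has a pointwise limit almost everywhere,
  and Fatou's lemma bounds the distance of the whole sequence from it.\<close>

instance l2 :: banach
proof
  fix X :: "nat \<Rightarrow> l2" assume X: "Cauchy X"
  \<comment> \<open>The squared distances are below \<open>(1/4)^k\<close>, so a geometric series is
    left after weighting by \<open>2^k\<close>.\<close>
  obtain r where r: "strict_mono r" "\<And>k. dist (X (r (Suc k))) (X (r k)) < (1/2) ^ k"
    using Cauchy_fast_subseq[OF X, of "\<lambda>k. (1/2) ^ k"] by auto
  define F where "F k = rep_l2 (X (r k))" for k
  have sF: "sqi (F k)" for k by (simp add: F_def)
  have mF [measurable]: "F k \<in> borel_measurable borel" for k using sqi_measurable[OF sF[of k]] by simp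
  define a where "a k x = cmod (F (Suc k) x - F k x)" for k x
  have ma [measurable]: "a k \<in> borel_measurable borel" for k unfolding a_def by measurable
  have int_a: "(\<integral>\<^sup>+x. ennreal ((a k x)\<^sup>2) \<partial>lborel) \<le> ennreal ((1/4) ^ k)" for k
  proof -
    have "(norm (X (r (Suc k)) - X (r k)))\<^sup>2 \<le> ((1/2) ^ k)\<^sup>2"
      using r(2)[of k] by (intro power_mono) (auto simp: dist_norm)
    also have "\<dots> = (1/4) ^ k" by (simp add: power2_eq_square flip: power_mult_distrib)
    finally show ?thesis unfolding a_def F_def nn_norm_diff_l2_sq by (rule ennreal_leI)
  qed
  have "(\<integral>\<^sup>+x. (\<Sum>k. ennreal (2 ^ k * (a k x)\<^sup>2)) \<partial>lborel) = (\<Sum>k. \<integral>\<^sup>+x. ennreal (2 ^ k * (a k x)\<^sup>2) \<partial>lborel)"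
    by (rule nn_integral_suminf) measurable
  also have "\<dots> \<le> (\<Sum>k. ennreal ((1/2) ^ k))"
  proof (intro suminf_le allI)
    fix k
    have "(\<integral>\<^sup>+x. ennreal (2 ^ k * (a k x)\<^sup>2) \<partial>lborel) = ennreal (2 ^ k) * (\<integral>\<^sup>+x. ennreal ((a k x)\<^sup>2) \<partial>lborel)"
      by (subst nn_integral_cmult[symmetric]) (auto simp: ennreal_mult)
    also have "\<dots> \<le> ennreal (2 ^ k) * ennreal ((1/4) ^ k)" by (intro mult_left_mono int_a) simp
    also have "\<dots> = ennreal ((1/2) ^ k)" by (simp flip: ennreal_mult power_mult_distrib)
    finally show "(\<integral>\<^sup>+x. ennreal (2 ^ k * (a k x)\<^sup>2) \<partial>lborel) \<le> ennreal ((1/2) ^ k)" .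
  qed auto
  also have "\<dots> = ennreal (\<Sum>k. (1/2) ^ k)"
    by (rule suminf_ennreal2) (auto intro: summable_geometric)
  also have "\<dots> < \<infinity>" by simp
  finally have "AE x in lborel. (\<Sum>k. ennreal (2 ^ k * (a k x)\<^sup>2)) \<noteq> \<infinity>"
    by (intro nn_integral_PInf_AE) auto
  then have conv: "AE x in lborel. convergent (\<lambda>k. F k x)"
  proof eventually_elim
    case (elim x)
    have "summable (\<lambda>k. 2 ^ k * (a k x)\<^sup>2)"
      using elim by (intro summable_suminf_not_top) auto
    then have "summable (\<lambda>k. a k x)"
      by (rule summable_of_weighted_squares) (simp add: a_def)
    then have "summable (\<lambda>k. F (Suc k) x - F k x)"
      unfolding a_def by (rule summable_norm_cancel)
    then have "convergent (\<lambda>n. F n x - F 0 x)"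
      by (simp add: summable_iff_convergent sum_lessThan_telescope[of "\<lambda>k. F k x"])
    then show ?case by (simp add: convergent_diff_const_right_iff)
  qed
  define f where "f x = lim (\<lambda>k. F k x)" for x
  have mf [measurable]: "f \<in> borel_measurable borel" unfolding f_def by (intro borel_measurable_lim_metric) simp
  have lim: "AE x in lborel. (\<lambda>k. F k x) \<longlonglongrightarrow> f x"
    using conv by eventually_elim (simp add: f_def convergent_LIMSEQ_iff)
  have est: "(\<integral>\<^sup>+x. ennreal ((cmod (rep_l2 (X n) x - f x))\<^sup>2) \<partial>lborel) \<le> ennreal (e\<^sup>2)"
    if e: "e > 0" and n: "\<And>m. m \<ge> n \<Longrightarrow> dist (X n) (X m) < e" for n e
  proof -
    let ?e = "\<lambda>k x. ennreal ((cmod (rep_l2 (X n) x - F k x))\<^sup>2)" and ?d = "\<lambda>x. ennreal ((cmod (rep_l2 (X n) x - f x))\<^sup>2)"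
    have [measurable]: "rep_l2 (X n) \<in> borel_measurable borel" using sqi_measurable[OF sqi_rep] by simp
    have "(\<integral>\<^sup>+x. ?d x \<partial>lborel)
        = (\<integral>\<^sup>+x. liminf (\<lambda>k. ?e k x) \<partial>lborel)"
    proof (rule nn_integral_cong_AE)
      show "AE x in lborel. ?d x
          = liminf (\<lambda>k. ?e k x)"
        using lim
      proof eventually_elim
        case (elim x)
        then have "(\<lambda>k. ?e k x) \<longlonglongrightarrow> ?d x"
          by (intro tendsto_intros tendsto_ennrealI)
        from lim_imp_Liminf[OF _ this] show ?case by simp
      qed
    qed
    also have "\<dots> \<le> liminf (\<lambda>k. \<integral>\<^sup>+x. ?e k x \<partial>lborel)"
      by (rule nn_integral_liminf) measurable
    also have "\<dots> \<le> ennreal (e\<^sup>2)"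
    proof (rule Liminf_le)
      have "(\<integral>\<^sup>+x. ?e k x \<partial>lborel) \<le> ennreal (e\<^sup>2)" if "k \<ge> n" for k
      proof -
        have "r k \<ge> n" using that seq_suble[OF r(1), of k] by linarith
        then have "norm (X n - X (r k)) < e" using n by (simp add: dist_norm)
        then show ?thesis unfolding F_def nn_norm_diff_l2_sq using e by (intro ennreal_leI power_mono) auto
      qed
      then show "\<forall>\<^sub>F k in sequentially. (\<integral>\<^sup>+x. ?e k x \<partial>lborel) \<le> ennreal (e\<^sup>2)"
        using eventually_sequentially by blast
    qed simp
    finally show ?thesis .
  qed
  have sqd: "sqi (\<lambda>x. rep_l2 (X n) x - f x)" if e: "e > 0" and n: "\<And>m. m \<ge> n \<Longrightarrow> dist (X n) (X m) < e" for n e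
    unfolding sqi_def
  proof
    have [measurable]: "rep_l2 (X n) \<in> borel_measurable borel" using sqi_measurable[OF sqi_rep] by simp
    show "(\<lambda>x. rep_l2 (X n) x - f x) \<in> borel_measurable lborel" by measurable
    show "integrable lborel (\<lambda>x. (cmod (rep_l2 (X n) x - f x))\<^sup>2)"
      by (rule integrableI_bounded) (use est[OF e n] in \<open>auto intro: order_le_less_trans\<close>)
  qed
  have sf: "sqi f"
  proof -
    obtain n where "\<And>m. m \<ge> n \<Longrightarrow> dist (X n) (X m) < 1" using metric_CauchyD[OF X, of 1] by auto
    then have "sqi (\<lambda>x. rep_l2 (X n) x - (rep_l2 (X n) x - f x))" by (intro sqi_diff sqi_rep sqd[of 1]) auto
    then show ?thesis by simp
  qed
  have "X \<longlonglongrightarrow> abs_l2 f"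
  proof (rule metric_LIMSEQ_I)
    fix e :: real assume "e > 0"
    then have e: "e / 2 > 0" by simp
    obtain N where N: "\<And>m n. m \<ge> N \<Longrightarrow> n \<ge> N \<Longrightarrow> dist (X m) (X n) < e / 2" using metric_CauchyD[OF X e] by blast
    show "\<exists>N. \<forall>n\<ge>N. dist (X n) (abs_l2 f) < e"
    proof (intro exI allI impI)
      fix n assume n: "n \<ge> N"
      then have nm: "\<And>m. m \<ge> n \<Longrightarrow> dist (X n) (X m) < e / 2" using N by simp
      have "ennreal ((norm (X n - abs_l2 f))\<^sup>2) = (\<integral>\<^sup>+t. ennreal ((cmod (rep_l2 (X n) t - rep_l2 (abs_l2 f) t))\<^sup>2) \<partial>lborel)"
        by (simp add: nn_norm_diff_l2_sq)
      also have "\<dots> = (\<integral>\<^sup>+t. ennreal ((cmod (rep_l2 (X n) t - f t))\<^sup>2) \<partial>lborel)"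
        by (intro nn_integral_cong_AE) (use rep_abs_l2[OF sf] in auto)
      also have "\<dots> \<le> ennreal ((e / 2)\<^sup>2)" by (rule est[OF e nm])
      finally have "(norm (X n - abs_l2 f))\<^sup>2 \<le> (e / 2)\<^sup>2" using ennreal_le_iff by (metis zero_le_power2)
      then have "norm (X n - abs_l2 f) \<le> e / 2" by (rule power2_le_imp_le) (use e in simp)
      then show "dist (X n) (abs_l2 f) < e" using \<open>e > 0\<close> by (simp add: dist_norm)
    qed
  qed
  then show "convergent X" by (auto simp: convergent_def)
qed

section \<open>Absolutely continuous functions and Sobolev spaces on an interval\<close>

lemma integrable_product_lborel:
  fixes f g :: "real \<Rightarrow> complex"
  assumes f: "integrable lborel f" and g: "integrable lborel g"
  shows "integrable (lborel \<Otimes>\<^sub>M lborel) (\<lambda>(x, y). f x * g y)"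
proof (rule lborel_pair.Fubini_integrable)
  have [measurable]: "f \<in> borel_measurable lborel" "g \<in> borel_measurable lborel"
    using f g by auto
  show "(\<lambda>(x, y). f x * g y) \<in> borel_measurable (lborel \<Otimes>\<^sub>M lborel)" by measurable
  have "(\<lambda>x. LINT y|lborel. norm (case (x, y) of (x, y) \<Rightarrow> f x * g y)) = (\<lambda>x. norm (f x) * (LINT y|lborel. norm (g y)))"
    by (simp add: norm_mult)
  then show "integrable lborel (\<lambda>x. LINT y|lborel. norm (case (x, y) of (x, y) \<Rightarrow> f x * g y))"
    using f by simp
  show "AE x in lborel. integrable lborel (\<lambda>y. case (x, y) of (x, y) \<Rightarrow> f x * g y)"
    using g by simp
qed

text \<open>The product of the two integrals is an integral over a square, which the diagonal splits into two
  triangles.\<close>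

lemma integral_by_parts_AC:
  fixes f g :: "real \<Rightarrow> complex"
  assumes f: "set_integrable lborel {0..L} f" and g: "set_integrable lborel {0..L} g"
  shows "(LINT s:{0..L}|lborel. f s * (LINT t:{0..s}|lborel. g t) + (LINT t:{0..s}|lborel. f t) * g s)
     = (LINT s:{0..L}|lborel. f s) * (LINT s:{0..L}|lborel. g s)" (is ?eq)
    and "set_integrable lborel {0..L} (\<lambda>s. f s * (LINT t:{0..s}|lborel. g t) + (LINT t:{0..s}|lborel. f t) * g s)" (is ?int)
proof -
  let ?F = "\<lambda>s. LINT t:{0..s}|lborel. f t" and ?G = "\<lambda>s. LINT t:{0..s}|lborel. g t"
  define f1 g1 where "f1 s = indicator {0..L} s *\<^sub>R f s" and "g1 s = indicator {0..L} s *\<^sub>R g s" for s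
  have i: "integrable lborel f1" "integrable lborel g1"
    using f g by (simp_all add: set_integrable_def f1_def[abs_def] g1_def[abs_def])
  then have [measurable]: "f1 \<in> borel_measurable lborel" "g1 \<in> borel_measurable lborel" by auto
  let ?P = "lborel \<Otimes>\<^sub>M lborel :: (real \<times> real) measure"
  let ?H = "\<lambda>(s, t). f1 s * g1 t"
  let ?A = "\<lambda>(s, t). indicator {(s, t). t \<le> s} (s, t) *\<^sub>R (f1 s * g1 t)"
  let ?B = "\<lambda>(s, t). indicator {(s, t). s < t} (s, t) *\<^sub>R (f1 s * g1 t)"
  have H: "integrable ?P ?H" by (rule integrable_product_lborel[OF i])
  have m1: "{(s, t). t \<le> s} \<in> sets ?P" and m2: "{(s, t). s < t} \<in> sets ?P"
  proof -
    have "Measurable.pred ?P (\<lambda>(s, t). t \<le> s)" "Measurable.pred ?P (\<lambda>(s, t). s < t)" by measurable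
    then show "{(s, t). t \<le> s} \<in> sets ?P" "{(s, t). s < t} \<in> sets ?P"
      by (simp_all add: pred_def space_pair_measure)
  qed
  have A: "integrable ?P ?A" using integrable_mult_indicator[OF m1 H] by (simp add: case_prod_unfold)
  have B: "integrable ?P ?B" using integrable_mult_indicator[OF m2 H] by (simp add: case_prod_unfold)
  have "integral\<^sup>L ?P ?H = (LINT s|lborel. LINT t|lborel. f1 s * g1 t)"
    by (rule lborel_pair.integral_fst[OF H, symmetric])
  also have "\<dots> = (LINT s|lborel. f1 s) * (LINT t|lborel. g1 t)" by simp
  finally have sq: "integral\<^sup>L ?P ?H = (LINT s:{0..L}|lborel. f s) * (LINT s:{0..L}|lborel. g s)"
    unfolding f1_def g1_def set_lebesgue_integral_def .
  have iA: "(LINT t|lborel. indicator {(s, t). t \<le> s} (s, t) *\<^sub>R (f1 s * g1 t))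
      = indicator {0..L} s *\<^sub>R (f s * ?G s)" for s
  proof -
    have "(LINT t|lborel. indicator {(s, t). t \<le> s} (s, t) *\<^sub>R (f1 s * g1 t))
       = (LINT t|lborel. f1 s * (indicator {0..s} t *\<^sub>R g t))"
      by (intro Bochner_Integration.integral_cong) (auto simp: f1_def g1_def indicator_def)
    also have "\<dots> = f1 s * (LINT t|lborel. indicator {0..s} t *\<^sub>R g t)" by (rule integral_mult_right_zero)
    finally show ?thesis by (simp only: set_lebesgue_integral_def f1_def mult_scaleR_left)
  qed
  have iB: "(LINT s|lborel. indicator {(s, t). s < t} (s, t) *\<^sub>R (f1 s * g1 t))
      = indicator {0..L} t *\<^sub>R (?F t * g t)" for t
  proof -
    have "(LINT s|lborel. indicator {(s, t). s < t} (s, t) *\<^sub>R (f1 s * g1 t))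
       = (LINT s|lborel. (indicator {0..t} s *\<^sub>R f s) * g1 t)"
    proof (cases "t \<in> {0..L}")
      case True
      \<comment> \<open>The diagonal was counted in the other triangle, so this slice and the closed
        interval differ in one point.\<close>
      have e: "AE s in lborel. indicator {(s, t). s < t} (s, t) *\<^sub>R (f1 s * g1 t) = (indicator {0..t} s *\<^sub>R f s) * g1 t"
        using AE_lborel_singleton[of t] by eventually_elim (use True in \<open>auto simp: f1_def g1_def indicator_def\<close>)
      have "(\<lambda>s. indicator {0..t} s *\<^sub>R f s) = (\<lambda>s. indicator {0..t} s *\<^sub>R f1 s)"
        using True by (auto simp: f1_def indicator_def)
      then have "(\<lambda>s. indicator {0..t} s *\<^sub>R f s) \<in> borel_measurable lborel" by simp
      then have "(\<lambda>s. indicator {0..t} s *\<^sub>R f s * g1 t) \<in> borel_measurable lborel"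
        by (rule borel_measurable_times) simp
      moreover have "(\<lambda>s. indicator {(s, t). s < t} (s, t) *\<^sub>R (f1 s * g1 t)) \<in> borel_measurable lborel"
        by measurable
      ultimately show ?thesis using e by (intro integral_cong_AE)
    qed (simp add: g1_def)
    also have "\<dots> = (LINT s|lborel. indicator {0..t} s *\<^sub>R f s) * g1 t" by (rule integral_mult_left_zero)
    finally show ?thesis by (simp only: set_lebesgue_integral_def g1_def mult_scaleR_right)
  qed
  have intA: "set_integrable lborel {0..L} (\<lambda>s. f s * ?G s)"
    using lborel_pair.integrable_fst[OF A] unfolding iA by (simp add: set_integrable_def)
  have intB: "set_integrable lborel {0..L} (\<lambda>s. ?F s * g s)"
    using lborel_pair.integrable_snd[OF B] unfolding iB by (simp add: set_integrable_def)
  show ?int using intA intB by (rule set_integral_add)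
  have "integral\<^sup>L ?P ?H = integral\<^sup>L ?P (\<lambda>x. ?A x + ?B x)"
    by (intro Bochner_Integration.integral_cong) (auto simp: indicator_def)
  also have "\<dots> = integral\<^sup>L ?P ?A + integral\<^sup>L ?P ?B"
    by (rule Bochner_Integration.integral_add[OF A B])
  also have "integral\<^sup>L ?P ?A = (LINT s:{0..L}|lborel. f s * ?G s)"
    using lborel_pair.integral_fst[OF A] unfolding iA by (simp add: set_lebesgue_integral_def)
  also have "integral\<^sup>L ?P ?B = (LINT s:{0..L}|lborel. ?F s * g s)"
    using lborel_pair.integral_snd[OF B] unfolding iB by (simp add: set_lebesgue_integral_def)
  also have "(LINT s:{0..L}|lborel. f s * ?G s) + (LINT s:{0..L}|lborel. ?F s * g s)
     = (LINT s:{0..L}|lborel. f s * ?G s + ?F s * g s)"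
    by (rule set_integral_add(2)[OF intA intB, symmetric])
  finally show ?eq using sq by simp
qed

text \<open>After extension by zero the integral vanishes over every half-line. Half-lines are
  stable under intersection and generate the Borel sets, so it vanishes over all of these, and a
  density with this property is zero almost everywhere.\<close>

lemma AE_zero_if_integrals_zero:
  fixes f :: "real \<Rightarrow> complex"
  assumes f: "set_integrable lborel {0..L} f" and L: "L \<ge> 0"
    and zero: "\<And>x. x \<in> {0..L} \<Longrightarrow> (LINT t:{0..x}|lborel. f t) = 0"
  shows "AE x in lborel. x \<in> {0..L} \<longrightarrow> f x = 0"
proof -
  define f1 where "f1 s = indicator {0..L} s *\<^sub>R f s" for s
  have i: "integrable lborel f1" using f by (simp add: set_integrable_def f1_def[abs_def])
  have si: "set_integrable lborel A f1" if "A \<in> sets borel" for A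
    unfolding set_integrable_def using that i by (intro integrable_mult_indicator) auto
  have atMost: "(LINT t:{..a}|lborel. f1 t) = 0" for a
  proof -
    have "(LINT t:{..a}|lborel. f1 t) = (LINT t:{0..min a L}|lborel. f t)"
      unfolding set_lebesgue_integral_def f1_def by (intro Bochner_Integration.integral_cong) (auto simp: indicator_def)
    also have "\<dots> = 0"
    proof (cases "a \<ge> 0")
      case True
      then show ?thesis using zero[of "min a L"] L by auto
    qed (simp add: set_lebesgue_integral_def)
    finally show ?thesis .
  qed
  have all: "(LINT t|lborel. f1 t) = 0"
    using zero[of L] L by (simp add: f1_def[abs_def] set_lebesgue_integral_def)
  have "(LINT t:A|lborel. f1 t) = 0" if "A \<in> sets lborel" for A
  proof -
    have A: "A \<in> sigma_sets UNIV (range (\<lambda>a. {..a::real}))"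
      using that by (simp add: borel_eq_atMost)
    have "Int_stable (range (\<lambda>a. {..a::real}))"
      by (auto simp: Int_stable_def)
    moreover have "range (\<lambda>a. {..a::real}) \<subseteq> Pow UNIV" by simp
    ultimately show ?thesis using A
    proof (induction rule: sigma_sets_induct_disjoint)
      case (basic A) then show ?case using atMost by auto
    next
      case empty then show ?case by (simp add: set_lebesgue_integral_def)
    next
      case (compl A)
      then have A: "A \<in> sets borel" by (simp add: borel_eq_atMost)
      have "(LINT t:UNIV|lborel. f1 t) = (LINT t:A \<union> (UNIV - A)|lborel. f1 t)" by simp
      also have "\<dots> = (LINT t:A|lborel. f1 t) + (LINT t:UNIV - A|lborel. f1 t)"
        using A by (intro set_integral_Un si) auto
      finally show ?case using compl(2) all by (simp add: set_lebesgue_integral_def)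
    next
      case (union A)
      then have A: "\<And>i. A i \<in> sets borel" by (auto simp: borel_eq_atMost)
      have "(LINT t:(\<Union>i. A i)|lborel. f1 t) = (\<Sum>i. LINT t:A i|lborel. f1 t)"
        using union(1) A by (intro lebesgue_integral_countable_add si) (auto simp: disjoint_family_on_def)
      then show ?case using union(3) by simp
    qed
  qed
  from sigma_finite_measure.density_zero[OF sigma_finite_lborel i this] have "AE x in lborel. f1 x = 0" .
  then show ?thesis by eventually_elim (auto simp: f1_def)
qed

lemma set_integrable_Icc_sub:
  "set_integrable lborel {0..L} f \<Longrightarrow> 0 \<le> x \<Longrightarrow> x \<le> L \<Longrightarrow> set_integrable lborel {0..x} f"
  for f :: "real \<Rightarrow> complex" and x L :: real
  by (rule set_integrable_subset) auto

lemma primitive_eq_integral: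
  "set_integrable lborel {0..L} f \<Longrightarrow> x \<in> {0..L} \<Longrightarrow> (LINT t:{0..x}|lborel. f t) = integral {0..x} f"
  for f :: "real \<Rightarrow> complex" and x L :: real
  by (rule set_borel_integral_eq_integral(2)) (rule set_integrable_Icc_sub[of L], auto)

lemma continuous_on_primitive:
  fixes f :: "real \<Rightarrow> complex"
  assumes f: "set_integrable lborel {0..L} f"
  shows "continuous_on {0..L} (\<lambda>x. LINT t:{0..x}|lborel. f t)"
proof -
  have "continuous_on {0..L} (\<lambda>x. integral {0..x} f)"
    by (intro indefinite_integral_continuous_1 set_borel_integral_eq_integral(1) f)
  then show ?thesis
    by (rule continuous_on_cong[THEN iffD1, rotated 2])
       (use primitive_eq_integral[OF f] in auto)
qed

lemma primitive_has_vector_derivative: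
  fixes f :: "real \<Rightarrow> complex"
  assumes f: "continuous_on {0..L} f" and x: "x \<in> {0..L}"
  shows "((\<lambda>x. LINT t:{0..x}|lborel. f t) has_vector_derivative f x) (at x within {0..L})"
proof -
  have i: "set_integrable lborel {0..L} f" using f by (rule borel_integrable_atLeastAtMost')
  show ?thesis
    by (rule has_vector_derivative_transform[OF x _ integral_has_vector_derivative[OF f x]])
       (use primitive_eq_integral[OF i] in auto)
qed

section \<open>Square integrable and weakly differentiable functions\<close>

lemma L2_iff_sqi: "L2 L f \<longleftrightarrow> sqi (\<lambda>x. indicator {0..L} x *\<^sub>R f x)"
proof -
  have "(cmod (indicator {0..L} x *\<^sub>R f x))\<^sup>2 = indicator {0..L} x *\<^sub>R (cmod (f x))\<^sup>2" for x
    by (auto split: split_indicator)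
  then show ?thesis by (simp add: L2_def sqi_def set_borel_measurable_def set_integrable_def)
qed

lemma L2_cong: "(\<And>x. x \<in> {0..L} \<Longrightarrow> f x = g x) \<Longrightarrow> L2 L f \<longleftrightarrow> L2 L g" for f :: "real \<Rightarrow> complex"
proof -
  assume "\<And>x. x \<in> {0..L} \<Longrightarrow> f x = g x"
  then have "(\<lambda>x. indicator {0..L} x *\<^sub>R f x) = (\<lambda>x. indicator {0..L} x *\<^sub>R g x)"
    by (auto split: split_indicator)
  then show ?thesis by (simp add: L2_iff_sqi)
qed

lemma L2_continuous: "continuous_on {0..L} f \<Longrightarrow> L2 L f" for f :: "real \<Rightarrow> complex"
  unfolding L2_def
proof
  assume f: "continuous_on {0..L} f"
  show "set_borel_measurable lborel {0..L} f"
    unfolding set_borel_measurable_def using borel_integrable_compact[OF compact_Icc f] by auto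
  show "set_integrable lborel {0..L} (\<lambda>x. (cmod (f x))\<^sup>2)"
    by (intro borel_integrable_atLeastAtMost' continuous_intros f)
qed

lemma L2_add: "L2 L f \<Longrightarrow> L2 L g \<Longrightarrow> L2 L (\<lambda>x. f x + g x)" for f :: "real \<Rightarrow> complex"
  unfolding L2_iff_sqi scaleR_add_right by (rule sqi_add)

lemma L2_cmult: "L2 L f \<Longrightarrow> L2 L (\<lambda>x. c * f x)" for f :: "real \<Rightarrow> complex"
  using sqi_scale[of "\<lambda>x. indicator {0..L} x *\<^sub>R f x" c] by (simp add: L2_iff_sqi)

lemma L2_diff: "L2 L f \<Longrightarrow> L2 L g \<Longrightarrow> L2 L (\<lambda>x. f x - g x)" for f :: "real \<Rightarrow> complex"
  unfolding L2_iff_sqi scaleR_diff_right by (rule sqi_diff)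

lemma L2_mult_continuous:
  fixes f m :: "real \<Rightarrow> complex"
  assumes f: "L2 L f" and m: "continuous_on {0..L} m"
  shows "L2 L (\<lambda>x. m x * f x)"
proof -
  have "bounded (m ` {0..L})" using m by (intro compact_imp_bounded compact_continuous_image compact_Icc)
  then obtain K where K: "\<forall>x\<in>{0..L}. cmod (m x) \<le> K" "K > 0" unfolding bounded_pos by auto
  have "sqi (\<lambda>x. (indicator {0..L} x *\<^sub>R m x) * (indicator {0..L} x *\<^sub>R f x))"
  proof (rule sqi_mult_bounded)
    show "(\<lambda>x. indicator {0..L} x *\<^sub>R m x) \<in> borel_measurable lborel"
      using borel_integrable_compact[OF compact_Icc m] by auto
    show "cmod (indicator {0..L} x *\<^sub>R m x) \<le> K" for x using K by (cases "x \<in> {0..L}") auto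
  qed (use f in \<open>simp add: L2_iff_sqi\<close>)
  moreover have "(\<lambda>x. (indicator {0..L} x *\<^sub>R m x) * (indicator {0..L} x *\<^sub>R f x)) = (\<lambda>x. indicator {0..L} x *\<^sub>R (m x * f x))"
    by (auto split: split_indicator)
  ultimately show ?thesis by (simp add: L2_iff_sqi)
qed

lemma L2_prod_integrable:
  assumes f: "L2 L f" and g: "L2 L g"
  shows "set_integrable lborel {0..L} (\<lambda>x. f x * cnj (g x))"
proof -
  have "(\<lambda>x. (indicator {0..L} x *\<^sub>R f x) * cnj (indicator {0..L} x *\<^sub>R g x)) = (\<lambda>x. indicator {0..L} x *\<^sub>R (f x * cnj (g x)))"
    by (auto split: split_indicator)
  then show ?thesis
    using sqi_prod_integrable[OF f[unfolded L2_iff_sqi] g[unfolded L2_iff_sqi]] by (simp add: set_integrable_def)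
qed

lemma L2_integrable: "L2 L f \<Longrightarrow> set_integrable lborel {0..L} f" for f :: "real \<Rightarrow> complex"
  using L2_prod_integrable[of L f "\<lambda>_. 1"] L2_continuous[of L "\<lambda>_. 1"] by simp

lemma L2_integrable_Icc: "L2 L f \<Longrightarrow> x \<in> {0..L} \<Longrightarrow> set_integrable lborel {0..x} f" for f :: "real \<Rightarrow> complex"
  by (rule set_integrable_Icc_sub[OF L2_integrable]) auto

lemma set_integral_singleton [simp]: "(LINT t:{a}|lborel. f t) = 0" for f :: "real \<Rightarrow> complex"
proof -
  have "AE t in lborel. indicator {a} t *\<^sub>R f t = 0"
    using AE_lborel_singleton[of a] by eventually_elim auto
  then show ?thesis unfolding set_lebesgue_integral_def by (rule integral_eq_zero_AE)
qed

text \<open>A function together with one of its weak derivatives. As these are unique only almost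
  everywhere, carrying the pair is more flexible than the fixed choice \<open>wd\<close>.\<close>

definition h1 :: "real \<Rightarrow> (real \<Rightarrow> complex) \<Rightarrow> (real \<Rightarrow> complex) \<Rightarrow> bool" where
  "h1 L f g \<longleftrightarrow> L2 L g \<and> (\<forall>x\<in>{0..L}. f x = f 0 + (LINT t:{0..x}|lborel. g t))"

lemma h1_eq: "h1 L f g \<Longrightarrow> x \<in> {0..L} \<Longrightarrow> f x = f 0 + (LINT t:{0..x}|lborel. g t)"
  unfolding h1_def by blast

lemma h1_L2: "h1 L f g \<Longrightarrow> L2 L g"
  unfolding h1_def by blast

lemma h1_cong:
  assumes "h1 L f g" "\<And>x. x \<in> {0..L} \<Longrightarrow> f x = f' x" "\<And>x. x \<in> {0..L} \<Longrightarrow> g x = g' x"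
  shows "h1 L f' g'"
  unfolding h1_def
proof (intro conjI ballI)
  show "L2 L g'" using h1_L2[OF assms(1)] L2_cong[of L g g'] assms(3) by blast
  fix x assume x: "x \<in> {0..L}"
  have "(LINT t:{0..x}|lborel. g t) = (LINT t:{0..x}|lborel. g' t)"
    using x assms(3) by (intro set_lebesgue_integral_cong) auto
  moreover have "f x = f' x" "f 0 = f' 0" using assms(2) x by auto
  ultimately show "f' x = f' 0 + (LINT t:{0..x}|lborel. g' t)"
    using h1_eq[OF assms(1) x] by metis
qed

lemma h1_primitive: "L2 L g \<Longrightarrow> h1 L (\<lambda>x. c + (LINT t:{0..x}|lborel. g t)) g"
  unfolding h1_def by simp

lemma h1_continuous: assumes "h1 L f g" shows "continuous_on {0..L} f"
proof -
  have "continuous_on {0..L} (\<lambda>x. f 0 + (LINT t:{0..x}|lborel. g t))"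
    by (intro continuous_intros continuous_on_primitive L2_integrable h1_L2[OF assms])
  then show ?thesis by (rule continuous_on_cong[THEN iffD2, rotated 2]) (rule refl, rule h1_eq[OF assms])
qed

lemma h1_add: assumes "h1 L f f'" "h1 L g g'" shows "h1 L (\<lambda>x. f x + g x) (\<lambda>x. f' x + g' x)"
  unfolding h1_def
proof (intro conjI ballI)
  show "L2 L (\<lambda>x. f' x + g' x)" using assms by (auto intro: L2_add h1_L2)
  fix x assume x: "x \<in> {0..L}"
  show "f x + g x = f 0 + g 0 + (LINT t:{0..x}|lborel. f' t + g' t)"
    using set_integral_add(2)[OF L2_integrable_Icc[OF h1_L2[OF assms(1)] x] L2_integrable_Icc[OF h1_L2[OF assms(2)] x]]
      h1_eq[OF assms(1) x] h1_eq[OF assms(2) x] by simp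
qed

lemma h1_cmult: assumes "h1 L f f'" shows "h1 L (\<lambda>x. c * f x) (\<lambda>x. c * f' x)"
  unfolding h1_def
proof (intro conjI ballI)
  show "L2 L (\<lambda>x. c * f' x)" using assms by (auto intro: L2_cmult h1_L2)
  fix x assume x: "x \<in> {0..L}"
  show "c * f x = c * f 0 + (LINT t:{0..x}|lborel. c * f' t)"
    using h1_eq[OF assms(1) x] by (simp add: algebra_simps)
qed

lemma h1_uminus: "h1 L f f' \<Longrightarrow> h1 L (\<lambda>x. - f x) (\<lambda>x. - f' x)"
  using h1_cmult[of L f f' "-1"] by simp

lemma h1_diff: "h1 L f f' \<Longrightarrow> h1 L g g' \<Longrightarrow> h1 L (\<lambda>x. f x - g x) (\<lambda>x. f' x - g' x)"
  using h1_add[of L f f' "\<lambda>x. - g x" "\<lambda>x. - g' x"] h1_uminus by simp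

lemma h1_const: "h1 L (\<lambda>_. c) (\<lambda>_. 0)"
  unfolding h1_def using L2_continuous[of L "\<lambda>_. 0"] by (simp add: set_lebesgue_integral_def)

lemma sqi_cnj: "sqi f \<Longrightarrow> sqi (\<lambda>x. cnj (f x))"
  unfolding sqi_def using measurable_compose[OF _ borel_measurable_cnj, of f lborel] by simp

lemma L2_cnj: "L2 L f \<Longrightarrow> L2 L (\<lambda>x. cnj (f x))" for f :: "real \<Rightarrow> complex"
  using sqi_cnj[of "\<lambda>x. indicator {0..L} x *\<^sub>R f x"] by (simp add: L2_iff_sqi)

lemma h1_cnj: assumes "h1 L f f'" shows "h1 L (\<lambda>x. cnj (f x)) (\<lambda>x. cnj (f' x))"
  unfolding h1_def
proof (intro conjI ballI)
  show "L2 L (\<lambda>x. cnj (f' x))" using assms by (auto intro: L2_cnj h1_L2)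
  fix x assume x: "x \<in> {0..L}"
  have "(LINT t:{0..x}|lborel. cnj (f' t)) = cnj (LINT t:{0..x}|lborel. f' t)"
    using integral_bounded_linear[OF bounded_linear_cnj L2_integrable_Icc[OF h1_L2[OF assms(1)] x, unfolded set_integrable_def]]
    by (simp add: set_lebesgue_integral_def)
  then show "cnj (f x) = cnj (f 0) + (LINT t:{0..x}|lborel. cnj (f' t))"
    using h1_eq[OF assms(1) x] by simp
qed

text \<open>Each factor is split into its value at 0 and a primitive. The product of the primitives
  is handled by \<open>integral_by_parts_AC\<close>, and the other terms are linear.\<close>

lemma h1_mult: assumes f: "h1 L f f'" and g: "h1 L g g'"
  shows "h1 L (\<lambda>x. f x * g x) (\<lambda>x. f' x * g x + f x * g' x)"
  unfolding h1_def
proof (intro conjI ballI)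
  show "L2 L (\<lambda>x. f' x * g x + f x * g' x)"
    using L2_mult_continuous[OF h1_L2[OF f] h1_continuous[OF g]] L2_mult_continuous[OF h1_L2[OF g] h1_continuous[OF f]]
    by (intro L2_add) (simp_all add: mult.commute)
  fix x assume x: "x \<in> {0..L}"
  have i: "set_integrable lborel {0..x} f'" "set_integrable lborel {0..x} g'"
    using L2_integrable_Icc[OF h1_L2[OF f] x] L2_integrable_Icc[OF h1_L2[OF g] x] by auto
  let ?F = "\<lambda>x. LINT t:{0..x}|lborel. f' t" and ?G = "\<lambda>x. LINT t:{0..x}|lborel. g' t"
  have i0: "set_integrable lborel {0..x} (\<lambda>t. g 0 * f' t)" "set_integrable lborel {0..x} (\<lambda>t. f 0 * g' t)"
    using i by (auto intro: set_integrable_mult_right)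
  have "(LINT t:{0..x}|lborel. f' t * g t + f t * g' t)
    = (LINT t:{0..x}|lborel. (g 0 * f' t + f 0 * g' t) + (f' t * ?G t + ?F t * g' t))"
  proof (rule set_lebesgue_integral_cong)
    show "\<forall>t. t \<in> {0..x} \<longrightarrow> f' t * g t + f t * g' t = (g 0 * f' t + f 0 * g' t) + (f' t * ?G t + ?F t * g' t)"
    proof (intro allI impI)
      fix t assume "t \<in> {0..x}"
      then have t: "t \<in> {0..L}" using x by auto
      show "f' t * g t + f t * g' t = (g 0 * f' t + f 0 * g' t) + (f' t * ?G t + ?F t * g' t)"
        by (subst h1_eq[OF f t], subst h1_eq[OF g t]) (simp add: algebra_simps)
    qed
  qed simp
  also have "\<dots> = g 0 * ?F x + f 0 * ?G x + ?F x * ?G x"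
    by (subst set_integral_add(2)[OF set_integral_add(1)[OF i0] integral_by_parts_AC(2)[OF i]],
        subst set_integral_add(2)[OF i0], subst integral_by_parts_AC(1)[OF i]) simp
  finally show "f x * g x = f 0 * g 0 + (LINT t:{0..x}|lborel. f' t * g t + f t * g' t)"
    using h1_eq[OF f x] h1_eq[OF g x] by (simp add: algebra_simps)
qed

lemma h1_unique:
  assumes L: "L \<ge> 0" and f: "h1 L f g" "h1 L f g'"
  shows "AE x in lborel. x \<in> {0..L} \<longrightarrow> g x = g' x"
proof -
  have d: "h1 L (\<lambda>x. f x - f x) (\<lambda>x. g x - g' x)" by (rule h1_diff[OF f])
  have "AE x in lborel. x \<in> {0..L} \<longrightarrow> g x - g' x = 0"
    by (rule AE_zero_if_integrals_zero[OF L2_integrable[OF h1_L2[OF d]] L]) (use h1_eq[OF d] in auto)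
  then show ?thesis by simp
qed

lemma h1_of_derivative:
  assumes "\<And>x. x \<in> {0..L} \<Longrightarrow> (f has_vector_derivative g x) (at x within {0..L})" "continuous_on {0..L} g"
  shows "h1 L f g"
  unfolding h1_def
proof (intro conjI ballI)
  show L2: "L2 L g" by (rule L2_continuous) fact
  fix x assume x: "x \<in> {0..L}"
  have "(g has_integral (f x - f 0)) {0..x}"
    using x by (intro fundamental_theorem_of_calculus)
      (auto intro: has_vector_derivative_within_subset[OF assms(1)])
  then show "f x = f 0 + (LINT t:{0..x}|lborel. g t)"
    using set_borel_integral_eq_integral(2)[OF L2_integrable_Icc[OF L2 x]] by (simp add: integral_unique)
qed

lemma h1_has_derivative:
  assumes "h1 L f g" "continuous_on {0..L} g" "x \<in> {0..L}"
  shows "(f has_vector_derivative g x) (at x within {0..L})"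
proof (rule has_vector_derivative_transform[OF assms(3)])
  show "((\<lambda>x. f 0 + (LINT t:{0..x}|lborel. g t)) has_vector_derivative g x) (at x within {0..L})"
    using has_vector_derivative_add[OF has_vector_derivative_const primitive_has_vector_derivative[OF assms(2,3)]] by simp
qed (rule h1_eq[OF assms(1)])

text \<open>Links the classical derivative \<open>dd\<close>, end points included, to a weak
  derivative with a continuous representative.\<close>

lemma h1_dd:
  assumes "L > 0" "h1 L f g" "continuous_on {0..L} g" "x \<in> {0..L}"
  shows "dd L f x = g x"
  unfolding dd_def using assms by (intro vector_derivative_within_closed_interval h1_has_derivative)

section \<open>The Sobolev scale\<close>

lemma sob_1_iff: "sob (Suc 0) L f \<longleftrightarrow> (\<exists>g. h1 L f g)" for f :: "real \<Rightarrow> complex"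
  by (simp add: h1_def)

declare sob.simps(2) [simp del]

lemma sob_continuous: "sob (Suc k) L f \<Longrightarrow> continuous_on {0..L} f"
  and sob_L2: "sob k L f \<Longrightarrow> L2 L f" for f :: "real \<Rightarrow> complex"
proof (induction k arbitrary: f)
  case 0
  { case 1 then show ?case by (auto simp: sob_1_iff intro: h1_continuous) }
  { case 2 then show ?case by simp }
next
  case (Suc k)
  { case 1
    then obtain g where "sob (Suc k) L g" "\<forall>x\<in>{0..L}. f x = f 0 + (LINT t:{0..x}|lborel. g t)"
      by (subst (asm) sob.simps) auto
    then have "h1 L f g" using L2_continuous[OF Suc(1)[of g]] unfolding h1_def by blast
    then show ?case by (rule h1_continuous) }
  { case 2 then show ?case by (intro L2_continuous Suc(1)) }
qed

lemma sob_Suc_iff: "sob (Suc k) L f \<longleftrightarrow> (\<exists>g. sob k L g \<and> h1 L f g)" for f :: "real \<Rightarrow> complex"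
  by (subst sob.simps) (auto simp: h1_def intro: sob_L2)

lemma sob_Suc_imp: "sob (Suc k) L f \<Longrightarrow> sob k L f" for f :: "real \<Rightarrow> complex"
proof (induction k arbitrary: f)
  case 0 then show ?case using sob_continuous L2_continuous by fastforce
next
  case (Suc k) then show ?case using sob_Suc_iff by blast
qed

lemma sob_cong: "sob k L f \<Longrightarrow> (\<And>x. x \<in> {0..L} \<Longrightarrow> f x = g x) \<Longrightarrow> sob k L g" for f g :: "real \<Rightarrow> complex"
proof (cases k)
  case 0
  assume "sob k L f" "\<And>x. x \<in> {0..L} \<Longrightarrow> f x = g x"
  with 0 show ?thesis using L2_cong[of L f g] by simp
next
  case (Suc j)
  assume "sob k L f" and e: "\<And>x. x \<in> {0..L} \<Longrightarrow> f x = g x"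
  then obtain f' where f': "sob j L f'" "h1 L f f'" using Suc sob_Suc_iff by blast
  have "h1 L g f'" by (rule h1_cong[OF f'(2) e refl])
  then show ?thesis using Suc f'(1) sob_Suc_iff by blast
qed

lemma sob_add: "sob k L f \<Longrightarrow> sob k L g \<Longrightarrow> sob k L (\<lambda>x. f x + g x)" for f g :: "real \<Rightarrow> complex"
proof (induction k arbitrary: f g)
  case (Suc k)
  then show ?case unfolding sob_Suc_iff by (blast intro: h1_add)
qed (simp add: L2_add)

lemma sob_cmult: "sob k L f \<Longrightarrow> sob k L (\<lambda>x. c * f x)" for f :: "real \<Rightarrow> complex"
proof (induction k arbitrary: f)
  case (Suc k)
  then show ?case unfolding sob_Suc_iff by (blast intro: h1_cmult)
qed (simp add: L2_cmult)

lemma sob_mult: "sob (Suc k) L f \<Longrightarrow> sob (Suc k) L g \<Longrightarrow> sob (Suc k) L (\<lambda>x. f x * g x)" for f g :: "real \<Rightarrow> complex"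
proof (induction k arbitrary: f g)
  case 0 then show ?case unfolding sob_1_iff using h1_mult by blast
next
  case (Suc k)
  obtain f' g' where f': "sob (Suc k) L f'" "h1 L f f'" and g': "sob (Suc k) L g'" "h1 L g g'"
    using Suc.prems sob_Suc_iff[of "Suc k"] by blast
  have "sob (Suc k) L (\<lambda>x. f' x * g x + f x * g' x)"
    by (intro sob_add Suc.IH f' g' sob_Suc_imp[of "Suc k"] Suc.prems)
  then show ?case using h1_mult[OF f'(2) g'(2)] sob_Suc_iff[of "Suc k"] by blast
qed

lemma sob_dd:
  fixes f :: "real \<Rightarrow> complex"
  assumes L: "L > 0" and f: "sob (Suc (Suc k)) L f"
  shows "sob (Suc k) L (dd L f)" "h1 L f (dd L f)"
proof -
  obtain g where g: "sob (Suc k) L g" "h1 L f g" using f sob_Suc_iff by blast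
  have "g x = dd L f x" if "x \<in> {0..L}" for x
    using h1_dd[OF L g(2) sob_continuous[OF g(1)] that] by simp
  then show "sob (Suc k) L (dd L f)" "h1 L f (dd L f)"
    using sob_cong[OF g(1)] h1_cong[OF g(2)] by blast+
qed

lemma sob_SucI: "sob k L g \<Longrightarrow> h1 L f g \<Longrightarrow> sob (Suc k) L f"
  using sob_Suc_iff by blast

lemma wd_h1: assumes "sob (Suc 0) L f" shows "h1 L f (wd L f)"
proof -
  have "wd L f = (SOME g. h1 L f g)" by (simp add: wd_def h1_def)
  then show ?thesis using assms someI_ex[of "h1 L f"] by (simp add: sob_1_iff)
qed

lemma sob_of_real: "sob k L P \<Longrightarrow> sob k L (\<lambda>x. complex_of_real (P x))"
proof (induction k arbitrary: P)
  case 0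
  have e: "(\<lambda>x. indicator {0..L} x *\<^sub>R complex_of_real (P x)) = (\<lambda>x. complex_of_real (indicator {0..L} x *\<^sub>R P x))"
    by (auto split: split_indicator)
  have "(\<lambda>x. indicator {0..L} x *\<^sub>R P x) \<in> borel_measurable lborel"
    using 0 by (simp add: L2_def set_borel_measurable_def)
  then have "(\<lambda>x. indicator {0..L} x *\<^sub>R complex_of_real (P x)) \<in> borel_measurable lborel"
    unfolding e by (rule measurable_compose) (intro borel_measurable_continuous_onI continuous_intros)
  then show ?case using 0 by (simp add: L2_def set_borel_measurable_def)
next
  case (Suc k)
  then obtain g where g: "sob k L g" "\<forall>x\<in>{0..L}. P x = P 0 + (LINT t:{0..x}|lborel. g t)"
    by (subst (asm) sob.simps) auto
  have "h1 L (\<lambda>x. complex_of_real (P x)) (\<lambda>x. complex_of_real (g x))"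
    unfolding h1_def
  proof (intro conjI ballI sob_L2[OF Suc.IH[OF g(1)]])
    fix x assume "x \<in> {0..L}"
    then show "complex_of_real (P x) = complex_of_real (P 0) + (LINT t:{0..x}|lborel. complex_of_real (g t))"
      unfolding set_integral_complex_of_real using g(2) by (metis of_real_add)
  qed
  then show ?case using Suc.IH[OF g(1)] sob_SucI by blast
qed

text \<open>Serves for \<open>1 / P\<close>. An \<open>H^2\<close> function is \<open>C^1\<close>,
  so the classical rule gives the derivative, and the product rule in \<open>H^1\<close> gains the
  second order.\<close>

lemma sob_inverse:
  fixes f :: "real \<Rightarrow> complex"
  assumes L: "L > 0" and f: "sob (Suc (Suc 0)) L f" and nz: "\<And>x. x \<in> {0..L} \<Longrightarrow> f x \<noteq> 0"
  shows "sob (Suc (Suc 0)) L (\<lambda>x. inverse (f x))"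
    "h1 L (\<lambda>x. inverse (f x)) (\<lambda>x. - (dd L f x * (inverse (f x) * inverse (f x))))"
proof -
  note d = sob_dd[OF L f]
  have cd: "continuous_on {0..L} (dd L f)" and cf: "continuous_on {0..L} f"
    using sob_continuous[OF d(1)] sob_continuous[OF f] by auto
  let ?g = "\<lambda>x. - (dd L f x * (inverse (f x) * inverse (f x)))"
  show h: "h1 L (\<lambda>x. inverse (f x)) ?g"
  proof (rule h1_of_derivative)
    show "continuous_on {0..L} ?g" by (intro continuous_intros cd cf) (use nz in auto)
    fix x assume x: "x \<in> {0..L}"
    have "(f has_derivative (\<lambda>h. h *\<^sub>R dd L f x)) (at x within {0..L})"
      using h1_has_derivative[OF d(2) cd x] by (simp add: has_vector_derivative_def)
    from Deriv.has_derivative_inverse[OF nz[OF x] this]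
    show "((\<lambda>x. inverse (f x)) has_vector_derivative ?g x) (at x within {0..L})"
      unfolding has_vector_derivative_def by (simp add: mult_ac)
  qed
  then have "sob (Suc 0) L (\<lambda>x. inverse (f x))" unfolding sob_1_iff by blast
  then have "sob (Suc 0) L (\<lambda>x. (-1) * (dd L f x * (inverse (f x) * inverse (f x))))"
    by (intro sob_cmult sob_mult d)
  then show "sob (Suc (Suc 0)) L (\<lambda>x. inverse (f x))"
    using sob_SucI[OF _ h] by simp
qed

section \<open>Square integrable functions on an interval\<close>

definition cls :: "real \<Rightarrow> (real \<Rightarrow> complex) \<Rightarrow> l2" where
  "cls L f = abs_l2 (\<lambda>x. indicator {0..L} x *\<^sub>R f x)"

lemma cls_add: "L2 L f \<Longrightarrow> L2 L g \<Longrightarrow> cls L (\<lambda>x. f x + g x) = cls L f + cls L g"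
  unfolding L2_iff_sqi cls_def scaleR_add_right by (rule abs_l2_add)

lemma cls_scaleR: "L2 L f \<Longrightarrow> cls L (\<lambda>x. r *\<^sub>R f x) = r *\<^sub>R cls L f"
  unfolding L2_iff_sqi cls_def scaleR_left_commute[of _ r] by (rule abs_l2_scaleR)

lemma cls_eq_iff:
  assumes "L2 L f" "L2 L g"
  shows "cls L f = cls L g \<longleftrightarrow> (AE x in lborel. x \<in> {0..L} \<longrightarrow> f x = g x)"
proof -
  have "indicator {0..L} x *\<^sub>R f x = indicator {0..L} x *\<^sub>R g x \<longleftrightarrow> (x \<in> {0..L} \<longrightarrow> f x = g x)" for x
    by (auto split: split_indicator)
  then show ?thesis unfolding cls_def using assms by (simp only: L2_iff_sqi abs_l2_eq_iff)
qed

lemma cls_cong: "(\<And>x. x \<in> {0..L} \<Longrightarrow> f x = g x) \<Longrightarrow> cls L f = cls L g"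
proof -
  assume "\<And>x. x \<in> {0..L} \<Longrightarrow> f x = g x"
  then have "(\<lambda>x. indicator {0..L} x *\<^sub>R f x) = (\<lambda>x. indicator {0..L} x *\<^sub>R g x)"
    by (auto split: split_indicator)
  then show ?thesis by (simp add: cls_def)
qed

lemma inner_cls:
  assumes f: "L2 L f" and g: "L2 L g"
  shows "inner (cls L f) (cls L g) = Re (LINT x:{0..L}|lborel. f x * cnj (g x))"
proof -
  have "inner (cls L f) (cls L g) = (LINT x|lborel. Re (indicator {0..L} x *\<^sub>R (f x * cnj (g x))))"
    unfolding cls_def using assms
    by (subst inner_abs_l2) (auto simp: L2_iff_sqi intro!: Bochner_Integration.integral_cong split: split_indicator)
  also have "\<dots> = Re (LINT x:{0..L}|lborel. f x * cnj (g x))"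
    unfolding set_lebesgue_integral_def
    by (rule integral_Re[OF L2_prod_integrable[OF f g, unfolded set_integrable_def]])
  finally show ?thesis .
qed

lemma norm_cls_sq:
  assumes f: "L2 L f" shows "(norm (cls L f))\<^sup>2 = (LINT x:{0..L}|lborel. (cmod (f x))\<^sup>2)"
  unfolding cls_def using f
  by (subst norm_abs_l2_sq)
     (auto simp: L2_iff_sqi set_lebesgue_integral_def power_mult_distrib intro!: Bochner_Integration.integral_cong split: split_indicator)

lemma norm_cls_le:
  assumes f: "L2 L f" and K: "K \<ge> 0" "\<And>x. x \<in> {0..L} \<Longrightarrow> cmod (f x) \<le> K" and L: "L \<ge> 0"
  shows "norm (cls L f) \<le> sqrt L * K"
proof (rule power2_le_imp_le)
  have "(LINT x:{0..L}|lborel. (cmod (f x))\<^sup>2) \<le> (LINT x:{0..L}|lborel. K\<^sup>2)"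
    using f K by (intro set_integral_mono) (auto simp: L2_def intro: borel_integrable_atLeastAtMost' continuous_intros)
  also have "\<dots> = L * K\<^sup>2" using L by (simp add: set_lebesgue_integral_def)
  finally show "(norm (cls L f))\<^sup>2 \<le> (sqrt L * K)\<^sup>2"
    using L by (simp add: norm_cls_sq[OF f] power_mult_distrib)
qed (use K L in auto)

lemma L2_rep [simp]: "L2 L (rep_l2 y)"
  unfolding L2_iff_sqi scaleR_conv_of_real
  by (rule sqi_mult_bounded[of _ _ 1]) (auto split: split_indicator)

lemma rep_cls: assumes "L2 L f" shows "AE x in lborel. x \<in> {0..L} \<longrightarrow> rep_l2 (cls L f) x = f x"
  using rep_abs_l2[OF assms[unfolded L2_iff_sqi]] unfolding cls_def[symmetric] by eventually_elim auto

lemma cls_rep_cls [simp]: "L2 L f \<Longrightarrow> cls L (rep_l2 (cls L f)) = cls L f"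
  using rep_cls by (simp add: cls_eq_iff)

lemma rep_add: "AE x in lborel. rep_l2 (y + z) x = rep_l2 y x + rep_l2 z x"
proof -
  have "y + z = abs_l2 (\<lambda>x. rep_l2 y x + rep_l2 z x)" by (simp add: abs_l2_add)
  then show ?thesis using rep_abs_l2[of "\<lambda>x. rep_l2 y x + rep_l2 z x"] by (simp add: sqi_add)
qed

lemma rep_scaleR: "AE x in lborel. rep_l2 (r *\<^sub>R y) x = r *\<^sub>R rep_l2 y x"
proof -
  have "r *\<^sub>R y = abs_l2 (\<lambda>x. r *\<^sub>R rep_l2 y x)" by (simp add: abs_l2_scaleR)
  then show ?thesis using rep_abs_l2[of "\<lambda>x. r *\<^sub>R rep_l2 y x"] by (simp add: sqi_scaleR)
qed

lemma norm_cls_rep_le: "norm (cls L (rep_l2 y)) \<le> norm y"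
proof (rule power2_le_imp_le)
  have "(norm (cls L (rep_l2 y)))\<^sup>2 = (LINT x|lborel. indicator {0..L} x *\<^sub>R (cmod (rep_l2 y x))\<^sup>2)"
    by (simp add: norm_cls_sq set_lebesgue_integral_def)
  also have "\<dots> \<le> (LINT x|lborel. (cmod (rep_l2 y x))\<^sup>2)"
    using sqi_integrable[OF sqi_rep[of y]]
    by (intro integral_mono integrable_mult_indicator) (auto split: split_indicator)
  also have "\<dots> = (norm y)\<^sup>2" using norm_abs_l2_sq[OF sqi_rep[of y]] by simp
  finally show "(norm (cls L (rep_l2 y)))\<^sup>2 \<le> (norm y)\<^sup>2" .
qed simp

lemma bounded_linear_mult_cls:
  assumes m: "continuous_on {0..L} m"
  shows "bounded_linear (\<lambda>y. cls L (\<lambda>x. m x * rep_l2 y x))"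
proof -
  have L2: "L2 L (\<lambda>x. m x * rep_l2 y x)" for y by (rule L2_mult_continuous[OF L2_rep m])
  have "bounded (m ` {0..L})" using m by (intro compact_imp_bounded compact_continuous_image compact_Icc)
  then obtain K where K: "\<forall>x\<in>{0..L}. cmod (m x) \<le> K" "K > 0" unfolding bounded_pos by auto
  show ?thesis
  proof (rule bounded_linear_intro)
    fix y z
    show "cls L (\<lambda>x. m x * rep_l2 (y + z) x) = cls L (\<lambda>x. m x * rep_l2 y x) + cls L (\<lambda>x. m x * rep_l2 z x)"
      unfolding cls_add[OF L2 L2, symmetric] cls_eq_iff[OF L2 L2_add[OF L2 L2]]
      using rep_add[of y z] by eventually_elim (simp add: algebra_simps)
  next
    fix r y
    have "L2 L (\<lambda>x. r *\<^sub>R (m x * rep_l2 y x))"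
      unfolding scaleR_conv_of_real by (rule L2_cmult[OF L2])
    then show "cls L (\<lambda>x. m x * rep_l2 (r *\<^sub>R y) x) = r *\<^sub>R cls L (\<lambda>x. m x * rep_l2 y x)"
      unfolding cls_scaleR[OF L2, symmetric] cls_eq_iff[OF L2 \<open>L2 L (\<lambda>x. r *\<^sub>R (m x * rep_l2 y x))\<close>]
      using rep_scaleR[of r y] by eventually_elim simp
  next
    fix y
    have "(norm (cls L (\<lambda>x. m x * rep_l2 y x)))\<^sup>2 \<le> (LINT x:{0..L}|lborel. K\<^sup>2 * (cmod (rep_l2 y x))\<^sup>2)"
      unfolding norm_cls_sq[OF L2] using L2 L2_rep[of L y] K
      by (intro set_integral_mono)
         (auto simp: L2_def norm_mult power_mult_distrib intro!: mult_right_mono power_mono set_integrable_mult_right)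
    also have "\<dots> = (K * norm (cls L (rep_l2 y)))\<^sup>2" by (simp add: norm_cls_sq power_mult_distrib)
    also have "\<dots> \<le> (K * norm y)\<^sup>2" using norm_cls_rep_le K by (intro power_mono mult_left_mono) auto
    finally have "norm (cls L (\<lambda>x. m x * rep_l2 y x)) \<le> K * norm y"
      by (rule power2_le_imp_le) (use K in auto)
    then show "norm (cls L (\<lambda>x. m x * rep_l2 y x)) \<le> norm y * K" by (simp add: mult.commute)
  qed
qed

lemma bounded_linear_cls_rep: "bounded_linear (\<lambda>y. cls L (rep_l2 y))"
  using bounded_linear_mult_cls[of L "\<lambda>_. 1"] by simp

lemma integral_cong_cls:
  assumes f: "L2 L f" "L2 L g" and e: "cls L f = cls L g" and x: "x \<in> {0..L}"
  shows "(LINT t:{0..x}|lborel. f t) = (LINT t:{0..x}|lborel. g t)"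
  unfolding set_lebesgue_integral_def
proof (rule integral_cong_AE)
  have "AE t in lborel. t \<in> {0..L} \<longrightarrow> f t = g t" using e f by (simp add: cls_eq_iff)
  then show "AE t in lborel. indicator {0..x} t *\<^sub>R f t = indicator {0..x} t *\<^sub>R g t"
    by eventually_elim (use x in \<open>auto split: split_indicator\<close>)
qed (use L2_integrable_Icc[OF f(1) x] L2_integrable_Icc[OF f(2) x] in \<open>auto simp: set_integrable_def\<close>)

lemma integral_le_norm_cls:
  assumes f: "L2 L f" and x: "x \<in> {0..L}"
  shows "cmod (LINT t:{0..x}|lborel. f t) \<le> sqrt L * norm (cls L f)"
proof -
  define I where "I = (LINT t:{0..x}|lborel. f t)"
  \<comment> \<open>The phase of \<open>I\<close>, and 0 if \<open>I = 0\<close>: testing against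
    this constant makes the real inner product return the modulus.\<close>
  define u where "u = sgn I"
  have u: "cmod u \<le> 1" by (simp add: u_def norm_sgn)
  have Lu: "L2 x (\<lambda>_. u)" by (intro L2_continuous continuous_intros)
  have "I * cnj u = I * cnj I / of_real (cmod I)" by (simp add: u_def sgn_eq)
  also have "\<dots> = of_real (cmod I)" by (simp add: complex_norm_square[symmetric] power2_eq_square)
  finally have Iu: "I * cnj u = of_real (cmod I)" .
  have "inner (cls L f) (cls x (\<lambda>_. u)) = (LINT t|lborel. Re (indicator {0..x} t *\<^sub>R (f t * cnj u)))"
    unfolding cls_def using f Lu x
    by (subst inner_abs_l2) (auto simp: L2_iff_sqi intro!: Bochner_Integration.integral_cong split: split_indicator)
  also have "\<dots> = Re (LINT t:{0..x}|lborel. f t * cnj u)"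
    unfolding set_lebesgue_integral_def
    by (rule integral_Re) (use set_integrable_mult_left[OF L2_integrable_Icc[OF f x], of "cnj u"] in \<open>simp add: set_integrable_def\<close>)
  also have "\<dots> = Re (I * cnj u)" by (simp add: I_def)
  also have "\<dots> = cmod I" by (simp add: Iu)
  finally have "cmod I \<le> norm (cls L f) * norm (cls x (\<lambda>_. u))" using norm_cauchy_schwarz by metis
  also have "\<dots> \<le> norm (cls L f) * (sqrt x * 1)"
    using x u by (intro mult_left_mono norm_cls_le Lu) auto
  also have "\<dots> \<le> norm (cls L f) * sqrt L" using x by (intro mult_left_mono) auto
  finally show ?thesis by (simp add: I_def mult.commute)
qed

section \<open>Primitives and bounded families of functions\<close>

definition prim :: "l2 \<Rightarrow> real \<Rightarrow> complex" where
  "prim y t = (LINT u:{0..t}|lborel. rep_l2 y u)"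

lemma prim_le: "t \<in> {0..L} \<Longrightarrow> cmod (prim y t) \<le> sqrt L * norm y"
  unfolding prim_def using integral_le_norm_cls[OF L2_rep, of t L y] norm_cls_rep_le[of L y]
  by (meson mult_left_mono order_trans real_sqrt_ge_zero atLeastAtMost_iff)

lemma prim_0 [simp]: "prim y 0 = 0"
  by (simp add: prim_def)

lemma h1_prim: "h1 L (\<lambda>t. c + prim y t) (rep_l2 y)"
  unfolding prim_def by (rule h1_primitive) simp

lemma prim_cls: "L2 L f \<Longrightarrow> t \<in> {0..L} \<Longrightarrow> prim (cls L f) t = (LINT u:{0..t}|lborel. f u)"
  unfolding prim_def by (rule integral_cong_cls[of L]) auto

text \<open>Continuous functions depending linearly on a parameter, with one bound for all points of
  \<open>[0,L]\<close>. The class is closed under sums, continuous factors and integration, which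
  yields boundedness of the integral operators below by composition.\<close>

definition lin_fam :: "real \<Rightarrow> ('a::real_normed_vector \<Rightarrow> real \<Rightarrow> complex) \<Rightarrow> bool" where
  "lin_fam L F \<longleftrightarrow> (\<forall>v. continuous_on {0..L} (F v)) \<and>
     (\<exists>K\<ge>0. \<forall>t\<in>{0..L}. linear (\<lambda>v. F v t) \<and> (\<forall>v. cmod (F v t) \<le> K * norm v))"

lemma lin_famI:
  assumes "\<And>v. continuous_on {0..L} (F v)" "K \<ge> 0"
    "\<And>t. t \<in> {0..L} \<Longrightarrow> linear (\<lambda>v. F v t)" "\<And>t v. t \<in> {0..L} \<Longrightarrow> cmod (F v t) \<le> K * norm v"
  shows "lin_fam L F"
  using assms unfolding lin_fam_def by blast

lemma lin_fam_continuous: "lin_fam L F \<Longrightarrow> continuous_on {0..L} (F v)"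
  unfolding lin_fam_def by blast

lemma lin_fam_bound:
  assumes "lin_fam L F"
  obtains K where "K \<ge> 0" "\<And>t v. t \<in> {0..L} \<Longrightarrow> cmod (F v t) \<le> K * norm v"
  using assms unfolding lin_fam_def by blast

lemma lin_fam_linear: "lin_fam L F \<Longrightarrow> t \<in> {0..L} \<Longrightarrow> linear (\<lambda>v. F v t)"
  unfolding lin_fam_def by blast

lemma lin_fam_L2: "lin_fam L F \<Longrightarrow> L2 L (F v)"
  by (rule L2_continuous[OF lin_fam_continuous])

lemma lin_fam_eval: assumes "lin_fam L F" "t \<in> {0..L}" shows "bounded_linear (\<lambda>v. F v t)"
proof -
  obtain K where K: "K \<ge> 0" "\<And>t v. t \<in> {0..L} \<Longrightarrow> cmod (F v t) \<le> K * norm v" using lin_fam_bound[OF assms(1)] by blast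
  from K(2) show ?thesis
    using lin_fam_linear[OF assms] assms(2)
    by (intro bounded_linear_intro[where K = K]) (auto simp: linear_iff mult.commute)
qed

lemma lin_fam_add: assumes "lin_fam L F" "lin_fam L G" shows "lin_fam L (\<lambda>v t. F v t + G v t)"
proof -
  obtain K where K: "K \<ge> 0" "\<And>t v. t \<in> {0..L} \<Longrightarrow> cmod (F v t) \<le> K * norm v" using lin_fam_bound[OF assms(1)] by blast
  obtain M where M: "M \<ge> 0" "\<And>t v. t \<in> {0..L} \<Longrightarrow> cmod (G v t) \<le> M * norm v" using lin_fam_bound[OF assms(2)] by blast
  show ?thesis
  proof (rule lin_famI[of _ _ "K + M"])
    show "cmod (F v t + G v t) \<le> (K + M) * norm v" if "t \<in> {0..L}" for t v
      using norm_triangle_ineq[of "F v t" "G v t"] K(2)[OF that, of v] M(2)[OF that, of v] by (simp add: algebra_simps)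
    show "continuous_on {0..L} (\<lambda>t. F v t + G v t)" for v
      by (intro continuous_on_add lin_fam_continuous[OF assms(1)] lin_fam_continuous[OF assms(2)])
    show "linear (\<lambda>v. F v t + G v t)" if "t \<in> {0..L}" for t
      by (intro linear_compose_add lin_fam_linear[OF assms(1) that] lin_fam_linear[OF assms(2) that])
  qed (use K M in auto)
qed

lemma lin_fam_mult:
  assumes F: "lin_fam L F" and m: "continuous_on {0..L} m" shows "lin_fam L (\<lambda>v t. m t * F v t)"
proof -
  obtain K where K: "K \<ge> 0" "\<And>t v. t \<in> {0..L} \<Longrightarrow> cmod (F v t) \<le> K * norm v" using lin_fam_bound[OF F] by blast
  have "bounded (m ` {0..L})" using m by (intro compact_imp_bounded compact_continuous_image compact_Icc)
  then obtain M where M: "\<forall>x\<in>{0..L}. cmod (m x) \<le> M" "M > 0" unfolding bounded_pos by auto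
  show ?thesis
  proof (rule lin_famI[of _ _ "M * K"])
    show "cmod (m t * F v t) \<le> M * K * norm v" if "t \<in> {0..L}" for t v
      unfolding norm_mult mult.assoc using M K that by (intro mult_mono) auto
    show "linear (\<lambda>v. m t * F v t)" if "t \<in> {0..L}" for t
      using lin_fam_linear[OF F that] by (simp add: linear_iff algebra_simps)
    show "continuous_on {0..L} (\<lambda>t. m t * F v t)" for v
      by (intro continuous_on_mult m lin_fam_continuous[OF F])
  qed (use K M in auto)
qed

lemma lin_fam_const: assumes "bounded_linear c" shows "lin_fam L (\<lambda>v _. c v)"
proof -
  interpret bounded_linear c by fact
  obtain K where "K \<ge> 0" "\<And>v. norm (c v) \<le> norm v * K" using nonneg_bounded by blast
  then show ?thesis
    by (intro lin_famI[of _ _ K]) (auto simp: mult.commute linear_axioms)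
qed

text \<open>Representatives of sums and multiples agree with the pointwise ones only almost
  everywhere; after integration the choice of representative disappears, so linearity holds at every
  point.\<close>

lemma lin_fam_prim:
  assumes A: "bounded_linear A" and L: "L \<ge> 0" shows "lin_fam L (\<lambda>v. prim (A v))"
proof -
  interpret A: bounded_linear A by fact
  obtain K where K: "K \<ge> 0" "\<And>v. norm (A v) \<le> norm v * K" using A.nonneg_bounded by blast
  show ?thesis
  proof (rule lin_famI[of _ _ "sqrt L * K"])
    show "continuous_on {0..L} (prim (A v))" for v using h1_continuous[OF h1_prim[of L 0 "A v"]] by simp
    show "cmod (prim (A v) t) \<le> sqrt L * K * norm v" if "t \<in> {0..L}" for t v
    proof -
      have "cmod (prim (A v) t) \<le> sqrt L * norm (A v)" by (rule prim_le[OF that])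
      also have "\<dots> \<le> sqrt L * (norm v * K)" using K L by (intro mult_left_mono) auto
      finally show ?thesis by (simp add: mult_ac)
    qed
    fix t assume t: "t \<in> {0..L}"
    show "linear (\<lambda>v. prim (A v) t)"
    proof (rule linearI)
      have i: "set_integrable lborel {0..t} (rep_l2 y)" for y by (rule L2_integrable_Icc[OF L2_rep t])
      fix v w
      have "prim (A v + A w) t = (LINT u:{0..t}|lborel. rep_l2 (A v) u + rep_l2 (A w) u)"
        unfolding prim_def
      proof (rule integral_cong_cls[OF L2_rep L2_add[OF L2_rep L2_rep] _ t])
        show "cls L (rep_l2 (A v + A w)) = cls L (\<lambda>u. rep_l2 (A v) u + rep_l2 (A w) u)"
          unfolding cls_eq_iff[OF L2_rep L2_add[OF L2_rep L2_rep]]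
          using rep_add[of "A v" "A w"] by eventually_elim simp
      qed
      then show "prim (A (v + w)) t = prim (A v) t + prim (A w) t"
        by (simp add: A.add prim_def set_integral_add(2)[OF i i])
      fix r
      have "prim (r *\<^sub>R A v) t = (LINT u:{0..t}|lborel. r *\<^sub>R rep_l2 (A v) u)"
        unfolding prim_def scaleR_conv_of_real[of r "rep_l2 _ _"]
      proof (rule integral_cong_cls[OF L2_rep L2_cmult[OF L2_rep] _ t])
        show "cls L (rep_l2 (r *\<^sub>R A v)) = cls L (\<lambda>u. of_real r * rep_l2 (A v) u)"
          unfolding cls_eq_iff[OF L2_rep L2_cmult[OF L2_rep]]
          using rep_scaleR[of r "A v"] by eventually_elim (simp add: scaleR_conv_of_real)
      qed
      then show "prim (A (r *\<^sub>R v)) t = r *\<^sub>R prim (A v) t"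
        by (simp add: A.scaleR prim_def)
    qed
  qed (use K L in auto)
qed

lemma lin_fam_cls:
  assumes F: "lin_fam L F" and L: "L \<ge> 0" shows "bounded_linear (\<lambda>v. cls L (F v))"
proof -
  obtain K where K: "K \<ge> 0" "\<And>t v. t \<in> {0..L} \<Longrightarrow> cmod (F v t) \<le> K * norm v" using lin_fam_bound[OF F] by blast
  note L2 = lin_fam_L2[OF F]
  show ?thesis
  proof (rule bounded_linear_intro)
    show "cls L (F (v + w)) = cls L (F v) + cls L (F w)" for v w
      unfolding cls_add[OF L2 L2, symmetric] by (rule cls_cong) (use lin_fam_linear[OF F] in \<open>auto simp: linear_iff\<close>)
    show "cls L (F (r *\<^sub>R v)) = r *\<^sub>R cls L (F v)" for r v
      unfolding cls_scaleR[OF L2, symmetric] by (rule cls_cong) (use lin_fam_linear[OF F] in \<open>auto simp: linear_iff\<close>)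
    show "norm (cls L (F v)) \<le> norm v * (sqrt L * K)" for v
    proof -
      have "norm (cls L (F v)) \<le> sqrt L * (K * norm v)" using K L by (intro norm_cls_le L2) auto
      then show ?thesis by (simp add: mult_ac)
    qed
  qed
qed

lemma lin_fam_integral:
  assumes F: "lin_fam L F" and L: "L \<ge> 0" shows "lin_fam L (\<lambda>v t. LINT u:{0..t}|lborel. F v u)"
proof -
  have "lin_fam L (\<lambda>v. prim (cls L (F v)))" by (intro lin_fam_prim lin_fam_cls F L)
  moreover have e: "prim (cls L (F v)) t = (LINT u:{0..t}|lborel. F v u)" if "t \<in> {0..L}" for v t
    by (rule prim_cls[OF lin_fam_L2[OF F] that])
  moreover have "continuous_on {0..L} (prim (cls L (F v))) \<longleftrightarrow> continuous_on {0..L} (\<lambda>t. LINT u:{0..t}|lborel. F v u)" for v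
    by (rule continuous_on_cong) (simp_all add: e)
  ultimately show ?thesis unfolding lin_fam_def by simp
qed

text \<open>The primitive of \<open>f\<close> vanishes, and its classical derivative is
  \<open>f\<close> at every point, end points included.\<close>

lemma continuous_cls_zero:
  assumes L: "L > 0" and f: "continuous_on {0..L} f" and z: "cls L f = 0" and x: "x \<in> {0..L}"
  shows "f x = 0"
proof -
  have L2: "L2 L (\<lambda>_. 0::complex)" by (intro L2_continuous continuous_intros)
  have "cls L f = cls L (\<lambda>_. 0)" using z by (simp add: cls_def zero_l2.abs_eq)
  then have i: "(LINT t:{0..x}|lborel. f t) = 0" if "x \<in> {0..L}" for x
    using integral_cong_cls[OF L2_continuous[OF f] L2 _ that] by (simp add: set_lebesgue_integral_def)
  have h: "h1 L (\<lambda>x. 0 + (LINT t:{0..x}|lborel. f t)) f" by (rule h1_primitive[OF L2_continuous[OF f]])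
  have h0: "h1 L (\<lambda>x. 0 + (LINT t:{0..x}|lborel. f t)) (\<lambda>_. 0)" by (rule h1_cong[OF h1_const[of L 0]]) (use i in auto)
  show ?thesis using h1_dd[OF L h f x] h1_dd[OF L h0 continuous_on_const x] by simp
qed

lemma le_sqrt_mult:
  fixes u K c n :: real
  assumes "c * u\<^sup>2 \<le> K * n\<^sup>2" "c > 0" "u \<ge> 0" "n \<ge> 0"
  shows "u \<le> sqrt (K / c) * n"
proof -
  have "u\<^sup>2 \<le> (K / c) * n\<^sup>2" using assms(1,2) by (simp add: field_simps)
  then have "sqrt (u\<^sup>2) \<le> sqrt ((K / c) * n\<^sup>2)" by (rule real_sqrt_le_mono)
  then show ?thesis using assms(3,4) by (simp add: real_sqrt_mult real_sqrt_divide)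
qed

lemma l2sq_cls: "L2 L f \<Longrightarrow> l2sq L f = (norm (cls L f))\<^sup>2"
  by (simp add: norm_cls_sq l2sq_def)

lemma norm_cls_mult_le:
  assumes m: "continuous_on {0..L} m"
  obtains K where "K \<ge> 0" "\<And>f. L2 L f \<Longrightarrow> norm (cls L (\<lambda>t. m t * f t)) \<le> K * norm (cls L f)"
proof -
  obtain K where K: "K \<ge> 0" "\<And>y. norm (cls L (\<lambda>x. m x * rep_l2 y x)) \<le> norm y * K"
    using bounded_linear.nonneg_bounded[OF bounded_linear_mult_cls[OF m]] by blast
  have "cls L (\<lambda>x. m x * rep_l2 (cls L f) x) = cls L (\<lambda>t. m t * f t)" if f: "L2 L f" for f
    unfolding cls_eq_iff[OF L2_mult_continuous[OF L2_rep m] L2_mult_continuous[OF f m]]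
    using rep_cls[OF f] by eventually_elim simp
  then show thesis using that[of K] K by (metis mult.commute)
qed

text \<open>A Sobolev embedding: the left side is the norm of the constant function with value
  \<open>f t\<close>, and its deviation from \<open>f\<close> is an integral of
  \<open>f'\<close>.\<close>

lemma h1_sup_bound:
  assumes L: "L > 0" and h: "h1 L f f'" and t: "t \<in> {0..L}"
  shows "sqrt L * cmod (f t) \<le> norm (cls L f) + 2 * L * norm (cls L f')"
proof -
  have Lf: "L2 L f" by (rule L2_continuous[OF h1_continuous[OF h]])
  have Lc: "L2 L (\<lambda>_. f t)" by (rule L2_continuous) simp
  have "(sqrt L * cmod (f t))\<^sup>2 = (norm (cls L (\<lambda>_. f t)))\<^sup>2"
    using L by (simp add: norm_cls_sq[OF Lc] set_lebesgue_integral_def power_mult_distrib)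
  then have "sqrt L * cmod (f t) = norm (cls L (\<lambda>_. f t))"
    using L by (simp add: power2_eq_iff_nonneg)
  also have "cls L (\<lambda>_. f t) = cls L f + cls L (\<lambda>s. f t - f s)"
    by (subst cls_add[symmetric, OF Lf L2_diff[OF Lc Lf]]) simp
  also have "norm \<dots> \<le> norm (cls L f) + sqrt L * (2 * sqrt L * norm (cls L f'))"
  proof (intro norm_triangle_le add_left_mono norm_cls_le L2_diff Lc Lf)
    fix s assume s: "s \<in> {0..L}"
    have "f t - f s = (LINT u:{0..t}|lborel. f' u) - (LINT u:{0..s}|lborel. f' u)"
      using h1_eq[OF h t] h1_eq[OF h s] by simp
    also have "cmod \<dots> \<le> cmod (LINT u:{0..t}|lborel. f' u) + cmod (LINT u:{0..s}|lborel. f' u)"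
      by (rule norm_triangle_ineq4)
    also have "\<dots> \<le> 2 * sqrt L * norm (cls L f')"
      using integral_le_norm_cls[OF h1_L2[OF h] t] integral_le_norm_cls[OF h1_L2[OF h] s] by simp
    finally show "cmod (f t - f s) \<le> 2 * sqrt L * norm (cls L f')" .
  qed (use L in auto)
  also have "sqrt L * (2 * sqrt L * norm (cls L f')) = 2 * L * norm (cls L f')" using L by simp
  finally show ?thesis .
qed

lemma cls_h1_unique:
  assumes "L \<ge> 0" "h1 L f g" "h1 L f g'" shows "cls L g = cls L g'"
  unfolding cls_eq_iff[OF h1_L2[OF assms(2)] h1_L2[OF assms(3)]] by (rule h1_unique[OF assms])

lemma cls_wd: "L \<ge> 0 \<Longrightarrow> h1 L f g \<Longrightarrow> cls L (wd L f) = cls L g"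
  by (rule cls_h1_unique[OF _ wd_h1]) (auto simp: sob_1_iff)

section \<open>The closed-loop operator in coordinates\<close>

type_synonym coord = "l2 \<times> l2 \<times> complex \<times> complex \<times> complex"

text \<open>The coordinates of \<open>(w, v)\<close> are \<open>((P w')', v', w'(L), w(0), v(0))\<close>.\<close>

abbreviation (input) kk :: "coord \<Rightarrow> l2" where "kk x \<equiv> fst x"
abbreviation (input) pp :: "coord \<Rightarrow> l2" where "pp x \<equiv> fst (snd x)"
abbreviation (input) al :: "coord \<Rightarrow> complex" where "al x \<equiv> fst (snd (snd x))"
abbreviation (input) be :: "coord \<Rightarrow> complex" where "be x \<equiv> fst (snd (snd (snd x)))"
abbreviation (input) ss :: "coord \<Rightarrow> complex" where "ss x \<equiv> snd (snd (snd (snd x)))"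

lemmas bounded_linear_coord =
  bounded_linear_fst
  bounded_linear_compose[OF bounded_linear_fst bounded_linear_snd]
  bounded_linear_compose[OF bounded_linear_fst bounded_linear_compose[OF bounded_linear_snd bounded_linear_snd]]
  bounded_linear_compose[OF bounded_linear_fst bounded_linear_compose[OF bounded_linear_snd bounded_linear_compose[OF bounded_linear_snd bounded_linear_snd]]]
  bounded_linear_compose[OF bounded_linear_snd bounded_linear_compose[OF bounded_linear_snd bounded_linear_compose[OF bounded_linear_snd bounded_linear_snd]]]

locale gantry =
  fixes L P0 a b th1 th2 th3 th4 :: real and P :: "real \<Rightarrow> real"
  assumes L: "L > 0" and P_sob: "sob 2 L P" and P0: "P0 > 0" and P_ge: "\<forall>x\<in>{0..L}. P x \<ge> P0"
    and a: "a > 0" and b: "b > 0"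
    and th1: "th1 = th3 / b - a" and th2: "th2 = th4 / b" and th3: "th3 < 0" and th4: "th4 > 0"
begin

definition p :: "real \<Rightarrow> complex" where "p x = complex_of_real (P x)"

definition q :: "real \<Rightarrow> complex" where "q x = inverse (p x)"

lemma P_pos: "x \<in> {0..L} \<Longrightarrow> P x > 0"
  using P_ge P0 by force

lemma p_nz: "x \<in> {0..L} \<Longrightarrow> p x \<noteq> 0"
  using P_pos by (fastforce simp: p_def)

lemma p_q: "x \<in> {0..L} \<Longrightarrow> p x * (q x * z) = z"
  using p_nz by (simp add: q_def)

lemma sob_p: "sob (Suc (Suc 0)) L p"
  using sob_of_real[OF P_sob] by (simp add: p_def[abs_def] numeral_2_eq_2)

lemma sob_q: "sob (Suc (Suc 0)) L q"
  unfolding q_def[abs_def] by (rule sob_inverse(1)[OF L sob_p p_nz])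

lemma cont_p: "continuous_on {0..L} p" and cont_q: "continuous_on {0..L} q"
  using sob_continuous sob_p sob_q by auto

lemma cont_P: "continuous_on {0..L} P"
  using continuous_on_Re[OF cont_p] by (simp add: p_def)

lemma L_in [simp]: "L \<in> {0..L}" "0 \<in> {0..L}"
  using L by auto

section \<open>Functions recovered from the coordinates\<close>

definition Vf :: "coord \<Rightarrow> real \<Rightarrow> complex" where "Vf x t = ss x + prim (pp x) t"
text \<open>The flux \<open>P w'\<close>, normalised at \<open>L\<close> because the coordinate for
  \<open>w'\<close> is its value there. Correspondingly \<open>Df\<close> is \<open>w'\<close>,
  \<open>Wf\<close> is \<open>w\<close>, and \<open>Vf\<close> is \<open>v\<close>.\<close>

definition Qf :: "coord \<Rightarrow> real \<Rightarrow> complex" where "Qf x t = (p L * al x - prim (kk x) L) + prim (kk x) t"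
definition Df :: "coord \<Rightarrow> real \<Rightarrow> complex" where "Df x t = q t * Qf x t"
definition Wf :: "coord \<Rightarrow> real \<Rightarrow> complex" where "Wf x t = be x + (LINT u:{0..t}|lborel. Df x u)"

lemma pD: "t \<in> {0..L} \<Longrightarrow> p t * Df x t = Qf x t"
  by (simp add: Df_def p_q)

lemma Vf_0: "Vf x 0 = ss x" and Wf_0: "Wf x 0 = be x" and Qf_L: "Qf x L = p L * al x"
  by (simp_all add: Vf_def Wf_def Qf_def)

lemma Df_L: "Df x L = al x"
  using p_nz[OF L_in(1)] by (simp add: Df_def Qf_L q_def)

lemma lin_Vf: "lin_fam L Vf"
  unfolding Vf_def[abs_def] by (intro lin_fam_add lin_fam_const lin_fam_prim bounded_linear_coord) (use L in auto)

lemma lin_Qf: "lin_fam L Qf"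
proof -
  have pL: "bounded_linear (\<lambda>x. prim (kk x) L)"
    by (rule lin_fam_eval[OF lin_fam_prim[OF bounded_linear_coord(1), of L]]) (use L in auto)
  have "bounded_linear (\<lambda>x. p L * al x)"
    by (intro bounded_linear_compose[OF bounded_linear_mult_right] bounded_linear_coord)
  then show ?thesis
    unfolding Qf_def[abs_def]
    by (intro lin_fam_add lin_fam_const lin_fam_prim bounded_linear_coord bounded_linear_sub pL) (use L in auto)
qed

lemma lin_Df: "lin_fam L Df"
  unfolding Df_def[abs_def] by (rule lin_fam_mult[OF lin_Qf cont_q])

lemma lin_Wf: "lin_fam L Wf"
  unfolding Wf_def[abs_def]
  by (intro lin_fam_add lin_fam_const lin_fam_integral lin_Df bounded_linear_coord) (use L in auto)

lemma h1_Vf: "h1 L (Vf x) (rep_l2 (pp x))"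
  unfolding Vf_def[abs_def] by (rule h1_prim)

lemma h1_Qf: "h1 L (Qf x) (rep_l2 (kk x))"
  unfolding Qf_def[abs_def] by (rule h1_prim)

lemma h1_Wf: "h1 L (Wf x) (Df x)"
  unfolding Wf_def[abs_def] by (rule h1_primitive[OF lin_fam_L2[OF lin_Df]])

section \<open>The inverse of the generator\<close>

definition bG :: "coord \<Rightarrow> complex" where
  "bG x = (ss x - th1 * be x - th2 * Df x 0 - th4 * (q 0 * (p L * (- Vf x L) - (LINT u:{0..L}|lborel. Vf x u)))) / th3"

text \<open>Solving \<open>A z = y\<close> for \<open>z\<close>: the functions \<open>(P w')'\<close> and \<open>v\<close> of \<open>z\<close> are the functions \<open>v\<close> and \<open>w\<close> of \<open>y\<close>, and
  \<open>w(0) = bG y\<close> comes from the boundary condition at \<open>0\<close>.\<close>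

definition G :: "coord \<Rightarrow> coord" where
  "G x = (cls L (Vf x), cls L (Df x), - Vf x L, bG x, be x)"

text \<open>Cuts both functions off outside \<open>[0,L]\<close>. Its fixed points are exactly the
  coordinates of states.\<close>

definition Pr :: "coord \<Rightarrow> coord" where
  "Pr x = (cls L (rep_l2 (kk x)), cls L (rep_l2 (pp x)), al x, be x, ss x)"

lemma bounded_linear_Pr: "bounded_linear Pr"
  unfolding Pr_def[abs_def]
  by (intro bounded_linear_Pair bounded_linear_coord bounded_linear_compose[OF bounded_linear_cls_rep])

lemma bounded_linear_bG: "bounded_linear bG"
proof -
  have "bounded_linear (\<lambda>x. LINT u:{0..L}|lborel. Vf x u)"
    by (rule lin_fam_eval[OF lin_fam_integral[OF lin_Vf]]) (use L in auto)
  moreover have "bounded_linear (\<lambda>x. Vf x L)" "bounded_linear (\<lambda>x. Df x 0)"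
    by (intro lin_fam_eval[OF lin_Vf] lin_fam_eval[OF lin_Df] L_in)+
  ultimately show ?thesis
    unfolding bG_def[abs_def] divide_inverse
    by (intro bounded_linear_sub bounded_linear_compose[OF bounded_linear_mult_right]
       bounded_linear_compose[OF bounded_linear_mult_left] bounded_linear_coord bounded_linear_minus)
qed

lemma bounded_linear_G: "bounded_linear G"
  unfolding G_def[abs_def]
  by (intro bounded_linear_Pair bounded_linear_coord lin_fam_cls lin_Vf lin_Df bounded_linear_minus
      lin_fam_eval[OF lin_Vf] bounded_linear_bG) (use L in auto)

lemma Pr_Pr: "Pr (Pr x) = Pr x" and Pr_G: "Pr (G x) = G x"
  by (simp_all add: Pr_def G_def lin_fam_L2[OF lin_Vf] lin_fam_L2[OF lin_Df])

lemma prim_Pr: "t \<in> {0..L} \<Longrightarrow> prim (cls L (rep_l2 y)) t = prim y t"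
  by (subst prim_cls[of L]) (simp_all add: prim_def)

lemma Vf_Pr: "t \<in> {0..L} \<Longrightarrow> Vf (Pr x) t = Vf x t" and Qf_Pr: "t \<in> {0..L} \<Longrightarrow> Qf (Pr x) t = Qf x t"
  by (simp_all only: Vf_def Qf_def Pr_def fst_conv snd_conv prim_Pr L_in)

lemma Df_Pr: "t \<in> {0..L} \<Longrightarrow> Df (Pr x) t = Df x t"
  by (simp add: Df_def Qf_Pr)

lemma coord_Pr: "al (Pr x) = al x" "be (Pr x) = be x" "ss (Pr x) = ss x"
  by (simp_all add: Pr_def)

lemma G_Pr: "G (Pr x) = G x"
proof -
  have "(LINT u:{0..L}|lborel. Vf (Pr x) u) = (LINT u:{0..L}|lborel. Vf x u)"
    by (intro set_lebesgue_integral_cong) (use Vf_Pr in auto)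
  then have "bG (Pr x) = bG x" by (simp only: bG_def coord_Pr Vf_Pr Df_Pr L_in)
  moreover have "cls L (Vf (Pr x)) = cls L (Vf x)" by (rule cls_cong) (rule Vf_Pr)
  moreover have "cls L (Df (Pr x)) = cls L (Df x)" by (rule cls_cong) (rule Df_Pr)
  ultimately show ?thesis
    unfolding G_def coord_Pr Vf_Pr[OF L_in(1)] by simp
qed

lemma coord_G: "kk (G x) = cls L (Vf x)" "pp (G x) = cls L (Df x)" "al (G x) = - Vf x L" "be (G x) = bG x" "ss (G x) = be x"
  by (simp_all add: G_def)

lemma Vf_G: "t \<in> {0..L} \<Longrightarrow> Vf (G x) t = Wf x t"
  by (simp only: Vf_def Wf_def coord_G prim_cls[OF lin_fam_L2[OF lin_Df]])

lemma Qf_G: "t \<in> {0..L} \<Longrightarrow> Qf (G x) t = p L * (- Vf x L) - (LINT u:{0..L}|lborel. Vf x u) + (LINT u:{0..t}|lborel. Vf x u)"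
  by (simp only: Qf_def coord_G prim_cls[OF lin_fam_L2[OF lin_Vf]] L_in)

lemma boundary_G: "th1 * be x + th2 * Df x 0 + th3 * be (G x) + th4 * Df (G x) 0 = ss x"
proof -
  have D: "Df (G x) 0 = q 0 * (p L * (- Vf x L) - (LINT u:{0..L}|lborel. Vf x u))"
    by (simp only: Df_def Qf_G[OF L_in(2)]) simp
  have "th3 * bG x = ss x - th1 * be x - th2 * Df x 0 - th4 * (q 0 * (p L * (- Vf x L) - (LINT u:{0..L}|lborel. Vf x u)))"
    using th3 by (simp only: bG_def) simp
  then show ?thesis unfolding coord_G D by simp
qed

text \<open>A continuous function with zero class vanishes pointwise, so \<open>v\<close>,
  \<open>w'\<close> and the flux are zero. Uniqueness of weak derivatives then clears the square
  integrable coordinates.\<close>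

lemma G_inj: assumes x: "Pr x = x" and z: "G x = 0" shows "x = 0"
proof -
  have e: "cls L (Vf x) = 0" "cls L (Df x) = 0" "be x = 0" using z by (simp_all add: G_def zero_prod_def)
  have V: "Vf x t = 0" if "t \<in> {0..L}" for t
    by (rule continuous_cls_zero[OF L lin_fam_continuous[OF lin_Vf] e(1) that])
  have D: "Df x t = 0" if "t \<in> {0..L}" for t
    by (rule continuous_cls_zero[OF L lin_fam_continuous[OF lin_Df] e(2) that])
  have Q: "Qf x t = 0" if "t \<in> {0..L}" for t using pD[OF that, of x] D[OF that] by simp
  have zero: "cls L (rep_l2 y) = 0" if h: "h1 L f (rep_l2 y)" and f: "\<And>t. t \<in> {0..L} \<Longrightarrow> f t = 0" for f y
  proof -
    have "h1 L f (\<lambda>_. 0)" by (rule h1_cong[OF h1_const[of L 0]]) (simp_all add: f)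
    then have "AE t in lborel. t \<in> {0..L} \<longrightarrow> rep_l2 y t = 0" using h1_unique[OF _ h] L by simp
    then have "cls L (rep_l2 y) = cls L (\<lambda>_. 0)"
      by (subst cls_eq_iff) (auto intro: L2_continuous continuous_intros)
    then show ?thesis by (simp add: cls_def zero_l2.abs_eq)
  qed
  have "kk x = 0" "pp x = 0"
    using zero[OF h1_Qf Q] zero[OF h1_Vf V] x by (metis Pr_def fst_conv snd_conv)+
  moreover have "ss x = 0" using V[OF L_in(2)] by (simp add: Vf_0)
  moreover have "al x = 0" using D[OF L_in(1)] by (simp add: Df_L)
  ultimately show ?thesis using e(3) by (simp add: zero_prod_def prod_eq_iff)
qed

section \<open>The energy and its dissipation\<close>

definition sP :: "real \<Rightarrow> complex" where "sP t = complex_of_real (sqrt (P t))"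

lemma cont_sP: "continuous_on {0..L} sP"
  unfolding sP_def[abs_def] by (intro continuous_intros cont_P)

lemma sP_sq: "t \<in> {0..L} \<Longrightarrow> sP t * cnj (sP t) = p t"
  using P_pos[of t] by (simp add: sP_def p_def flip: of_real_mult)

definition c1 :: real where "c1 = P 0 * b * (a + b) / th4"
definition c2 :: real where "c2 = - P 0 * th3 / th4"

lemma c1_pos: "c1 > 0" and c2_pos: "c2 > 0"
  using P_pos[OF L_in(2)] a b th3 th4 by (auto simp: c1_def c2_def divide_neg_pos mult_pos_neg)

text \<open>The squared norm of \<open>\<Phi> x\<close> is the energy of \<open>u = v + b w\<close>.\<close>

definition \<Phi> :: "coord \<Rightarrow> coord" where
  "\<Phi> x = (cls L (\<lambda>t. sP t * (rep_l2 (pp x) t + b * Df x t)), cls L (\<lambda>t. rep_l2 (kk x) t + b * Vf x t),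
    sP L * (al x - b * Vf x L), sqrt c1 * ss x, sqrt c2 * (ss x + b * be x))"

lemma L2_strain0: "L2 L (\<lambda>t. rep_l2 (pp x) t + b * Df x t)" and L2_velocity: "L2 L (\<lambda>t. rep_l2 (kk x) t + b * Vf x t)"
  by (intro L2_add L2_rep L2_cmult lin_fam_L2[OF lin_Df] lin_fam_L2[OF lin_Vf])+

lemma L2_strain: "L2 L (\<lambda>t. sP t * (rep_l2 (pp x) t + b * Df x t))"
  by (rule L2_mult_continuous[OF L2_strain0 cont_sP])

lemma bounded_linear_\<Phi>: "bounded_linear \<Phi>"
proof -
  have 1: "cls L (\<lambda>t. sP t * (rep_l2 (pp x) t + b * Df x t))
      = cls L (\<lambda>t. sP t * rep_l2 (pp x) t) + cls L (\<lambda>t. (sP t * b) * Df x t)" for x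
    by (subst cls_add[symmetric])
       (auto intro!: L2_mult_continuous lin_fam_L2[OF lin_Df] continuous_intros cont_sP cls_cong simp: algebra_simps)
  have 2: "cls L (\<lambda>t. rep_l2 (kk x) t + b * Vf x t) = cls L (rep_l2 (kk x)) + cls L (\<lambda>t. b * Vf x t)" for x
    by (rule cls_add) (auto intro!: L2_cmult lin_fam_L2[OF lin_Vf])
  have V: "bounded_linear (\<lambda>x. Vf x L)" by (intro lin_fam_eval[OF lin_Vf] L_in)
  show ?thesis
    unfolding \<Phi>_def[abs_def] 1 2
    by (intro bounded_linear_Pair bounded_linear_add bounded_linear_sub bounded_linear_coord
        bounded_linear_compose[OF bounded_linear_cls_rep] bounded_linear_compose[OF bounded_linear_mult_cls]
        lin_fam_cls lin_fam_mult lin_Df lin_Vf cont_sP continuous_intros V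
        bounded_linear_compose[OF bounded_linear_mult_right])
       (use L in auto)
qed

lemma \<Phi>_Pr: "\<Phi> (Pr x) = \<Phi> x"
proof -
  have 1: "cls L (\<lambda>t. sP t * (rep_l2 (pp (Pr x)) t + b * Df (Pr x) t)) = cls L (\<lambda>t. sP t * (rep_l2 (pp x) t + b * Df x t))"
    unfolding cls_eq_iff[OF L2_strain L2_strain] using rep_cls[OF L2_rep[of L "pp x"]]
    by eventually_elim (simp add: Df_Pr, simp add: Pr_def)
  have 2: "cls L (\<lambda>t. rep_l2 (kk (Pr x)) t + b * Vf (Pr x) t) = cls L (\<lambda>t. rep_l2 (kk x) t + b * Vf x t)"
    unfolding cls_eq_iff[OF L2_velocity L2_velocity] using rep_cls[OF L2_rep[of L "kk x"]]
    by eventually_elim (simp add: Vf_Pr, simp add: Pr_def)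
  show ?thesis unfolding \<Phi>_def 1 2 coord_Pr Vf_Pr[OF L_in(1)] ..
qed

lemma inner_complex_eq_Re: "inner (u :: complex) v = Re (u * cnj v)"
  by (simp add: inner_complex_def)

lemma inner_sqrt_mult: "c \<ge> 0 \<Longrightarrow> inner (complex_of_real (sqrt c) * u) (complex_of_real (sqrt c) * v) = c * Re (u * cnj v)"
  unfolding scaleR_conv_of_real[symmetric] inner_scaleR_left inner_scaleR_right
  unfolding inner_complex_eq_Re by (simp only: mult.assoc[symmetric] real_sqrt_mult_self abs_of_nonneg)

text \<open>Green's formula, that is the product rule for \<open>f\<close> and the conjugate of
  \<open>g\<close> integrated over the whole interval; \<open>g\<close> will be a flux.\<close>

lemma h1_boundary:
  assumes f: "h1 L f f'" and g: "h1 L g g'"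
  shows "(LINT t:{0..L}|lborel. f' t * cnj (g t)) + (LINT t:{0..L}|lborel. f t * cnj (g' t)) = f L * cnj (g L) - f 0 * cnj (g 0)"
    "set_integrable lborel {0..L} (\<lambda>t. f' t * cnj (g t))" "set_integrable lborel {0..L} (\<lambda>t. f t * cnj (g' t))"
proof -
  show i: "set_integrable lborel {0..L} (\<lambda>t. f' t * cnj (g t))" "set_integrable lborel {0..L} (\<lambda>t. f t * cnj (g' t))"
    by (intro L2_prod_integrable h1_L2[OF f] h1_L2[OF g] L2_continuous h1_continuous[OF f] h1_continuous[OF g])+
  have h: "h1 L (\<lambda>t. f t * cnj (g t)) (\<lambda>t. f' t * cnj (g t) + f t * cnj (g' t))"
    by (rule h1_mult[OF f h1_cnj[OF g]])
  show "(LINT t:{0..L}|lborel. f' t * cnj (g t)) + (LINT t:{0..L}|lborel. f t * cnj (g' t)) = f L * cnj (g L) - f 0 * cnj (g 0)"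
    using h1_eq[OF h L_in(1)] set_integral_add(2)[OF i] by (simp add: algebra_simps)
qed

lemma h1_Vf_G: "h1 L (Vf (G x)) (Df x)"
  by (rule h1_cong[OF h1_Wf]) (simp_all add: Vf_G)

lemma h1_Qf_G: "h1 L (Qf (G x)) (Vf x)"
  by (rule h1_cong[OF h1_primitive[OF lin_fam_L2[OF lin_Vf]]]) (simp_all add: Qf_G)

lemma \<Phi>_G: "\<Phi> (G x) = (cls L (\<lambda>t. sP t * (Df x t + b * Df (G x) t)), cls L (\<lambda>t. Vf x t + b * Vf (G x) t),
    - (sP L * (Vf x L + b * Vf (G x) L)), sqrt c1 * be x, sqrt c2 * (be x + b * be (G x)))"
proof -
  have 1: "cls L (\<lambda>t. sP t * (rep_l2 (pp (G x)) t + b * Df (G x) t)) = cls L (\<lambda>t. sP t * (Df x t + b * Df (G x) t))"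
    by (subst cls_eq_iff)
       (use rep_cls[OF lin_fam_L2[OF lin_Df, of x]] in \<open>auto simp: coord_G intro!: L2_mult_continuous cont_sP L2_add L2_cmult lin_fam_L2[OF lin_Df]\<close>)
  have 2: "cls L (\<lambda>t. rep_l2 (kk (G x)) t + b * Vf (G x) t) = cls L (\<lambda>t. Vf x t + b * Vf (G x) t)"
    by (subst cls_eq_iff)
       (use rep_cls[OF lin_fam_L2[OF lin_Vf, of x]] in \<open>auto simp: coord_G intro!: L2_add L2_cmult lin_fam_L2[OF lin_Vf]\<close>)
  show ?thesis unfolding \<Phi>_def 1 2 by (simp add: coord_G(3,5) algebra_simps)
qed

text \<open>For the state with coordinates \<open>G x\<close>, on which the generator takes the
  value \<open>x\<close>, this is half the time derivative of the energy. The integral components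
  reduce to fluxes at the two ends by Green's formula.\<close>

lemma diss: "inner (\<Phi> x) (\<Phi> (G x)) \<le> 0"
proof -
  \<comment> \<open>For the state with coordinates \<open>G x\<close>, \<open>h\<close> is
    \<open>u_t\<close> and \<open>g\<close> is \<open>P u'\<close>; their derivatives are
    \<open>h'\<close> and \<open>g'\<close>, and \<open>g'\<close> is also
    \<open>u_tt\<close>.\<close>
  define h h' g g' where "h t = Vf x t + b * Vf (G x) t" and "h' t = rep_l2 (pp x) t + b * Df x t"
    and "g t = Qf x t + b * Qf (G x) t" and "g' t = rep_l2 (kk x) t + b * Vf x t" for t
  have hh: "h1 L h h'" unfolding h_def[abs_def] h'_def[abs_def] by (intro h1_add h1_cmult h1_Vf h1_Vf_G)
  have gg: "h1 L g g'" unfolding g_def[abs_def] g'_def[abs_def] by (intro h1_add h1_cmult h1_Qf h1_Qf_G)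
  have pg: "p t * (Df x t + b * Df (G x) t) = g t" if "t \<in> {0..L}" for t
    using pD[OF that, of x] pD[OF that, of "G x"] by (simp add: g_def algebra_simps)
  note B = h1_boundary[OF hh gg]
  let ?I = "LINT t:{0..L}|lborel. h' t * cnj (g t)" and ?J = "LINT t:{0..L}|lborel. h t * cnj (g' t)"
  have L2a: "L2 L (\<lambda>t. sP t * (Df x t + b * Df (G x) t))"
    by (intro L2_mult_continuous cont_sP L2_add L2_cmult lin_fam_L2[OF lin_Df])
  have L2b: "L2 L (\<lambda>t. Vf x t + b * Vf (G x) t)"
    by (intro L2_add L2_cmult lin_fam_L2[OF lin_Vf])
  have i1: "inner (cls L (\<lambda>t. sP t * (rep_l2 (pp x) t + b * Df x t))) (cls L (\<lambda>t. sP t * (Df x t + b * Df (G x) t)))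
      = Re ?I"
  proof -
    have "(LINT t:{0..L}|lborel. sP t * (rep_l2 (pp x) t + b * Df x t) * cnj (sP t * (Df x t + b * Df (G x) t)))
       = ?I"
    proof (rule set_lebesgue_integral_cong)
      have "sP t * (rep_l2 (pp x) t + b * Df x t) * cnj (sP t * (Df x t + b * Df (G x) t)) = h' t * cnj (g t)" if t: "t \<in> {0..L}" for t
      proof -
        have "sP t * (rep_l2 (pp x) t + b * Df x t) * cnj (sP t * (Df x t + b * Df (G x) t))
           = h' t * ((sP t * cnj (sP t)) * cnj (Df x t + b * Df (G x) t))"
          by (simp only: h'_def complex_cnj_mult mult_ac)
        also have "(sP t * cnj (sP t)) * cnj (Df x t + b * Df (G x) t) = cnj (g t)"
          unfolding sP_sq[OF t] pg[OF t, symmetric] by (simp add: p_def)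
        finally show ?thesis .
      qed
      then show "\<forall>t. t \<in> {0..L} \<longrightarrow> sP t * (rep_l2 (pp x) t + b * Df x t) * cnj (sP t * (Df x t + b * Df (G x) t)) = h' t * cnj (g t)"
        by blast
    qed simp
    then show ?thesis unfolding inner_cls[OF L2_strain L2a] by simp
  qed
  have i2: "inner (cls L (\<lambda>t. rep_l2 (kk x) t + b * Vf x t)) (cls L (\<lambda>t. Vf x t + b * Vf (G x) t))
      = Re ?J"
    unfolding inner_commute[of "cls L (\<lambda>t. rep_l2 (kk x) t + b * Vf x t)"]
    by (simp add: inner_cls[OF L2b L2_velocity] h_def g'_def)
  have gL: "g L = p L * (al x - b * Vf x L)" by (simp add: g_def Qf_L coord_G algebra_simps)
  \<comment> \<open>The boundary condition at \<open>L\<close>, encoded in the third coordinate of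
    \<open>G x\<close>, makes this component the negative of the flux there.\<close>
  have i3: "inner (sP L * (al x - b * Vf x L)) (- (sP L * (Vf x L + b * Vf (G x) L))) = - Re (h L * cnj (g L))"
  proof -
    have "inner (sP L * (al x - b * Vf x L)) (- (sP L * (Vf x L + b * Vf (G x) L))) = - Re ((sP L * cnj (sP L)) * ((al x - b * Vf x L) * cnj (h L)))"
      unfolding inner_complex_eq_Re by (simp only: h_def complex_cnj_mult complex_cnj_minus mult_minus_right uminus_complex.sel mult_ac)
    also have "\<dots> = - Re (g L * cnj (h L))" by (simp only: sP_sq[OF L_in(1)] gL mult.assoc)
    also have "\<dots> = - Re (h L * cnj (g L))" by simp
    finally show ?thesis .
  qed
  \<comment> \<open>These are \<open>v_t(0)\<close>, \<open>v(0)\<close> and \<open>w(0)\<close> of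
    the same state; \<open>d\<close> below is \<open>u'(0)\<close>.\<close>
  define s1 s r where "s1 = ss x" and "s = be x" and "r = be (G x)"
  have h0: "h 0 = s1 + b * s" by (simp add: h_def Vf_0 coord_G s1_def s_def)
  define d where "d = Df x 0 + b * Df (G x) 0"
  have g0: "g 0 = p 0 * d" using pg[OF L_in(2)] by (simp add: d_def)
  have "th1 * s + th2 * Df x 0 + th3 * r + th4 * Df (G x) 0 = s1"
    using boundary_G[of x] by (simp add: s_def s1_def r_def)
  \<comment> \<open>This relation merges \<open>v'(0)\<close> and \<open>w'(0)\<close> into the
    single quantity \<open>u'(0)\<close>.\<close>
  moreover have "complex_of_real th4 = b * th2" using b by (simp add: th2)
  ultimately have "th2 * d = s1 - th1 * s - th3 * r" by (simp add: d_def algebra_simps)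
  then have d: "d = (b / th4) * (s1 - th1 * s - th3 * r)"
    using th4 b unfolding th2 by (simp add: field_simps)
  have "inner (\<Phi> x) (\<Phi> (G x)) = Re ?I + Re ?J
      - Re (h L * cnj (g L)) + c1 * Re (s1 * cnj s) + c2 * Re ((s1 + b * s) * cnj (s + b * r))"
    unfolding \<Phi>_G unfolding \<Phi>_def inner_prod_def fst_conv snd_conv i1 i2 i3
      inner_sqrt_mult[OF less_imp_le[OF c1_pos]] inner_sqrt_mult[OF less_imp_le[OF c2_pos]] s1_def s_def r_def
    by simp
  also have "Re ?I + Re ?J
      = Re (h L * cnj (g L)) - Re (h 0 * cnj (g 0))"
    using B(1) by (metis minus_complex.sel(1) plus_complex.sel(1))
  finally have I: "inner (\<Phi> x) (\<Phi> (G x)) = c1 * Re (s1 * cnj s) + c2 * Re ((s1 + b * s) * cnj (s + b * r)) - Re (h 0 * cnj (g 0))"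
    by simp
  have e: "complex_of_real th1 * s = (th3 / b) * s - a * s" by (simp add: th1 algebra_simps)
  have "Re (h 0 * cnj (g 0)) = (P 0 * b / th4) * Re ((s1 + b * s) * cnj (s1 + a * s - (th3 / b) * (s + b * r)))"
  proof -
    have E: "s1 - th1 * s - th3 * r = s1 + a * s - (th3 / b) * (s + b * r)"
      unfolding e using b by (simp add: algebra_simps)
    have "h 0 * cnj (g 0) = (P 0 * b / th4) *\<^sub>R ((s1 + b * s) * cnj (s1 + a * s - (th3 / b) * (s + b * r)))"
      unfolding h0 g0 d p_def E scaleR_conv_of_real by simp
    then show ?thesis by (simp only: scaleR_complex.sel)
  qed
  \<comment> \<open>The coefficient of the product of \<open>u_t(0)\<close> and \<open>u(0)\<close>
    is exactly \<open>c2\<close>, so this term cancels against the last component of the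
    energy.\<close>
  also have "\<dots> = (P 0 * b / th4) * Re ((s1 + b * s) * cnj (s1 + a * s)) + c2 * Re ((s1 + b * s) * cnj (s + b * r))"
  proof -
    have gen: "Re (Y * cnj (Z - complex_of_real t * U)) = Re (Y * cnj Z) - t * Re (Y * cnj U)" for Y Z U t
      by (simp add: algebra_simps)
    show ?thesis
      unfolding of_real_divide[symmetric] gen c2_def right_diff_distrib using b th4 by (simp only: field_simps) simp
  qed
  \<comment> \<open>The mixed term carries the factor \<open>a + b\<close>, which is the one in
    \<open>c1\<close>.\<close>
  also have "Re ((s1 + b * s) * cnj (s1 + a * s)) = (cmod s1)\<^sup>2 + (a + b) * Re (s1 * cnj s) + a * b * (cmod s)\<^sup>2"
    unfolding cmod_power2 by (simp add: algebra_simps power2_eq_square)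
  finally have "inner (\<Phi> x) (\<Phi> (G x)) = - (P 0 * b / th4) * ((cmod s1)\<^sup>2 + a * b * (cmod s)\<^sup>2)"
    unfolding I using th4 by (simp add: c1_def field_simps)
  also have "\<dots> \<le> 0"
    using P_pos[OF L_in(2)] a b th4 by (simp add: mult_nonneg_nonneg)
  finally show ?thesis .
qed

section \<open>Coercivity of the energy\<close>

lemma norm_coord_sq: "(norm (x :: coord))\<^sup>2 = (norm (kk x))\<^sup>2 + (norm (pp x))\<^sup>2 + (cmod (al x))\<^sup>2 + (cmod (be x))\<^sup>2 + (cmod (ss x))\<^sup>2"
  by (cases x) (simp add: norm_Pair)

lemma norm_coord_le: "norm (x :: coord) \<le> norm (kk x) + norm (pp x) + cmod (al x) + cmod (be x) + cmod (ss x)"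
proof (rule power2_le_imp_le)
  have sq: "(u::real)\<^sup>2 + v\<^sup>2 \<le> (u + v)\<^sup>2" if "u \<ge> 0" "v \<ge> 0" for u v using that by (simp add: power2_sum)
  show "(norm x)\<^sup>2 \<le> (norm (kk x) + norm (pp x) + cmod (al x) + cmod (be x) + cmod (ss x))\<^sup>2"
    unfolding norm_coord_sq
    by (rule order_trans[OF _ sq]; (rule add_right_mono)?; simp?)+
qed simp

lemma norm_component_le:
  "norm (kk x) \<le> norm (x :: coord)" "norm (pp x) \<le> norm (x :: coord)" "cmod (al x) \<le> norm (x :: coord)"
  "cmod (be x) \<le> norm (x :: coord)" "cmod (ss x) \<le> norm (x :: coord)"
  by (rule power2_le_imp_le; simp add: norm_coord_sq)+

lemma Qf_0_le: assumes "Pr x = x" shows "cmod (Qf x 0) \<le> P L * cmod (al x) + sqrt L * norm (kk x)"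
proof -
  have "cmod (Qf x 0) \<le> cmod (p L * al x) + cmod (prim (kk x) L)"
    unfolding Qf_def using norm_triangle_ineq4 by simp
  also have "\<dots> \<le> P L * cmod (al x) + sqrt L * norm (kk x)"
    using prim_le[OF L_in(1), of "kk x"] P_pos[OF L_in(1)] by (simp add: p_def norm_mult)
  finally show ?thesis .
qed

lemma cmod_add_sq_ge: "(cmod (u + complex_of_real r * v))\<^sup>2 \<ge> (cmod u)\<^sup>2 + 2 * r * Re (u * cnj v)"
proof -
  have "(cmod (u + r * v))\<^sup>2 = (cmod u)\<^sup>2 + 2 * r * Re (u * cnj v) + r\<^sup>2 * (cmod v)\<^sup>2"
    unfolding cmod_power2 by (simp add: algebra_simps power2_eq_square)
  moreover have "0 \<le> r\<^sup>2 * (cmod v)\<^sup>2" by simp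
  ultimately show ?thesis by linarith
qed

text \<open>Expanding the squares in the energy, the mixed terms form the total derivative of \<open>2 b Re (P w' cnj v)\<close>;
  its value at \<open>L\<close> cancels against the boundary term there.\<close>

lemma energy_lower:
  assumes x: "Pr x = x"
  shows "(norm (\<Phi> x))\<^sup>2 \<ge> P0 * (norm (pp x))\<^sup>2 + (norm (kk x))\<^sup>2 + P L * (cmod (al x))\<^sup>2
     - 2 * b * cmod (ss x) * cmod (Qf x 0)"
    and "(norm (\<Phi> x))\<^sup>2 \<ge> c1 * (cmod (ss x))\<^sup>2" "(norm (\<Phi> x))\<^sup>2 \<ge> c2 * (cmod (ss x + b * be x))\<^sup>2"
proof -
  let ?f = "rep_l2 (pp x)" and ?g = "rep_l2 (kk x)"
  let ?I = "LINT t:{0..L}|lborel. ?f t * cnj (Qf x t)" and ?J = "LINT t:{0..L}|lborel. Vf x t * cnj (?g t)"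
  have k: "kk x = cls L ?g" "pp x = cls L ?f" using x by (metis Pr_def fst_conv snd_conv)+
  define I1 I2 where "I1 = (norm (cls L (\<lambda>t. sP t * (?f t + b * Df x t))))\<^sup>2"
    and "I2 = (norm (cls L (\<lambda>t. ?g t + b * Vf x t)))\<^sup>2"
  have N: "(norm (\<Phi> x))\<^sup>2 = I1 + I2 + P L * (cmod (al x - b * Vf x L))\<^sup>2 + c1 * (cmod (ss x))\<^sup>2 + c2 * (cmod (ss x + b * be x))\<^sup>2"
    unfolding norm_coord_sq I1_def I2_def
    using P_pos[OF L_in(1)] c1_pos c2_pos by (simp add: \<Phi>_def sP_def norm_mult power_mult_distrib)
  have nn: "I1 \<ge> 0" "I2 \<ge> 0" "P L * (cmod (al x - b * Vf x L))\<^sup>2 \<ge> 0" "c1 * (cmod (ss x))\<^sup>2 \<ge> 0" "c2 * (cmod (ss x + b * be x))\<^sup>2 \<ge> 0"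
    using P_pos[OF L_in(1)] c1_pos c2_pos by (simp_all add: I1_def I2_def)
  show "(norm (\<Phi> x))\<^sup>2 \<ge> c1 * (cmod (ss x))\<^sup>2" "(norm (\<Phi> x))\<^sup>2 \<ge> c2 * (cmod (ss x + b * be x))\<^sup>2"
    unfolding N using nn by linarith+
  note B = h1_boundary[OF h1_Vf h1_Qf, of x x]
  have R: "set_integrable lborel {0..L} (\<lambda>t. Re (?f t * cnj (Qf x t)))" "set_integrable lborel {0..L} (\<lambda>t. Re (Vf x t * cnj (?g t)))"
    and Ri: "(LINT t:{0..L}|lborel. Re (?f t * cnj (Qf x t))) = Re ?I"
      "(LINT t:{0..L}|lborel. Re (Vf x t * cnj (?g t))) = Re ?J"
    using integrable_Re[OF B(2)[unfolded set_integrable_def]] integrable_Re[OF B(3)[unfolded set_integrable_def]]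
      integral_Re[OF B(2)[unfolded set_integrable_def]] integral_Re[OF B(3)[unfolded set_integrable_def]]
    by (simp_all add: set_integrable_def set_lebesgue_integral_def del: times_complex.sel)
  have f2: "set_integrable lborel {0..L} (\<lambda>t. P0 * (cmod (?f t))\<^sup>2)" and g2: "set_integrable lborel {0..L} (\<lambda>t. (cmod (?g t))\<^sup>2)"
    using L2_rep[of L "pp x"] L2_rep[of L "kk x"] by (auto simp: L2_def)
  have "P0 * (norm (pp x))\<^sup>2 + 2 * b * Re ?I
      = (LINT t:{0..L}|lborel. P0 * (cmod (?f t))\<^sup>2 + 2 * b * Re (?f t * cnj (Qf x t)))"
    using k(2) norm_cls_sq[OF L2_rep[of L "pp x"]]
    by (subst set_integral_add(2)[OF f2 set_integrable_mult_right[OF R(1)]]) (simp add: Ri(1)[symmetric] del: times_complex.sel)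
  also have "\<dots> \<le> (LINT t:{0..L}|lborel. (cmod (sP t * (?f t + b * Df x t)))\<^sup>2)"
  proof (rule set_integral_mono)
    show "set_integrable lborel {0..L} (\<lambda>t. P0 * (cmod (?f t))\<^sup>2 + 2 * b * Re (?f t * cnj (Qf x t)))"
      by (rule set_integral_add(1)[OF f2 set_integrable_mult_right[OF R(1)]])
    show "set_integrable lborel {0..L} (\<lambda>t. (cmod (sP t * (?f t + b * Df x t)))\<^sup>2)"
      using L2_strain[of x] by (simp add: L2_def)
    fix t assume t: "t \<in> {0..L}"
    have "P t * ((cmod (?f t))\<^sup>2 + 2 * b * Re (?f t * cnj (Df x t))) \<le> P t * (cmod (?f t + b * Df x t))\<^sup>2"
      using P_pos[OF t] by (intro mult_left_mono cmod_add_sq_ge) auto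
    \<comment> \<open>Only the square is weakened from \<open>P\<close> to \<open>P0\<close>. The
      mixed term keeps its exact weight, so that \<open>P w'\<close> appears, whose derivative
      occurs in the second component.\<close>
    moreover have "P t * Re (?f t * cnj (Df x t)) = Re (?f t * cnj (Qf x t))"
      unfolding pD[OF t, symmetric] p_def by (simp add: algebra_simps)
    moreover have "P0 * (cmod (?f t))\<^sup>2 \<le> P t * (cmod (?f t))\<^sup>2" using P_ge t by (intro mult_right_mono) auto
    moreover have "(cmod (sP t * (?f t + b * Df x t)))\<^sup>2 = P t * (cmod (?f t + b * Df x t))\<^sup>2"
      using P_pos[OF t] by (simp add: sP_def norm_mult power_mult_distrib)
    ultimately show "P0 * (cmod (?f t))\<^sup>2 + 2 * b * Re (?f t * cnj (Qf x t)) \<le> (cmod (sP t * (?f t + b * Df x t)))\<^sup>2"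
      by (simp add: distrib_left mult.left_commute[of "P t"] del: times_complex.sel)
  qed
  also have "\<dots> = I1" by (simp add: I1_def norm_cls_sq[OF L2_strain])
  finally have i1: "P0 * (norm (pp x))\<^sup>2 + 2 * b * Re ?I \<le> I1" .
  have "(norm (kk x))\<^sup>2 + 2 * b * Re ?J
      = (LINT t:{0..L}|lborel. (cmod (?g t))\<^sup>2 + 2 * b * Re (Vf x t * cnj (?g t)))"
    using k(1) norm_cls_sq[OF L2_rep[of L "kk x"]]
    by (subst set_integral_add(2)[OF g2 set_integrable_mult_right[OF R(2)]]) (simp add: Ri(2)[symmetric] del: times_complex.sel)
  also have "\<dots> \<le> (LINT t:{0..L}|lborel. (cmod (?g t + b * Vf x t))\<^sup>2)"
  proof (rule set_integral_mono)
    show "set_integrable lborel {0..L} (\<lambda>t. (cmod (?g t))\<^sup>2 + 2 * b * Re (Vf x t * cnj (?g t)))"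
      by (rule set_integral_add(1)[OF g2 set_integrable_mult_right[OF R(2)]])
    show "set_integrable lborel {0..L} (\<lambda>t. (cmod (?g t + b * Vf x t))\<^sup>2)"
      using L2_velocity[of x] by (simp add: L2_def)
    show "(cmod (?g t))\<^sup>2 + 2 * b * Re (Vf x t * cnj (?g t)) \<le> (cmod (?g t + b * Vf x t))\<^sup>2" for t
      using cmod_add_sq_ge[of "?g t" b "Vf x t"] by (simp add: mult.commute)
  qed
  also have "\<dots> = I2" by (simp add: I2_def norm_cls_sq[OF L2_velocity])
  finally have i2: "(norm (kk x))\<^sup>2 + 2 * b * Re ?J \<le> I2" .
  have "Re ?I + Re ?J
      = Re (Vf x L * cnj (Qf x L)) - Re (Vf x 0 * cnj (Qf x 0))"
    using B(1) by (metis minus_complex.sel(1) plus_complex.sel(1))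
  also have "Re (Vf x L * cnj (Qf x L)) = P L * Re (al x * cnj (Vf x L))"
    unfolding Qf_L p_def by (simp add: algebra_simps)
  finally have i3: "Re ?I + Re ?J
      = P L * Re (al x * cnj (Vf x L)) - Re (ss x * cnj (Qf x 0))" by (simp only: Vf_0)
  have "Re (ss x * cnj (Qf x 0)) \<le> cmod (ss x) * cmod (Qf x 0)"
    using complex_Re_le_cmod[of "ss x * cnj (Qf x 0)"] by (simp add: norm_mult del: times_complex.sel)
  then have i4: "2 * b * Re (ss x * cnj (Qf x 0)) \<le> 2 * b * (cmod (ss x) * cmod (Qf x 0))"
    using b by (intro mult_left_mono) auto
  have "P L * ((cmod (al x))\<^sup>2 + 2 * (- b) * Re (al x * cnj (Vf x L))) \<le> P L * (cmod (al x + complex_of_real (- b) * Vf x L))\<^sup>2"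
    using P_pos[OF L_in(1)] by (intro mult_left_mono cmod_add_sq_ge) auto
  then have i5: "P L * (cmod (al x))\<^sup>2 - 2 * b * (P L * Re (al x * cnj (Vf x L))) \<le> P L * (cmod (al x - b * Vf x L))\<^sup>2"
    by (simp add: algebra_simps del: times_complex.sel)
  have "2 * b * Re ?I + 2 * b * Re ?J
     = 2 * b * (P L * Re (al x * cnj (Vf x L))) - 2 * b * Re (ss x * cnj (Qf x 0))"
    using arg_cong[OF i3, of "\<lambda>u. 2 * b * u"] by (simp only: distrib_left right_diff_distrib)
  then show "(norm (\<Phi> x))\<^sup>2 \<ge> P0 * (norm (pp x))\<^sup>2 + (norm (kk x))\<^sup>2 + P L * (cmod (al x))\<^sup>2
     - 2 * b * cmod (ss x) * cmod (Qf x 0)"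
    unfolding N using i1 i2 i4 i5 nn unfolding mult.assoc by linarith
qed

text \<open>The term at \<open>0\<close> left by \<open>energy_lower\<close> is absorbed into half
  of the squares and a multiple of \<open>|v(0)|^2\<close>, which the energy controls through
  \<open>c1\<close>. The value \<open>w(0)\<close> is then recovered from \<open>u(0)\<close> and
  \<open>v(0)\<close>.\<close>

lemma \<Phi>_lower: "\<exists>C. \<forall>x. Pr x = x \<longrightarrow> norm x \<le> C * norm (\<Phi> x)"
proof -
  \<comment> \<open>Young's inequality against halves of the squares of \<open>w'(L)\<close> and of
    the first coordinate leaves \<open>M |v(0)|^2\<close>; dividing by \<open>c1\<close> expresses
    this cost through the energy.\<close>
  define M K where "M = 2 * b\<^sup>2 * (P L + L)" and "K = 1 + M / c1"
  have PL: "P L > 0" by (rule P_pos[OF L_in(1)])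
  have "0 \<le> P L + L" using PL L by linarith
  then have M: "M \<ge> 0" unfolding M_def by (rule mult_nonneg_nonneg[rotated]) simp
  define C where "C = sqrt (K / (1/2)) + sqrt (K / P0) + sqrt (K / (P L / 2)) + (sqrt (1 / c2) + sqrt (1 / c1)) / b + sqrt (1 / c1)"
  have "norm x \<le> C * norm (\<Phi> x)" if x: "Pr x = x" for x
  proof -
    define n m A S B N where "n = norm (kk x)" and "m = norm (pp x)" and "A = cmod (al x)" and "S = cmod (ss x)"
      and "B = cmod (ss x + b * be x)" and "N = norm (\<Phi> x)"
    note defs = n_def m_def A_def S_def B_def N_def
    have pos: "n \<ge> 0" "m \<ge> 0" "A \<ge> 0" "S \<ge> 0" "B \<ge> 0" "N \<ge> 0" by (simp_all add: defs)
    note E = energy_lower[OF x, folded defs]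
    have "2 * b * S * cmod (Qf x 0) \<le> 2 * b * S * (P L * A + sqrt L * n)"
      using Qf_0_le[OF x] b pos by (intro mult_left_mono) (auto simp: defs)
    also have "\<dots> \<le> P L * A\<^sup>2 / 2 + n\<^sup>2 / 2 + M * S\<^sup>2"
    proof -
      have z: "0 \<le> P L * (A - 2 * b * S)\<^sup>2" "0 \<le> (n - 2 * b * S * sqrt L)\<^sup>2" using PL by auto
      have "(n - 2 * b * S * sqrt L)\<^sup>2 = n\<^sup>2 - 2 * (2 * b * S * (sqrt L * n)) + 4 * (b\<^sup>2 * S\<^sup>2 * L)"
        using L by (simp add: power2_diff power_mult_distrib algebra_simps)
      moreover have "P L * (A - 2 * b * S)\<^sup>2 = P L * A\<^sup>2 - 2 * (2 * b * S * (P L * A)) + 4 * (b\<^sup>2 * S\<^sup>2 * P L)"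
        by (simp add: power2_eq_square algebra_simps)
      moreover have "M * S\<^sup>2 = 2 * (b\<^sup>2 * S\<^sup>2 * L) + 2 * (b\<^sup>2 * S\<^sup>2 * P L)"
        by (simp add: M_def algebra_simps)
      ultimately show ?thesis using z unfolding distrib_left by linarith
    qed
    finally have 1: "P0 * m\<^sup>2 + n\<^sup>2 / 2 + P L * A\<^sup>2 / 2 \<le> N\<^sup>2 + M * S\<^sup>2" using E(1) by linarith
    have "M * S\<^sup>2 = (M / c1) * (c1 * S\<^sup>2)" using c1_pos by simp
    also have "\<dots> \<le> (M / c1) * N\<^sup>2" using E(2) M c1_pos by (intro mult_left_mono) auto
    finally have 2: "P0 * m\<^sup>2 + n\<^sup>2 / 2 + P L * A\<^sup>2 / 2 \<le> K * N\<^sup>2" using 1 by (simp add: K_def algebra_simps)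
    have nn: "0 \<le> P0 * m\<^sup>2" "0 \<le> n\<^sup>2 / 2" "0 \<le> P L * A\<^sup>2 / 2" using P0 PL by auto
    have 3: "1 / 2 * n\<^sup>2 \<le> K * N\<^sup>2" "P0 * m\<^sup>2 \<le> K * N\<^sup>2" "P L / 2 * A\<^sup>2 \<le> K * N\<^sup>2"
      using 2 nn by linarith+
    have bn: "n \<le> sqrt (K / (1/2)) * N" by (rule le_sqrt_mult[OF 3(1)]) (use pos in auto)
    have bm: "m \<le> sqrt (K / P0) * N" by (rule le_sqrt_mult[OF 3(2)]) (use pos P0 in auto)
    have bA: "A \<le> sqrt (K / (P L / 2)) * N" by (rule le_sqrt_mult[OF 3(3)]) (use pos PL in auto)
    have bS: "S \<le> sqrt (1 / c1) * N" by (rule le_sqrt_mult[of c1]) (use E(2) pos c1_pos in auto)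
    have bB: "B \<le> sqrt (1 / c2) * N" by (rule le_sqrt_mult[of c2]) (use E(3) pos c2_pos in auto)
    have "b * cmod (be x) = cmod ((ss x + b * be x) - ss x)" using b by (simp add: norm_mult)
    also have "\<dots> \<le> B + S" unfolding defs by (rule norm_triangle_ineq4)
    finally have "cmod (be x) \<le> (B + S) / b" using b by (simp add: field_simps)
    also have "\<dots> \<le> (sqrt (1 / c2) * N + sqrt (1 / c1) * N) / b" using bB bS b by (intro divide_right_mono) auto
    finally have "cmod (be x) \<le> ((sqrt (1 / c2) + sqrt (1 / c1)) / b) * N" by (simp add: algebra_simps)
    then have "norm x \<le> C * N"
      using norm_coord_le[of x, folded defs] bn bm bA bS unfolding C_def distrib_right by linarith
    then show ?thesis by (simp add: N_def)
  qed
  then show ?thesis by blast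
qed

section \<open>Multiplication by complex numbers\<close>

definition Jop :: "complex \<Rightarrow> coord \<Rightarrow> coord" where
  "Jop c x = (cls L (\<lambda>t. c * rep_l2 (kk x) t), cls L (\<lambda>t. c * rep_l2 (pp x) t), c * al x, c * be x, c * ss x)"

lemma bounded_linear_Jop: "bounded_linear (Jop c)"
  unfolding Jop_def[abs_def]
  by (intro bounded_linear_Pair bounded_linear_compose[OF bounded_linear_mult_cls] continuous_intros
     bounded_linear_coord bounded_linear_compose[OF bounded_linear_mult_right])

lemma coord_Jop: "al (Jop c x) = c * al x" "be (Jop c x) = c * be x" "ss (Jop c x) = c * ss x"
  by (simp_all add: Jop_def)

lemma cls_cmult_cong:
  assumes "L2 L f" "L2 L g" "cls L f = cls L g"
  shows "cls L (\<lambda>t. c * f t) = cls L (\<lambda>t. c * g t)"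
proof -
  have "AE t in lborel. t \<in> {0..L} \<longrightarrow> f t = g t" using assms by (simp add: cls_eq_iff)
  then show ?thesis unfolding cls_eq_iff[OF L2_cmult[OF assms(1)] L2_cmult[OF assms(2)]] by eventually_elim auto
qed

lemma Jop_Pr: "Jop c (Pr x) = Pr (Jop c x)"
proof -
  have "cls L (\<lambda>t. c * rep_l2 (cls L (rep_l2 y)) t) = cls L (\<lambda>t. c * rep_l2 y t)" for y
    by (rule cls_cmult_cong) simp_all
  then show ?thesis by (simp add: Jop_def Pr_def L2_cmult)
qed

lemma prim_Jop: "t \<in> {0..L} \<Longrightarrow> prim (cls L (\<lambda>t. c * rep_l2 y t)) t = c * prim y t"
  by (subst prim_cls[of L]) (simp_all add: prim_def L2_cmult)

lemma Vf_Jop: "t \<in> {0..L} \<Longrightarrow> Vf (Jop c x) t = c * Vf x t"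
  and Qf_Jop: "t \<in> {0..L} \<Longrightarrow> Qf (Jop c x) t = c * Qf x t"
  unfolding Vf_def Qf_def coord_Jop by (simp_all add: Jop_def prim_Jop algebra_simps)

lemma Df_Jop: "t \<in> {0..L} \<Longrightarrow> Df (Jop c x) t = c * Df x t"
  by (simp add: Df_def Qf_Jop)

text \<open>Complex linearity of the semigroup rests on this: operators commuting with
  \<open>G\<close> and \<open>Pr\<close> commute with the semigroup.\<close>

lemma Jop_G: "Jop c (G x) = G (Jop c x)"
proof -
  have 1: "cls L (\<lambda>t. c * rep_l2 (cls L f) t) = cls L g"
    if "L2 L f" "\<And>t. t \<in> {0..L} \<Longrightarrow> g t = c * f t" for f g
  proof -
    have "cls L (\<lambda>t. c * rep_l2 (cls L f) t) = cls L (\<lambda>t. c * f t)" by (rule cls_cmult_cong) (simp_all add: that)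
    also have "\<dots> = cls L g" by (rule cls_cong) (simp add: that)
    finally show ?thesis .
  qed
  have "(LINT u:{0..L}|lborel. Vf (Jop c x) u) = (LINT u:{0..L}|lborel. c * Vf x u)"
    by (intro set_lebesgue_integral_cong) (use Vf_Jop in auto)
  then have I: "(LINT u:{0..L}|lborel. Vf (Jop c x) u) = c * (LINT u:{0..L}|lborel. Vf x u)" by simp
  have "bG (Jop c x) = c * bG x"
    unfolding bG_def I coord_Jop Vf_Jop[OF L_in(1)] Df_Jop[OF L_in(2)] times_divide_eq_right
    by (rule arg_cong2[where f = "(/)"]) (simp_all add: algebra_simps)
  moreover have "cls L (\<lambda>t. c * rep_l2 (cls L (Vf x)) t) = cls L (Vf (Jop c x))"
    by (rule 1[OF lin_fam_L2[OF lin_Vf] Vf_Jop])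
  moreover have "cls L (\<lambda>t. c * rep_l2 (cls L (Df x)) t) = cls L (Df (Jop c x))"
    by (rule 1[OF lin_fam_L2[OF lin_Df] Df_Jop])
  ultimately show ?thesis
    unfolding G_def[of "Jop c x"] coord_Jop Vf_Jop[OF L_in(1)] Jop_def[of c "G x"] coord_G by simp
qed

subsection \<open>Transport to the state space\<close>

lemma L_nonneg: "L \<ge> 0"
  using L by simp

definition flux :: "(real \<Rightarrow> complex) \<Rightarrow> real \<Rightarrow> complex" where
  "flux w t = p t * dd L w t"

lemma flux_d_eq: "flux_d L P w = dd L (flux w)"
  by (simp add: flux_d_def flux_def[abs_def] p_def)

definition tox :: "st \<Rightarrow> coord" where
  "tox z = (cls L (wd L (flux (sw z))), cls L (wd L (sv z)), dd L (sw z) L, sw z 0, sv z 0)"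

definition fromx :: "coord \<Rightarrow> st" where
  "fromx x = \<lparr>sw = Wf x, sv = Vf x, sxi = Vf x L, spsi = Vf x 0\<rparr>"

lemma coord_tox: "kk (tox z) = cls L (wd L (flux (sw z)))" "pp (tox z) = cls L (wd L (sv z))"
  "al (tox z) = dd L (sw z) L" "be (tox z) = sw z 0" "ss (tox z) = sv z 0"
  by (simp_all add: tox_def)

lemma Hsp_D:
  assumes "z \<in> Hsp L"
  shows "sob (Suc (Suc 0)) L (sw z)" "sob (Suc 0) L (sv z)" "sxi z = sv z L" "spsi z = sv z 0"
    "sob (Suc 0) L (dd L (sw z))" "h1 L (sw z) (dd L (sw z))" "continuous_on {0..L} (dd L (sw z))"
    "sob (Suc 0) L (flux (sw z))" "h1 L (sv z) (wd L (sv z))" "h1 L (flux (sw z)) (wd L (flux (sw z)))"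
    "h1 L (dd L (sw z)) (wd L (dd L (sw z)))"
proof -
  show 1: "sob (Suc (Suc 0)) L (sw z)" "sob (Suc 0) L (sv z)" "sxi z = sv z L" "spsi z = sv z 0"
    using assms by (simp_all add: Hsp_def numeral_2_eq_2)
  show 2: "sob (Suc 0) L (dd L (sw z))" "h1 L (sw z) (dd L (sw z))" using sob_dd[OF L 1(1)] .
  show "continuous_on {0..L} (dd L (sw z))" by (rule sob_continuous[OF 2(1)])
  show 3: "sob (Suc 0) L (flux (sw z))"
    unfolding flux_def[abs_def] by (rule sob_mult[OF sob_Suc_imp[OF sob_p] 2(1)])
  show "h1 L (sv z) (wd L (sv z))" "h1 L (flux (sw z)) (wd L (flux (sw z)))" "h1 L (dd L (sw z)) (wd L (dd L (sw z)))"
    by (intro wd_h1 1 2 3)+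
qed

lemma Pr_tox: "z \<in> Hsp L \<Longrightarrow> Pr (tox z) = tox z"
  by (simp add: Pr_def tox_def h1_L2[OF Hsp_D(9)] h1_L2[OF Hsp_D(10)])

lemma Vf_tox: assumes z: "z \<in> Hsp L" and t: "t \<in> {0..L}" shows "Vf (tox z) t = sv z t"
  unfolding Vf_def coord_tox prim_cls[OF h1_L2[OF Hsp_D(9)[OF z]] t] by (rule h1_eq[OF Hsp_D(9)[OF z] t, symmetric])

lemma Qf_tox: assumes z: "z \<in> Hsp L" and t: "t \<in> {0..L}" shows "Qf (tox z) t = flux (sw z) t"
proof -
  note h = Hsp_D(10)[OF z]
  have pr: "prim (cls L (wd L (flux (sw z)))) s = flux (sw z) s - flux (sw z) 0" if "s \<in> {0..L}" for s
    unfolding prim_cls[OF h1_L2[OF h] that] using h1_eq[OF h that] by simp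
  show ?thesis unfolding Qf_def coord_tox pr[OF t] pr[OF L_in(1)] by (simp add: flux_def)
qed

lemma q_flux: "t \<in> {0..L} \<Longrightarrow> q t * flux w t = dd L w t"
  using p_nz[of t] by (simp add: flux_def q_def)

lemma Df_tox: assumes z: "z \<in> Hsp L" and t: "t \<in> {0..L}" shows "Df (tox z) t = dd L (sw z) t"
  unfolding Df_def Qf_tox[OF assms] by (rule q_flux[OF t])

lemma Wf_tox: assumes z: "z \<in> Hsp L" and t: "t \<in> {0..L}" shows "Wf (tox z) t = sw z t"
proof -
  have "(LINT u:{0..t}|lborel. Df (tox z) u) = (LINT u:{0..t}|lborel. dd L (sw z) u)"
    by (intro set_lebesgue_integral_cong) (use Df_tox[OF z] t in auto)
  then show ?thesis unfolding Wf_def coord_tox using h1_eq[OF Hsp_D(6)[OF z] t] by simp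
qed

lemma sob_Qf: "sob (Suc 0) L (Qf x)" and sob_Vf: "sob (Suc 0) L (Vf x)"
  unfolding sob_1_iff using h1_Qf h1_Vf by blast+

lemma sob_Df: "sob (Suc 0) L (Df x)"
  unfolding Df_def[abs_def] by (rule sob_mult[OF sob_Suc_imp[OF sob_q] sob_Qf])

lemma fromx_Hsp: "fromx x \<in> Hsp L"
  using sob_SucI[OF sob_Df h1_Wf] sob_Vf by (simp add: Hsp_def fromx_def numeral_2_eq_2)

lemma dd_Wf: "t \<in> {0..L} \<Longrightarrow> dd L (Wf x) t = Df x t"
  by (rule h1_dd[OF L h1_Wf lin_fam_continuous[OF lin_Df]])

lemma tox_fromx: assumes x: "Pr x = x" shows "tox (fromx x) = x"
proof -
  have k: "kk x = cls L (rep_l2 (kk x))" "pp x = cls L (rep_l2 (pp x))" using x by (metis Pr_def fst_conv snd_conv)+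
  have "h1 L (flux (Wf x)) (rep_l2 (kk x))"
    by (rule h1_cong[OF h1_Qf]) (simp_all add: flux_def dd_Wf pD)
  from cls_wd[OF L_nonneg this] have "cls L (wd L (flux (Wf x))) = kk x" using k by simp
  moreover have "cls L (wd L (Vf x)) = pp x" using cls_wd[OF L_nonneg h1_Vf, of x] k by simp
  ultimately show ?thesis
    by (simp add: tox_def fromx_def dd_Wf[OF L_in(1)] Df_L Wf_0 Vf_0)
qed

lemma dd_add:
  assumes "z1 \<in> Hsp L" "z2 \<in> Hsp L" "t \<in> {0..L}"
  shows "dd L (\<lambda>x. sw z1 x + sw z2 x) t = dd L (sw z1) t + dd L (sw z2) t"
  by (rule h1_dd[OF L h1_add[OF Hsp_D(6) Hsp_D(6)]]) (use assms Hsp_D(7) in \<open>auto intro: continuous_on_add\<close>)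

lemma dd_cmult:
  assumes "z \<in> Hsp L" "t \<in> {0..L}"
  shows "dd L (\<lambda>x. c * sw z x) t = c * dd L (sw z) t"
  by (rule h1_dd[OF L h1_cmult[OF Hsp_D(6)]]) (use assms Hsp_D(7) in \<open>auto intro: continuous_on_mult\<close>)

lemma Hsp_add: "z1 \<in> Hsp L \<Longrightarrow> z2 \<in> Hsp L \<Longrightarrow> st_add z1 z2 \<in> Hsp L"
  by (auto simp: Hsp_def st_add_def intro: sob_add)

lemma Hsp_scale: "z \<in> Hsp L \<Longrightarrow> st_scale c z \<in> Hsp L"
  by (auto simp: Hsp_def st_scale_def intro: sob_cmult)

lemma Hsp_diff: "z1 \<in> Hsp L \<Longrightarrow> z2 \<in> Hsp L \<Longrightarrow> st_diff z1 z2 \<in> Hsp L"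
  unfolding st_diff_def by (intro Hsp_add Hsp_scale)

lemma tox_add:
  assumes z: "z1 \<in> Hsp L" "z2 \<in> Hsp L"
  shows "tox (st_add z1 z2) = tox z1 + tox z2"
proof -
  note 1 = Hsp_D[OF z(1)] and 2 = Hsp_D[OF z(2)]
  have "h1 L (flux (\<lambda>x. sw z1 x + sw z2 x)) (\<lambda>t. wd L (flux (sw z1)) t + wd L (flux (sw z2)) t)"
    by (rule h1_cong[OF h1_add[OF 1(10) 2(10)]]) (simp_all add: flux_def dd_add[OF z] algebra_simps)
  from cls_wd[OF L_nonneg this]
  have "cls L (wd L (flux (\<lambda>x. sw z1 x + sw z2 x))) = cls L (wd L (flux (sw z1))) + cls L (wd L (flux (sw z2)))"
    using cls_add[OF h1_L2[OF 1(10)] h1_L2[OF 2(10)]] by simp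
  moreover have "cls L (wd L (\<lambda>x. sv z1 x + sv z2 x)) = cls L (wd L (sv z1)) + cls L (wd L (sv z2))"
    using cls_wd[OF L_nonneg h1_add[OF 1(9) 2(9)]] cls_add[OF h1_L2[OF 1(9)] h1_L2[OF 2(9)]] by simp
  ultimately show ?thesis by (simp add: tox_def st_add_def dd_add[OF z L_in(1)])
qed

lemma tox_scale:
  assumes z: "z \<in> Hsp L"
  shows "tox (st_scale c z) = Jop c (tox z)"
proof -
  note 1 = Hsp_D[OF z]
  have r: "cls L (\<lambda>t. c * rep_l2 (cls L f) t) = cls L (\<lambda>t. c * f t)" if "L2 L f" for f
    by (rule cls_cmult_cong) (simp_all add: that)
  have "h1 L (flux (\<lambda>x. c * sw z x)) (\<lambda>t. c * wd L (flux (sw z)) t)"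
    by (rule h1_cong[OF h1_cmult[OF 1(10), of c]]) (simp_all add: flux_def dd_cmult[OF z] algebra_simps)
  from cls_wd[OF L_nonneg this]
  have "cls L (wd L (flux (\<lambda>x. c * sw z x))) = cls L (\<lambda>t. c * rep_l2 (cls L (wd L (flux (sw z)))) t)"
    unfolding r[OF h1_L2[OF 1(10)]] .
  moreover have "cls L (wd L (\<lambda>x. c * sv z x)) = cls L (\<lambda>t. c * rep_l2 (cls L (wd L (sv z))) t)"
    unfolding r[OF h1_L2[OF 1(9)]] by (rule cls_wd[OF L_nonneg h1_cmult[OF 1(9)]])
  ultimately show ?thesis by (simp add: tox_def Jop_def st_scale_def dd_cmult[OF z L_in(1)])
qed

lemma Jop_of_real: assumes x: "Pr x = x" shows "Jop (of_real r) x = r *\<^sub>R x"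
proof -
  have "cls L (\<lambda>t. of_real r * rep_l2 y t) = r *\<^sub>R cls L (rep_l2 y)" for y
    using cls_scaleR[OF L2_rep, of L r y] by (simp add: scaleR_conv_of_real)
  then have "Jop (of_real r) x = r *\<^sub>R Pr x"
    by (simp add: Jop_def Pr_def prod_eq_iff scaleR_conv_of_real)
  then show ?thesis by (simp add: x)
qed

lemma tox_diff:
  assumes z: "z1 \<in> Hsp L" "z2 \<in> Hsp L"
  shows "tox (st_diff z1 z2) = tox z1 - tox z2"
  unfolding st_diff_def tox_add[OF z(1) Hsp_scale[OF z(2)]] tox_scale[OF z(2)]
  using Jop_of_real[OF Pr_tox[OF z(2)], of "-1"] by simp

section \<open>Equivalence of the state norm and the coordinate norm\<close>

lemma Hnorm_sq:
  assumes z: "z \<in> Hsp L"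
  shows "(Hnorm L z)\<^sup>2 = (norm (cls L (sw z)))\<^sup>2 + (norm (cls L (dd L (sw z))))\<^sup>2 + (norm (cls L (wd L (dd L (sw z)))))\<^sup>2
     + (norm (cls L (sv z)))\<^sup>2 + (norm (cls L (wd L (sv z))))\<^sup>2 + (cmod (sv z L))\<^sup>2 + (cmod (sv z 0))\<^sup>2"
  using Hsp_D[OF z] by (simp add: Hnorm_def h2sq_def h1sq_def l2sq_cls sob_L2 h1_L2 L2_continuous h1_continuous)

lemma Hnorm_nonneg: "z \<in> Hsp L \<Longrightarrow> Hnorm L z \<ge> 0"
  using Hsp_D[of z] unfolding Hnorm_def
  by (intro real_sqrt_ge_zero) (simp add: h2sq_def h1sq_def l2sq_cls sob_L2 h1_L2 L2_continuous h1_continuous)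

text \<open>The product rule for \<open>w' = q * flux w\<close>, which expresses \<open>w''\<close>
  through the coordinates.\<close>

lemma h1_dd_sw:
  assumes z: "z \<in> Hsp L"
  shows "h1 L (dd L (sw z)) (\<lambda>t. - (dd L p t * (q t * q t)) * Qf (tox z) t + q t * wd L (flux (sw z)) t)"
  by (rule h1_cong[OF h1_mult[OF sob_inverse(2)[OF L sob_p p_nz] Hsp_D(10)[OF z]]])
     (simp_all add: q_flux[unfolded q_def] Qf_tox[OF z] q_def)

lemma cont_dd_p: "continuous_on {0..L} (dd L p)"
  by (rule sob_continuous[OF sob_dd(1)[OF L sob_p]])

text \<open>Every function in the state norm is a bounded linear image of the coordinates; for
  \<open>w''\<close> this is \<open>h1_dd_sw\<close>.\<close>

lemma Hnorm_upper: "\<exists>C. \<forall>z\<in>Hsp L. Hnorm L z \<le> C * norm (tox z)"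
proof -
  let ?m = "\<lambda>t. - (dd L p t * (q t * q t))"
  have cm: "continuous_on {0..L} ?m" by (intro continuous_intros cont_dd_p cont_q)
  \<comment> \<open>The class of \<open>w''\<close> as a bounded linear function of the
    coordinates.\<close>
  define B where "B x = cls L (\<lambda>t. ?m t * Qf x t) + cls L (\<lambda>t. q t * rep_l2 (kk x) t)" for x
  have bl: "bounded_linear B"
    unfolding B_def[abs_def]
    by (intro bounded_linear_add lin_fam_cls lin_fam_mult lin_Qf cm L_nonneg
        bounded_linear_compose[OF bounded_linear_mult_cls[OF cont_q]] bounded_linear_coord)
  note nb = bounded_linear.nonneg_bounded
  obtain K1 where K1: "\<And>x. norm (cls L (Wf x)) \<le> norm x * K1" using nb[OF lin_fam_cls[OF lin_Wf L_nonneg]] by blast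
  obtain K2 where K2: "\<And>x. norm (cls L (Df x)) \<le> norm x * K2" using nb[OF lin_fam_cls[OF lin_Df L_nonneg]] by blast
  obtain K3 where K3: "\<And>x. norm (B x) \<le> norm x * K3" using nb[OF bl] by blast
  obtain K4 where K4: "\<And>x. norm (cls L (Vf x)) \<le> norm x * K4" using nb[OF lin_fam_cls[OF lin_Vf L_nonneg]] by blast
  obtain K5 where K5: "\<And>x. cmod (Vf x L) \<le> norm x * K5" using nb[OF lin_fam_eval[OF lin_Vf L_in(1)]] by blast
  \<comment> \<open>The two summands 1 stand for \<open>v'\<close> and \<open>v(0)\<close>, which
    are coordinates themselves.\<close>
  define C where "C = sqrt (K1\<^sup>2 + K2\<^sup>2 + K3\<^sup>2 + K4\<^sup>2 + 1 + K5\<^sup>2 + 1)"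
  have "Hnorm L z \<le> C * norm (tox z)" if z: "z \<in> Hsp L" for z
  proof (rule power2_le_imp_le)
    define x where "x = tox z"
    note H = Hsp_D[OF z]
    have 1: "cls L (sw z) = cls L (Wf x)" "cls L (dd L (sw z)) = cls L (Df x)" "cls L (sv z) = cls L (Vf x)"
      unfolding x_def by (rule cls_cong; simp add: Wf_tox[OF z] Df_tox[OF z] Vf_tox[OF z])+
    have 2: "cls L (wd L (dd L (sw z))) = B x"
    proof -
      note h = h1_dd_sw[OF z, folded x_def]
      have L2m: "L2 L (\<lambda>t. ?m t * Qf x t)" by (intro L2_mult_continuous cm lin_fam_L2[OF lin_Qf])
      have L2q: "L2 L (\<lambda>t. q t * wd L (flux (sw z)) t)" by (intro L2_mult_continuous cont_q h1_L2[OF H(10)])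
      have L2q': "L2 L (\<lambda>t. q t * rep_l2 (kk x) t)" by (intro L2_mult_continuous cont_q L2_rep)
      have "cls L (\<lambda>t. q t * rep_l2 (kk x) t) = cls L (\<lambda>t. q t * wd L (flux (sw z)) t)"
        unfolding cls_eq_iff[OF L2q' L2q] unfolding x_def coord_tox using rep_cls[OF h1_L2[OF H(10)]] by eventually_elim simp
      then show ?thesis
        unfolding cls_wd[OF L_nonneg h] cls_add[OF L2m L2q] B_def by simp
    qed
    have 3: "cls L (wd L (sv z)) = pp x" "sv z L = Vf x L" "sv z 0 = ss x"
      using Vf_tox[OF z L_in(1)] by (simp_all add: x_def coord_tox)
    have sq: "u\<^sup>2 \<le> K\<^sup>2 * (norm x)\<^sup>2" if "u \<le> norm x * K" "u \<ge> 0" for u K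
      using power_mono[OF that, of 2] by (simp add: power_mult_distrib mult.commute)
    have "(Hnorm L z)\<^sup>2 \<le> K1\<^sup>2 * (norm x)\<^sup>2 + K2\<^sup>2 * (norm x)\<^sup>2 + K3\<^sup>2 * (norm x)\<^sup>2 + K4\<^sup>2 * (norm x)\<^sup>2
        + (norm x)\<^sup>2 + K5\<^sup>2 * (norm x)\<^sup>2 + (norm x)\<^sup>2"
      unfolding Hnorm_sq[OF z] 1 2 3
      by (intro add_mono sq K1 K2 K3 K4 K5 norm_ge_zero power_mono norm_component_le)
    also have "\<dots> = (C * norm (tox z))\<^sup>2"
      by (simp add: C_def x_def power_mult_distrib algebra_simps add_nonneg_nonneg)
    finally show "(Hnorm L z)\<^sup>2 \<le> (C * norm (tox z))\<^sup>2" .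
  qed (simp add: C_def)
  then show ?thesis by blast
qed

text \<open>Expanding \<open>(P w')'\<close> as \<open>P' w' + P w''\<close> controls the first
  coordinate, and \<open>h1_sup_bound\<close> controls the values \<open>w(0)\<close> and
  \<open>w'(L)\<close>.\<close>

lemma Hnorm_lower: "\<exists>C. \<forall>z\<in>Hsp L. norm (tox z) \<le> C * Hnorm L z"
proof -
  obtain K1 where K1: "K1 \<ge> 0" "\<And>f. L2 L f \<Longrightarrow> norm (cls L (\<lambda>t. dd L p t * f t)) \<le> K1 * norm (cls L f)"
    using norm_cls_mult_le[OF cont_dd_p] by blast
  obtain K2 where K2: "K2 \<ge> 0" "\<And>f. L2 L f \<Longrightarrow> norm (cls L (\<lambda>t. p t * f t)) \<le> K2 * norm (cls L f)"
    using norm_cls_mult_le[OF cont_p] by blast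
  \<comment> \<open>The constant in \<open>h1_sup_bound\<close> when both norms there are at most
    \<open>N\<close>.\<close>
  define K where "K = (1 + 2 * L) / sqrt L"
  have "norm (tox z) \<le> (K1 + K2 + 1 + K + K + 1) * Hnorm L z" if z: "z \<in> Hsp L" for z
  proof -
    note H = Hsp_D[OF z]
    define N where "N = Hnorm L z"
    have N: "N \<ge> 0" using Hnorm_nonneg[OF z] by (simp add: N_def)
    have b: "norm (cls L (sw z)) \<le> N" "norm (cls L (dd L (sw z))) \<le> N" "norm (cls L (wd L (dd L (sw z)))) \<le> N"
      "norm (cls L (wd L (sv z))) \<le> N" "cmod (sv z 0) \<le> N"
      by (rule power2_le_imp_le[OF _ N], simp add: N_def Hnorm_sq[OF z])+
    have sup: "cmod (f t) \<le> K * N" if "h1 L f f'" "norm (cls L f) \<le> N" "norm (cls L f') \<le> N" "t \<in> {0..L}" for f f' t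
    proof -
      have "sqrt L * cmod (f t) \<le> norm (cls L f) + 2 * L * norm (cls L f')" by (rule h1_sup_bound[OF L that(1,4)])
      also have "\<dots> \<le> N + 2 * L * N" using that L by (intro add_mono mult_left_mono) auto
      finally show ?thesis using L by (simp add: K_def field_simps)
    qed
    have "cmod (be (tox z)) \<le> K * N" unfolding coord_tox by (rule sup[OF H(6) b(1,2) L_in(2)])
    moreover have "cmod (al (tox z)) \<le> K * N" unfolding coord_tox by (rule sup[OF H(11) b(2,3) L_in(1)])
    moreover have "cmod (ss (tox z)) \<le> N" unfolding coord_tox by (rule b)
    moreover have "norm (pp (tox z)) \<le> N" unfolding coord_tox by (rule b)
    moreover have "norm (kk (tox z)) \<le> K1 * N + K2 * N"
    proof -
      have h: "h1 L (flux (sw z)) (\<lambda>t. dd L p t * dd L (sw z) t + p t * wd L (dd L (sw z)) t)"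
        unfolding flux_def[abs_def] by (rule h1_mult[OF sob_dd(2)[OF L sob_p] H(11)])
      have L2: "L2 L (dd L (sw z))" "L2 L (wd L (dd L (sw z)))" using H(7,11) by (auto intro: L2_continuous h1_L2)
      have "kk (tox z) = cls L (\<lambda>t. dd L p t * dd L (sw z) t) + cls L (\<lambda>t. p t * wd L (dd L (sw z)) t)"
        unfolding coord_tox cls_wd[OF L_nonneg h]
        by (intro cls_add L2_mult_continuous cont_dd_p cont_p L2)
      also have "norm \<dots> \<le> K1 * norm (cls L (dd L (sw z))) + K2 * norm (cls L (wd L (dd L (sw z))))"
        by (intro norm_triangle_le add_mono K1 K2 L2)
      also have "\<dots> \<le> K1 * N + K2 * N" by (rule add_mono[OF mult_left_mono[OF b(2) K1(1)] mult_left_mono[OF b(3) K2(1)]])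
      finally show ?thesis .
    qed
    ultimately have "norm (tox z) \<le> K1 * N + K2 * N + N + K * N + K * N + N"
      using norm_coord_le[of "tox z"] by linarith
    then show ?thesis by (simp add: N_def algebra_simps)
  qed
  then show ?thesis by blast
qed

section \<open>The domain and the generated semigroup\<close>

abbreviation "DAg \<equiv> DA L P th1 th2 th3 th4"
abbreviation "Ag \<equiv> Aop L P th1 th2 th3 th4"

text \<open>\<open>G\<close> undoes the operator coordinate by coordinate. For \<open>w(0)\<close>,
  both sides satisfy the same boundary relation at \<open>0\<close>, which can be solved because
  \<open>th3\<close> is nonzero.\<close>

lemma DA_tox:
  assumes z: "z \<in> DAg"
  shows "z \<in> Hsp L" "Ag z \<in> Hsp L" "tox z = G (tox (Ag z))"
proof -
  have w: "sob (Suc (Suc (Suc 0))) L (sw z)" and v: "sob (Suc (Suc 0)) L (sv z)"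
    and bc: "sxi z = sv z L" "spsi z = sv z 0" "dd L (flux (sw z)) L = - dd L (sw z) L"
      "dd L (flux (sw z)) 0 = Fb L th1 th2 th3 th4 z"
    using z by (simp_all add: DA_def flux_d_eq numeral_2_eq_2 numeral_3_eq_3)
  show zH: "z \<in> Hsp L" using sob_Suc_imp[OF w] sob_Suc_imp[OF v] bc by (simp add: Hsp_def numeral_2_eq_2)
  note H = Hsp_D[OF zH]
  have fl: "sob (Suc (Suc 0)) L (flux (sw z))"
    unfolding flux_def[abs_def] by (rule sob_mult[OF sob_p sob_dd(1)[OF L w]])
  note F = sob_dd[OF L fl]
  have A: "sw (Ag z) = sv z" "sv (Ag z) = dd L (flux (sw z))" "sxi (Ag z) = - dd L (sw z) L" "spsi (Ag z) = Fb L th1 th2 th3 th4 z"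
    by (simp_all add: Aop_def flux_d_eq)
  show AH: "Ag z \<in> Hsp L" using v F(1) bc by (simp add: Hsp_def A numeral_2_eq_2)
  define x where "x = tox (Ag z)"
  have V: "Vf x t = dd L (flux (sw z)) t" and D: "Df x t = dd L (sv z) t" if "t \<in> {0..L}" for t
    using Vf_tox[OF AH that] Df_tox[OF AH that] by (simp_all add: x_def A)
  have k: "kk (tox z) = kk (G x)"
    unfolding coord_tox coord_G cls_wd[OF L_nonneg F(2)] by (rule cls_cong) (simp add: V)
  have pq: "pp (tox z) = pp (G x)"
    unfolding coord_tox coord_G cls_wd[OF L_nonneg sob_dd(2)[OF L v]] by (rule cls_cong) (simp add: D)
  have al: "al (tox z) = al (G x)"
    unfolding coord_tox coord_G V[OF L_in(1)] bc by simp
  have be: "be x = sv z 0" by (simp add: x_def coord_tox A)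
  have s: "ss x = Fb L th1 th2 th3 th4 z" using V[OF L_in(2)] bc by (simp add: Vf_0)
  have "Df (tox z) 0 = Df (G x) 0" unfolding Df_def Qf_def k al ..
  then have D0: "Df (G x) 0 = dd L (sw z) 0" using Df_tox[OF zH L_in(2)] by simp
  have "th3 * be (G x) = th3 * sw z 0"
    using boundary_G[of x] unfolding be s D[OF L_in(2)] D0 by (simp add: Fb_def)
  then have b: "be (tox z) = be (G x)" using th3 by (simp add: coord_tox)
  have "ss (tox z) = ss (G x)" by (simp add: coord_tox coord_G be)
  with k pq al b show "tox z = G (tox (Ag z))" unfolding x_def by (simp add: prod_eq_iff)
qed

text \<open>Regularity comes from \<open>y\<close>: \<open>v\<close> of \<open>z\<close> equals the
  \<open>H^2\<close> function \<open>w\<close> of \<open>y\<close>, and the flux of \<open>z\<close>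
  has the \<open>H^1\<close> function \<open>v\<close> of \<open>y\<close> as derivative, so
  division by \<open>P\<close> puts \<open>w'\<close> in \<open>H^2\<close>.\<close>

lemma DA_I:
  assumes z: "z \<in> Hsp L" and y: "y \<in> Hsp L" and e: "tox z = G (tox y)"
  shows "z \<in> DAg"
proof -
  define x where "x = tox y"
  note Hz = Hsp_D[OF z] and Hy = Hsp_D[OF y]
  have v: "sv z t = sw y t" if "t \<in> {0..L}" for t
    using Vf_tox[OF z that] Vf_G[OF that] Wf_tox[OF y that] by (simp add: e)
  have sv: "sob (Suc (Suc 0)) L (sv z)" by (rule sob_cong[OF Hy(1)]) (simp add: v)
  have ddv: "dd L (sv z) 0 = dd L (sw y) 0"
    by (rule h1_dd[OF L h1_cong[OF Hy(6)] Hy(7) L_in(2)]) (simp_all add: v)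
  have hf: "h1 L (flux (sw z)) (sv y)"
    by (rule h1_cong[OF h1_Qf_G[of "tox y"]]) (simp_all add: Qf_tox[OF z, unfolded e] Vf_tox[OF y])
  have fl: "sob (Suc (Suc 0)) L (flux (sw z))" by (rule sob_SucI[OF Hy(2) hf])
  have "sob (Suc (Suc 0)) L (dd L (sw z))"
    by (rule sob_cong[OF sob_mult[OF sob_q fl]]) (simp add: q_flux)
  then have w: "sob (Suc (Suc (Suc 0))) L (sw z)" by (rule sob_SucI[OF _ Hz(6)])
  have F: "dd L (flux (sw z)) t = sv y t" if "t \<in> {0..L}" for t
    by (rule h1_dd[OF L hf sob_continuous[OF Hy(2)] that])
  have "dd L (sw z) L = - Vf x L"
    using coord_tox(3)[of z] unfolding e x_def coord_G by simp
  then have bL: "dd L (flux (sw z)) L = - dd L (sw z) L" using F[OF L_in(1)] Vf_tox[OF y L_in(1)] by (simp add: x_def)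
  have "th1 * be x + th2 * Df x 0 + th3 * be (G x) + th4 * Df (G x) 0 = ss x" by (rule boundary_G)
  moreover have "be x = sv z 0" using v[OF L_in(2)] by (simp add: x_def coord_tox)
  moreover have "Df x 0 = dd L (sv z) 0" using Df_tox[OF y L_in(2)] by (simp add: x_def ddv)
  moreover have "be (G x) = sw z 0" by (simp add: x_def e[symmetric] coord_tox)
  moreover have "Df (G x) 0 = dd L (sw z) 0" using Df_tox[OF z L_in(2)] by (simp add: x_def e)
  moreover have "ss x = dd L (flux (sw z)) 0" using F[OF L_in(2)] by (simp add: x_def coord_tox)
  ultimately have b0: "dd L (flux (sw z)) 0 = Fb L th1 th2 th3 th4 z" by (simp add: Fb_def)
  show ?thesis using w sv Hz(3,4) bL b0 by (simp add: DA_def flux_d_eq numeral_2_eq_2 numeral_3_eq_3)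
qed

lemma generation:
  "\<exists>T. c0_semigroup L T \<and> uniformly_bounded L T \<and> is_generator L DAg Ag T"
proof -
  obtain C0 where C0: "\<And>x. Pr x = x \<Longrightarrow> norm x \<le> C0 * norm (\<Phi> x)" using \<Phi>_lower by blast
  obtain K where K: "\<And>x. norm (\<Phi> x) \<le> norm x * K"
    using bounded_linear.nonneg_bounded[OF bounded_linear_\<Phi>] by blast
  show ?thesis
  proof (rule semigroup_on_projection[OF bounded_linear_Pr bounded_linear_G bounded_linear_\<Phi> Pr_Pr G_Pr Pr_G \<Phi>_Pr G_inj C0 diss], goal_cases)
    case T: (4 T)
    define C where "C = \<bar>C0\<bar> * K"
    have TJ: "T t (Jop c x) = Jop c (T t x)" if "t \<ge> 0" for t x c
      by (rule T(8)[OF bounded_linear_Jop Jop_Pr Jop_G that])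
    have TC: "norm (T t x) \<le> C * norm x" if t: "t \<ge> 0" "Pr x = x" for t x
    proof -
      have "norm (T t x) \<le> C0 * norm (\<Phi> (T t x))" by (rule C0[OF T(1)[OF t]])
      also have "\<dots> \<le> \<bar>C0\<bar> * (norm x * K)"
        using order_trans[OF T(3)[OF t] K] by (intro mult_mono) auto
      finally show ?thesis by (simp add: C_def mult_ac)
    qed
    obtain C1 where C1: "\<And>z. z \<in> Hsp L \<Longrightarrow> Hnorm L z \<le> C1 * norm (tox z)" using Hnorm_upper by blast
    obtain C2 where C2: "\<And>z. z \<in> Hsp L \<Longrightarrow> norm (tox z) \<le> C2 * Hnorm L z" using Hnorm_lower by blast
    define S where "S t z = fromx (T t (tox z))" for t z
    have SH: "S t z \<in> Hsp L" for t z by (simp add: S_def fromx_Hsp)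
    have toxS: "tox (S t z) = T t (tox z)" if "t \<ge> 0" "z \<in> Hsp L" for t z
      unfolding S_def by (rule tox_fromx[OF T(1)[OF that(1) Pr_tox[OF that(2)]]])
    \<comment> \<open>Equal coordinates determine a state only on \<open>[0,L]\<close>, hence
      \<open>Heq\<close> rather than equality.\<close>
    have HeqI: "Heq L u v" if uv: "u \<in> Hsp L" "v \<in> Hsp L" "tox u = tox v" for u v
    proof -
      have "Hnorm L (st_diff u v) \<le> C1 * norm (tox (st_diff u v))" by (rule C1[OF Hsp_diff[OF uv(1,2)]])
      then show ?thesis using Hnorm_nonneg[OF Hsp_diff[OF uv(1,2)]] uv(3) by (simp add: Heq_def tox_diff[OF uv(1,2)])
    qed
    \<comment> \<open>By the two norm bounds, limits in the state space are limits of coordinates,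
      where the abstract semigroup lives.\<close>
    have lim: "((\<lambda>h. Hnorm L (f h)) \<longlongrightarrow> 0) (at_right 0) \<longleftrightarrow> ((\<lambda>h. tox (f h)) \<longlongrightarrow> 0) (at_right 0)"
      if f: "\<And>h. f h \<in> Hsp L" for f :: "real \<Rightarrow> st"
    proof
      assume "((\<lambda>h. Hnorm L (f h)) \<longlongrightarrow> 0) (at_right 0)"
      from tendsto_mult_left[OF this, of C2] show "((\<lambda>h. tox (f h)) \<longlongrightarrow> 0) (at_right 0)"
        by - (rule Lim_null_comparison[of _ "\<lambda>h. C2 * Hnorm L (f h)"], simp_all add: C2[OF f])
    next
      assume "((\<lambda>h. tox (f h)) \<longlongrightarrow> 0) (at_right 0)"
      from tendsto_mult_left[OF tendsto_norm_zero[OF this], of C1] show "((\<lambda>h. Hnorm L (f h)) \<longlongrightarrow> 0) (at_right 0)"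
        by - (rule Lim_null_comparison[of _ "\<lambda>h. C1 * norm (tox (f h))"], simp_all add: C1[OF f] Hnorm_nonneg[OF f])
    qed
    have bnd: "Hnorm L (S t z) \<le> (\<bar>C1\<bar> * \<bar>C\<bar> * \<bar>C2\<bar>) * Hnorm L z" if t: "t \<ge> 0" and z: "z \<in> Hsp L" for t z
    proof -
      have "Hnorm L (S t z) \<le> C1 * norm (T t (tox z))" using C1[OF SH[of t z]] toxS[OF t z] by simp
      also have "\<dots> \<le> \<bar>C1\<bar> * norm (T t (tox z))" by (intro mult_right_mono) auto
      also have "\<dots> \<le> \<bar>C1\<bar> * (\<bar>C\<bar> * norm (tox z))"
        using order_trans[OF TC[OF t Pr_tox[OF z]] mult_right_mono[OF abs_ge_self[of C]]] by (intro mult_left_mono) auto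
      also have "\<dots> \<le> \<bar>C1\<bar> * (\<bar>C\<bar> * (\<bar>C2\<bar> * Hnorm L z))"
        using order_trans[OF C2[OF z] mult_right_mono[OF abs_ge_self[of C2] Hnorm_nonneg[OF z]]] by (intro mult_left_mono) auto
      finally show ?thesis by (simp add: mult_ac)
    qed
    have gen: "((\<lambda>h. Hnorm L (st_diff (st_scale (of_real (1/h)) (st_diff (S h z) z)) y)) \<longlongrightarrow> 0) (at_right 0)
        \<longleftrightarrow> tox z = G (tox y)" if z: "z \<in> Hsp L" and y: "y \<in> Hsp L" for z y
    proof -
      have H: "st_diff (st_scale (of_real (1/h)) (st_diff (S h z) z)) y \<in> Hsp L" for h
        by (intro Hsp_diff Hsp_scale SH z y)
      have e: "\<forall>\<^sub>F h in at_right 0. tox (st_diff (st_scale (of_real (1/h)) (st_diff (S h z) z)) y)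
          = (1 / h) *\<^sub>R (T h (tox z) - tox z) - tox y"
        using eventually_at_right_less[of "0::real"]
      proof eventually_elim
        case (elim h)
        have d: "st_diff (S h z) z \<in> Hsp L" by (intro Hsp_diff SH z)
        show ?case
          unfolding tox_diff[OF Hsp_scale[OF d] y] tox_scale[OF d] Jop_of_real[OF Pr_tox[OF d]]
          unfolding tox_diff[OF SH z]
          using elim by (simp only: toxS[OF less_imp_le z])
      qed
      have "((\<lambda>h. Hnorm L (st_diff (st_scale (of_real (1/h)) (st_diff (S h z) z)) y)) \<longlongrightarrow> 0) (at_right 0)
        \<longleftrightarrow> ((\<lambda>h. (1 / h) *\<^sub>R (T h (tox z) - tox z) - tox y) \<longlongrightarrow> 0) (at_right 0)"
        unfolding lim[OF H] by (rule tendsto_cong[OF e])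
      also have "\<dots> \<longleftrightarrow> ((\<lambda>h. (1 / h) *\<^sub>R (T h (tox z) - tox z)) \<longlongrightarrow> tox y) (at_right 0)"
        by (rule LIM_zero_iff)
      also have "\<dots> \<longleftrightarrow> tox z = G (tox y)" by (rule T(7)[OF Pr_tox[OF z] Pr_tox[OF y]])
      finally show ?thesis .
    qed
    have "c0_semigroup L S"
      unfolding c0_semigroup_def
    proof (intro conjI allI impI ballI)
      show "S t z \<in> Hsp L" for t z by (rule SH)
      show "Heq L (S t (st_add z1 (st_scale c z2))) (st_add (S t z1) (st_scale c (S t z2)))"
        if t: "t \<ge> 0" and z: "z1 \<in> Hsp L" "z2 \<in> Hsp L" for t z1 z2 c
      proof (rule HeqI)
        interpret l: linear "T t" by (rule T(2)[OF t])
        show "tox (S t (st_add z1 (st_scale c z2))) = tox (st_add (S t z1) (st_scale c (S t z2)))"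
          using t z by (simp add: toxS tox_add tox_scale Hsp_add Hsp_scale SH l.add TJ)
      qed (intro SH Hsp_add Hsp_scale)+
      show "\<exists>M. \<forall>z\<in>Hsp L. Hnorm L (S t z) \<le> M * Hnorm L z" if "t \<ge> 0" for t
        using bnd[OF that] by blast
      show "Heq L (S 0 z) z" if "z \<in> Hsp L" for z
        by (rule HeqI[OF SH that]) (simp add: toxS that T(4))
      show "Heq L (S (t + s) z) (S t (S s z))" if "t \<ge> 0" "s \<ge> 0" "z \<in> Hsp L" for t s z
        by (rule HeqI[OF SH SH]) (simp add: toxS that SH T(5))
      show "((\<lambda>t. Hnorm L (st_diff (S t z) z)) \<longlongrightarrow> 0) (at_right 0)" if z: "z \<in> Hsp L" for z
      proof -
        have e: "\<forall>\<^sub>F t in at_right 0. tox (st_diff (S t z) z) = T t (tox z) - tox z"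
          using eventually_at_right_less[of "0::real"]
          by eventually_elim (simp add: tox_diff SH z toxS)
        show ?thesis
          unfolding lim[OF Hsp_diff[OF SH z]] tendsto_cong[OF e] LIM_zero_iff by (rule T(6))
      qed
    qed
    moreover have "uniformly_bounded L S"
      unfolding uniformly_bounded_def using bnd by blast
    moreover have "is_generator L DAg Ag S"
      unfolding is_generator_def
    proof (intro conjI ballI)
      show "DAg \<subseteq> Hsp L" using DA_tox(1) by blast
      \<comment> \<open>From left to right the witness is \<open>Ag z\<close>; conversely a limit
        \<open>y\<close> of the difference quotients gives \<open>tox z = G (tox y)\<close>, and
        \<open>DA_I\<close> applies.\<close>
      show "z \<in> DAg \<longleftrightarrow> (\<exists>y\<in>Hsp L. ((\<lambda>h. Hnorm L (st_diff (st_scale (of_real (1/h)) (st_diff (S h z) z)) y)) \<longlongrightarrow> 0) (at_right 0))"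
        if z: "z \<in> Hsp L" for z
        using gen[OF z] DA_tox(2,3)[of z] DA_I[OF z] by blast
      show "Ag z \<in> Hsp L" if "z \<in> DAg" for z by (rule DA_tox(2)[OF that])
      show "((\<lambda>h. Hnorm L (st_diff (st_scale (of_real (1/h)) (st_diff (S h z) z)) (Ag z))) \<longlongrightarrow> 0) (at_right 0)"
        if "z \<in> DAg" for z
        unfolding gen[OF DA_tox(1,2)[OF that]] by (rule DA_tox(3)[OF that])
    qed
    ultimately show ?case by blast
  qed
qed

end

theorem theorem2p2:
  fixes L P0 a b th1 th2 th3 th4 :: real and P :: "real \<Rightarrow> real"
  assumes "L > 0"
    and "sob 2 L P"
    and "P0 > 0" and "\<forall>x\<in>{0..L}. P x \<ge> P0"
    and "a > 0" and "b > 0" and "(a + b - 1)\<^sup>2 < 4 * a * b"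
    and "th1 = th3 / b - a" and "th2 = th4 / b"
    and "th1 < 0" and "th3 < 0" and "th2 > 0" and "th4 > 0"
  shows "\<exists>T. c0_semigroup L T \<and> uniformly_bounded L T
             \<and> is_generator L (DA L P th1 th2 th3 th4) (Aop L P th1 th2 th3 th4) T"
proof -
  interpret gantry L P0 a b th1 th2 th3 th4 P
    using assms by unfold_locales auto
  show ?thesis by (rule generation)
qed

end
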